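(* Let $\Lambda$ be a $2$-graph that is row-finite and has no sources, with vertex set $V=\bigsqcup_{n\in\mathbb Z}V_n$, where the $V_n$ are disjoint non-empty sets of finitely many vertices, such that: (1) each blue edge $f$ has $s(f)\in V_n$ and $r(f)\in V_{n+1}$ for some $n\in\mathbb Z$; (2) each vertex in $V_n$ is on exactly one red cycle, whose vertices are all in $V_n$; (3) there exists $N$ such that $|V_n|=1$ for all $n\ge N$, and there exists exactly one blue edge from $V_n$ to $V_{n+1}$ for all $n\ge N$. Then the C*-algebra $C^*(\Lambda)$ is Morita equivalent to $C(\mathbb T)$.
   Context: A $2$-graph is a small category $\Lambda$ with a functor $d\colon\Lambda\to\mathbb N^2$ satisfying the factorization property: whenever $d(\lambda)=m+n$ with $m,n\in\mathbb N^2$, there exist unique $\mu,\nu\in\Lambda$ with $\lambda=\mu\nu$, $d(\mu)=m$, $d(\nu)=n$. It is treated as a directed graph on the vertex set $d^{-1}(0)$ whose edges are coloured red or blue, each colour corresponding to one of the two copies of $\mathbb N$ in $\mathbb N^2$; $r$ and $s$ denote range and source. $\Lambda$ is row-finite if for each vertex $v$ there are finitely many edges with range $v$. A vertex $v$ is a source if there is no red or blue edge that has range $v$. Infinite paths: $\Omega_2$ is the $2$-graph with vertex set $\mathbb N^2$ and one morphism $(m,n)$ for each pair $m\le n$ in $\mathbb N^2$ (coordinatewise order), with $r(m,n)=n$, $s(m,n)=m$, $d(m,n)=n-m$. The infinite path space is $Y=\Lambda^\infty=\{x\colon\Omega_2\to\Lambda : x \text{ is a }2\text{-graph morphism (degree-preserving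 functor)}\}$, with the usual topology generated by cylinder sets. The shift maps $\sigma_b,\sigma_r\colon Y\to Y$ along blue and red edges commute and give an action $\sigma$ of $\mathbb N^2$ on $Y$. The path groupoid of $\Lambda$ is $Y\rtimes_\sigma\mathbb N^2=\{(x,p-q,y)\in Y\times\mathbb Z^2\times Y: p,q\in\mathbb N^2,\ \sigma^p(x)=\sigma^q(y)\}$ with $(x,k,y)(y,l,z)=(x,k+l,z)$, $(x,k,y)^{-1}=(y,-k,x)$, and basic open sets $\{(x,p-q,y): x\in U,\ y\in W,\ \sigma^p(x)=\sigma^q(y)\}$ for open $U,W\subseteq Y$ and $p,q\in\mathbb N^2$. $C^*(\Lambda)$ denotes the higher-rank graph C*-algebra of $\Lambda$ (Kumjian–Pask, defined by Cuntz–Krieger relations), identified with the C*-algebra of the path groupoid $Y\rtimes_\sigma\mathbb N^2$.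
   Formalization: Condition (2) is supplemented: every red edge must have both ends in the same V_n. Otherwise the claim fails, e.g. for V_n={v_n} with one blue edge v_n→v_{n+1}, a red loop at v_n and a further red edge v_n→v_{n+1} (infinite projections). *)

theory Defs
  imports "HOL-Analysis.Analysis" "Graph_Theory.Arc_Walk"
begin

section \<open>2-graphs\<close>

text \<open>
  A small category is given by its set of morphisms; an object is identified with its identity
  morphism, so range and source are identity morphisms. The composite of \<open>\<lambda>\<close> and \<open>\<mu>\<close>, written
  \<open>\<lambda>\<mu>\<close> on paper, is defined when the source of \<open>\<lambda>\<close> is the range of \<open>\<mu>\<close>.
\<close>

record 'a two_graph =
  mor :: "'a set"
  rng :: "'a \<Rightarrow> 'a"
  src :: "'a \<Rightarrow> 'a"
  cmp :: "'a \<Rightarrow> 'a \<Rightarrow> 'a"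
  deg :: "'a \<Rightarrow> nat \<times> nat"

locale small_category =
  fixes \<Lambda> :: "('a, 'm) two_graph_scheme"
  assumes rng_mor: "l \<in> mor \<Lambda> \<Longrightarrow> rng \<Lambda> l \<in> mor \<Lambda>"
    and src_mor: "l \<in> mor \<Lambda> \<Longrightarrow> src \<Lambda> l \<in> mor \<Lambda>"
    and rng_rng: "l \<in> mor \<Lambda> \<Longrightarrow> rng \<Lambda> (rng \<Lambda> l) = rng \<Lambda> l"
    and src_rng: "l \<in> mor \<Lambda> \<Longrightarrow> src \<Lambda> (rng \<Lambda> l) = rng \<Lambda> l"
    and rng_src: "l \<in> mor \<Lambda> \<Longrightarrow> rng \<Lambda> (src \<Lambda> l) = src \<Lambda> l"
    and src_src: "l \<in> mor \<Lambda> \<Longrightarrow> src \<Lambda> (src \<Lambda> l) = src \<Lambda> l"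
    and cmp_rng: "l \<in> mor \<Lambda> \<Longrightarrow> cmp \<Lambda> (rng \<Lambda> l) l = l"
    and cmp_src: "l \<in> mor \<Lambda> \<Longrightarrow> cmp \<Lambda> l (src \<Lambda> l) = l"
    and cmp_mor: "\<lbrakk>l \<in> mor \<Lambda>; m \<in> mor \<Lambda>; src \<Lambda> l = rng \<Lambda> m\<rbrakk> \<Longrightarrow> cmp \<Lambda> l m \<in> mor \<Lambda>"
    and rng_cmp: "\<lbrakk>l \<in> mor \<Lambda>; m \<in> mor \<Lambda>; src \<Lambda> l = rng \<Lambda> m\<rbrakk> \<Longrightarrow> rng \<Lambda> (cmp \<Lambda> l m) = rng \<Lambda> l"
    and src_cmp: "\<lbrakk>l \<in> mor \<Lambda>; m \<in> mor \<Lambda>; src \<Lambda> l = rng \<Lambda> m\<rbrakk> \<Longrightarrow> src \<Lambda> (cmp \<Lambda> l m) = src \<Lambda> m"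
    and cmp_assoc: "\<lbrakk>l \<in> mor \<Lambda>; m \<in> mor \<Lambda>; k \<in> mor \<Lambda>; src \<Lambda> l = rng \<Lambda> m; src \<Lambda> m = rng \<Lambda> k\<rbrakk>
      \<Longrightarrow> cmp \<Lambda> (cmp \<Lambda> l m) k = cmp \<Lambda> l (cmp \<Lambda> m k)"

locale two_graph = small_category +
  assumes deg_rng: "l \<in> mor \<Lambda> \<Longrightarrow> deg \<Lambda> (rng \<Lambda> l) = 0"
    and deg_src: "l \<in> mor \<Lambda> \<Longrightarrow> deg \<Lambda> (src \<Lambda> l) = 0"
    and deg_cmp: "\<lbrakk>l \<in> mor \<Lambda>; m \<in> mor \<Lambda>; src \<Lambda> l = rng \<Lambda> m\<rbrakk>
      \<Longrightarrow> deg \<Lambda> (cmp \<Lambda> l m) = deg \<Lambda> l + deg \<Lambda> m"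
    and factorization: "\<lbrakk>l \<in> mor \<Lambda>; deg \<Lambda> l = p + q\<rbrakk>
      \<Longrightarrow> \<exists>!(m, n). m \<in> mor \<Lambda> \<and> n \<in> mor \<Lambda> \<and> src \<Lambda> m = rng \<Lambda> n \<and> l = cmp \<Lambda> m n
            \<and> deg \<Lambda> m = p \<and> deg \<Lambda> n = q"

definition vertices :: "('a, 'm) two_graph_scheme \<Rightarrow> 'a set" where
  "vertices \<Lambda> = {v \<in> mor \<Lambda>. deg \<Lambda> v = 0}"

definition blue_edges :: "('a, 'm) two_graph_scheme \<Rightarrow> 'a set" where
  "blue_edges \<Lambda> = {e \<in> mor \<Lambda>. deg \<Lambda> e = (1, 0)}"

definition red_edges :: "('a, 'm) two_graph_scheme \<Rightarrow> 'a set" where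
  "red_edges \<Lambda> = {e \<in> mor \<Lambda>. deg \<Lambda> e = (0, 1)}"

definition row_finite :: "('a, 'm) two_graph_scheme \<Rightarrow> bool" where
  "row_finite \<Lambda> \<longleftrightarrow>
    (\<forall>v \<in> vertices \<Lambda>. finite {e \<in> blue_edges \<Lambda> \<union> red_edges \<Lambda>. rng \<Lambda> e = v})"

definition is_source :: "('a, 'm) two_graph_scheme \<Rightarrow> 'a \<Rightarrow> bool" where
  "is_source \<Lambda> v \<longleftrightarrow> v \<in> vertices \<Lambda> \<and> \<not> (\<exists>e \<in> blue_edges \<Lambda> \<union> red_edges \<Lambda>. rng \<Lambda> e = v)"

definition red_graph :: "('a, 'm) two_graph_scheme \<Rightarrow> ('a, 'a) pre_digraph" where
  "red_graph \<Lambda> =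
    \<lparr>verts = vertices \<Lambda>, arcs = red_edges \<Lambda>, tail = src \<Lambda>, head = rng \<Lambda>\<rparr>"

text \<open>
  The library's cycles are nonempty closed edge lists without repeated vertices, loops included.
  Such a list is determined up to rotation by its set of edges, so a cycle regardless of its
  starting point is represented by that set.
\<close>

definition red_cycle :: "('a, 'm) two_graph_scheme \<Rightarrow> 'a set \<Rightarrow> bool" where
  "red_cycle \<Lambda> C \<longleftrightarrow> (\<exists>es. pre_digraph.cycle (red_graph \<Lambda>) es \<and> C = set es)"

definition cycle_vertices :: "('a, 'm) two_graph_scheme \<Rightarrow> 'a set \<Rightarrow> 'a set" where
  "cycle_vertices \<Lambda> C = src \<Lambda> ` C"

section \<open>Infinite paths\<close>

text \<open>
  In \<open>\<Omega>\<close> the morphism \<open>(m, n)\<close> runs from \<open>m\<close> to \<open>n\<close>. This is opposite to the convention of Kumjian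
  and Pask: an infinite path here starts at the vertex \<open>x (0, 0)\<close> and follows edges forwards, from
  source to range.
\<close>

definition Omega2 :: "((nat \<times> nat) \<times> (nat \<times> nat)) two_graph" where
  "Omega2 = \<lparr>mor = {(m, n). m \<le> n}, rng = (\<lambda>(m, n). (n, n)), src = (\<lambda>(m, n). (m, m)),
     cmp = (\<lambda>(m, n) (k, l). (k, n)), deg = (\<lambda>(m, n). n - m)\<rparr>"

definition two_graph_morphism ::
    "('a, 'm) two_graph_scheme \<Rightarrow> ('b, 'n) two_graph_scheme \<Rightarrow> ('a \<Rightarrow> 'b) \<Rightarrow> bool" where
  "two_graph_morphism \<Gamma> \<Lambda> x \<longleftrightarrow>
    (\<forall>l \<in> mor \<Gamma>. x l \<in> mor \<Lambda> \<and> rng \<Lambda> (x l) = x (rng \<Gamma> l) \<and> src \<Lambda> (x l) = x (src \<Gamma> l)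
       \<and> deg \<Lambda> (x l) = deg \<Gamma> l) \<and>
    (\<forall>l \<in> mor \<Gamma>. \<forall>m \<in> mor \<Gamma>. src \<Gamma> l = rng \<Gamma> m \<longrightarrow> x (cmp \<Gamma> l m) = cmp \<Lambda> (x l) (x m))"

type_synonym 'a ipath = "(nat \<times> nat) \<times> (nat \<times> nat) \<Rightarrow> 'a"

definition infinite_paths :: "('a, 'm) two_graph_scheme \<Rightarrow> 'a ipath set" where
  "infinite_paths \<Lambda> = {x \<in> extensional (mor Omega2). two_graph_morphism Omega2 \<Lambda> x}"

definition cylinder :: "('a, 'm) two_graph_scheme \<Rightarrow> 'a \<Rightarrow> 'a ipath set" where
  "cylinder \<Lambda> l = {x \<in> infinite_paths \<Lambda>. x (0, deg \<Lambda> l) = l}"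

definition path_topology :: "('a, 'm) two_graph_scheme \<Rightarrow> 'a ipath topology" where
  "path_topology \<Lambda> = topology_generated_by (cylinder \<Lambda> ` mor \<Lambda>)"

definition shift :: "nat \<times> nat \<Rightarrow> 'a ipath \<Rightarrow> 'a ipath" where
  "shift p x = restrict (\<lambda>(m, n). x (m + p, n + p)) (mor Omega2)"

section \<open>The path groupoid\<close>

text \<open>
  \<open>gmult\<close> is only meaningful on composable pairs: \<open>\<alpha>\<close> and \<open>\<beta>\<close> are composable when
  \<open>\<alpha>\<^sup>-\<^sup>1\<alpha> = \<beta>\<beta>\<^sup>-\<^sup>1\<close>.
\<close>

record 'g top_groupoid =
  arrows :: "'g set"
  gmult :: "'g \<Rightarrow> 'g \<Rightarrow> 'g"
  ginv :: "'g \<Rightarrow> 'g"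
  gtop :: "'g topology"

definition composable :: "('g, 'm) top_groupoid_scheme \<Rightarrow> 'g \<Rightarrow> 'g \<Rightarrow> bool" where
  "composable G a b \<longleftrightarrow> a \<in> arrows G \<and> b \<in> arrows G \<and> gmult G (ginv G a) a = gmult G b (ginv G b)"

definition int_diff :: "nat \<times> nat \<Rightarrow> nat \<times> nat \<Rightarrow> int \<times> int" where
  "int_diff p q = (int (fst p) - int (fst q), int (snd p) - int (snd q))"

type_synonym 'a path_arrow = "'a ipath \<times> (int \<times> int) \<times> 'a ipath"

definition path_bisets ::
    "'a ipath set \<Rightarrow> nat \<times> nat \<Rightarrow> nat \<times> nat \<Rightarrow> 'a ipath set \<Rightarrow> 'a path_arrow set" where
  "path_bisets U p q W = {(x, int_diff p q, y) |x y. x \<in> U \<and> y \<in> W \<and> shift p x = shift q y}"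

definition path_groupoid :: "('a, 'm) two_graph_scheme \<Rightarrow> 'a path_arrow top_groupoid" where
  "path_groupoid \<Lambda> =
    \<lparr>arrows = (\<Union>p q. path_bisets (infinite_paths \<Lambda>) p q (infinite_paths \<Lambda>)),
     gmult = (\<lambda>(x, k, y) (y', l, z). (x, k + l, z)),
     ginv = (\<lambda>(x, k, y). (y, - k, x)),
     gtop = topology_generated_by
       {path_bisets U p q W |U p q W. openin (path_topology \<Lambda>) U \<and> openin (path_topology \<Lambda>) W}\<rparr>"

section \<open>C*-algebras\<close>

text \<open>
  The algebras below depend on the graph, so they are carrier sets with operations rather than
  instances of type classes. No unit is assumed.
\<close>

record 'a cvect =
  vcarrier :: "'a set"
  vzero :: 'a
  vplus :: "'a \<Rightarrow> 'a \<Rightarrow> 'a"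
  vscale :: "complex \<Rightarrow> 'a \<Rightarrow> 'a"

definition vminus :: "('a, 'm) cvect_scheme \<Rightarrow> 'a \<Rightarrow> 'a \<Rightarrow> 'a" where
  "vminus E x y = vplus E x (vscale E (-1) y)"

locale complex_vector_space =
  fixes E :: "('a, 'm) cvect_scheme"
  assumes vzero_closed: "vzero E \<in> vcarrier E"
    and vplus_closed: "\<lbrakk>x \<in> vcarrier E; y \<in> vcarrier E\<rbrakk> \<Longrightarrow> vplus E x y \<in> vcarrier E"
    and vscale_closed: "x \<in> vcarrier E \<Longrightarrow> vscale E c x \<in> vcarrier E"
    and vplus_assoc: "\<lbrakk>x \<in> vcarrier E; y \<in> vcarrier E; z \<in> vcarrier E\<rbrakk>
      \<Longrightarrow> vplus E (vplus E x y) z = vplus E x (vplus E y z)"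
    and vplus_commute: "\<lbrakk>x \<in> vcarrier E; y \<in> vcarrier E\<rbrakk> \<Longrightarrow> vplus E x y = vplus E y x"
    and vplus_vzero: "x \<in> vcarrier E \<Longrightarrow> vplus E x (vzero E) = x"
    and vplus_neg: "x \<in> vcarrier E \<Longrightarrow> vplus E x (vscale E (-1) x) = vzero E"
    and vscale_one: "x \<in> vcarrier E \<Longrightarrow> vscale E 1 x = x"
    and vscale_assoc: "x \<in> vcarrier E \<Longrightarrow> vscale E b (vscale E c x) = vscale E (b * c) x"
    and vscale_vplus: "\<lbrakk>x \<in> vcarrier E; y \<in> vcarrier E\<rbrakk>
      \<Longrightarrow> vscale E c (vplus E x y) = vplus E (vscale E c x) (vscale E c y)"
    and vscale_add: "x \<in> vcarrier E \<Longrightarrow> vscale E (b + c) x = vplus E (vscale E b x) (vscale E c x)"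

definition vsubspace :: "('a, 'm) cvect_scheme \<Rightarrow> 'a set \<Rightarrow> bool" where
  "vsubspace E U \<longleftrightarrow> U \<subseteq> vcarrier E \<and> vzero E \<in> U \<and> (\<forall>x \<in> U. \<forall>y \<in> U. vplus E x y \<in> U)
    \<and> (\<forall>c. \<forall>x \<in> U. vscale E c x \<in> U)"

text \<open>
  The distance of a norm on the carrier. It is cut off outside the carrier because
  \<^locale>\<open>Metric_space\<close> asks for symmetry and nonnegativity on the whole type.
\<close>

definition norm_dist :: "('a, 'm) cvect_scheme \<Rightarrow> ('a \<Rightarrow> real) \<Rightarrow> 'a \<Rightarrow> 'a \<Rightarrow> real" where
  "norm_dist E \<nu> x y = (if x \<in> vcarrier E \<and> y \<in> vcarrier E then \<nu> (vminus E x y) else 0)"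

record 'a star_alg = "'a cvect" +
  amult :: "'a \<Rightarrow> 'a \<Rightarrow> 'a"
  astar :: "'a \<Rightarrow> 'a"

locale star_algebra = complex_vector_space A for A :: "('a, 'm) star_alg_scheme" +
  assumes amult_closed: "\<lbrakk>a \<in> vcarrier A; b \<in> vcarrier A\<rbrakk> \<Longrightarrow> amult A a b \<in> vcarrier A"
    and astar_closed: "a \<in> vcarrier A \<Longrightarrow> astar A a \<in> vcarrier A"
    and amult_assoc: "\<lbrakk>a \<in> vcarrier A; b \<in> vcarrier A; c \<in> vcarrier A\<rbrakk>
      \<Longrightarrow> amult A (amult A a b) c = amult A a (amult A b c)"
    and amult_vplus_left: "\<lbrakk>a \<in> vcarrier A; b \<in> vcarrier A; c \<in> vcarrier A\<rbrakk>
      \<Longrightarrow> amult A (vplus A a b) c = vplus A (amult A a c) (amult A b c)"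
    and amult_vplus_right: "\<lbrakk>a \<in> vcarrier A; b \<in> vcarrier A; c \<in> vcarrier A\<rbrakk>
      \<Longrightarrow> amult A a (vplus A b c) = vplus A (amult A a b) (amult A a c)"
    and amult_vscale_left: "\<lbrakk>a \<in> vcarrier A; b \<in> vcarrier A\<rbrakk>
      \<Longrightarrow> amult A (vscale A t a) b = vscale A t (amult A a b)"
    and amult_vscale_right: "\<lbrakk>a \<in> vcarrier A; b \<in> vcarrier A\<rbrakk>
      \<Longrightarrow> amult A a (vscale A t b) = vscale A t (amult A a b)"
    and astar_astar: "a \<in> vcarrier A \<Longrightarrow> astar A (astar A a) = a"
    and astar_vplus: "\<lbrakk>a \<in> vcarrier A; b \<in> vcarrier A\<rbrakk>
      \<Longrightarrow> astar A (vplus A a b) = vplus A (astar A a) (astar A b)"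
    and astar_vscale: "a \<in> vcarrier A \<Longrightarrow> astar A (vscale A t a) = vscale A (cnj t) (astar A a)"
    and astar_amult: "\<lbrakk>a \<in> vcarrier A; b \<in> vcarrier A\<rbrakk>
      \<Longrightarrow> astar A (amult A a b) = amult A (astar A b) (astar A a)"

definition cstar_seminorm :: "('a, 'm) star_alg_scheme \<Rightarrow> ('a \<Rightarrow> real) \<Rightarrow> bool" where
  "cstar_seminorm A \<rho> \<longleftrightarrow>
    (\<forall>a \<in> vcarrier A. 0 \<le> \<rho> a \<and> (\<forall>t. \<rho> (vscale A t a) = cmod t * \<rho> a)
       \<and> \<rho> (amult A (astar A a) a) = (\<rho> a)\<^sup>2) \<and>
    (\<forall>a \<in> vcarrier A. \<forall>b \<in> vcarrier A.
       \<rho> (vplus A a b) \<le> \<rho> a + \<rho> b \<and> \<rho> (amult A a b) \<le> \<rho> a * \<rho> b)"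

record 'a cstar_alg = "'a star_alg" +
  anorm :: "'a \<Rightarrow> real"

locale cstar_algebra = star_algebra A for A :: "('a, 'm) cstar_alg_scheme" +
  assumes anorm_cstar: "cstar_seminorm A (anorm A)"
    and anorm_eq_0: "a \<in> vcarrier A \<Longrightarrow> anorm A a = 0 \<Longrightarrow> a = vzero A"
    and anorm_complete: "Metric_space.mcomplete (vcarrier A) (norm_dist A (anorm A))"

definition positive_elements :: "('a, 'm) star_alg_scheme \<Rightarrow> 'a set" where
  "positive_elements A = (\<lambda>b. amult A (astar A b) b) ` vcarrier A"

definition dense_span :: "('a, 'm) cstar_alg_scheme \<Rightarrow> 'a set \<Rightarrow> bool" where
  "dense_span A S \<longleftrightarrow>
    Metric_space.mtopology (vcarrier A) (norm_dist A (anorm A)) closure_of (vsubspace A hull S) = vcarrier A"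

text \<open>The algebra of continuous functions on the unit circle, extended by zero to the plane.\<close>

definition circle_algebra :: "(complex \<Rightarrow> complex) cstar_alg" where
  "circle_algebra =
    \<lparr>vcarrier = {f. continuous_on (sphere 0 1) f \<and> (\<forall>z. z \<notin> sphere 0 1 \<longrightarrow> f z = 0)},
     vzero = (\<lambda>z. 0), vplus = (\<lambda>f g z. f z + g z), vscale = (\<lambda>c f z. c * f z),
     amult = (\<lambda>f g z. f z * g z), astar = (\<lambda>f z. cnj (f z)),
     anorm = (\<lambda>f. SUP z\<in>sphere 0 1. cmod (f z))\<rparr>"

section \<open>Morita equivalence\<close>

text \<open>
  Rieffel's imprimitivity bimodules. The \<open>A\<close>-valued inner product is linear in its first variable,
  the \<open>B\<close>-valued one in its second.
\<close>

record ('a, 'b, 'x) bimod = "'x cvect" +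
  lact :: "'a \<Rightarrow> 'x \<Rightarrow> 'x"
  ract :: "'x \<Rightarrow> 'b \<Rightarrow> 'x"
  linner :: "'x \<Rightarrow> 'x \<Rightarrow> 'a"
  rinner :: "'x \<Rightarrow> 'x \<Rightarrow> 'b"

locale bimodule = A: star_algebra A + B: star_algebra B + X: complex_vector_space X
  for A :: "('a, 'm) star_alg_scheme" and B :: "('b, 'n) star_alg_scheme"
    and X :: "('a, 'b, 'x, 'k) bimod_scheme" +
  assumes lact_closed: "\<lbrakk>a \<in> vcarrier A; x \<in> vcarrier X\<rbrakk> \<Longrightarrow> lact X a x \<in> vcarrier X"
    and lact_lact: "\<lbrakk>a \<in> vcarrier A; c \<in> vcarrier A; x \<in> vcarrier X\<rbrakk>
      \<Longrightarrow> lact X (amult A a c) x = lact X a (lact X c x)"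
    and lact_vplus_left: "\<lbrakk>a \<in> vcarrier A; c \<in> vcarrier A; x \<in> vcarrier X\<rbrakk>
      \<Longrightarrow> lact X (vplus A a c) x = vplus X (lact X a x) (lact X c x)"
    and lact_vplus_right: "\<lbrakk>a \<in> vcarrier A; x \<in> vcarrier X; y \<in> vcarrier X\<rbrakk>
      \<Longrightarrow> lact X a (vplus X x y) = vplus X (lact X a x) (lact X a y)"
    and lact_vscale_left: "\<lbrakk>a \<in> vcarrier A; x \<in> vcarrier X\<rbrakk>
      \<Longrightarrow> lact X (vscale A t a) x = vscale X t (lact X a x)"
    and lact_vscale_right: "\<lbrakk>a \<in> vcarrier A; x \<in> vcarrier X\<rbrakk>
      \<Longrightarrow> lact X a (vscale X t x) = vscale X t (lact X a x)"
    and ract_closed: "\<lbrakk>x \<in> vcarrier X; b \<in> vcarrier B\<rbrakk> \<Longrightarrow> ract X x b \<in> vcarrier X"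
    and ract_ract: "\<lbrakk>x \<in> vcarrier X; b \<in> vcarrier B; d \<in> vcarrier B\<rbrakk>
      \<Longrightarrow> ract X x (amult B b d) = ract X (ract X x b) d"
    and ract_vplus_left: "\<lbrakk>x \<in> vcarrier X; y \<in> vcarrier X; b \<in> vcarrier B\<rbrakk>
      \<Longrightarrow> ract X (vplus X x y) b = vplus X (ract X x b) (ract X y b)"
    and ract_vplus_right: "\<lbrakk>x \<in> vcarrier X; b \<in> vcarrier B; d \<in> vcarrier B\<rbrakk>
      \<Longrightarrow> ract X x (vplus B b d) = vplus X (ract X x b) (ract X x d)"
    and ract_vscale_left: "\<lbrakk>x \<in> vcarrier X; b \<in> vcarrier B\<rbrakk>
      \<Longrightarrow> ract X (vscale X t x) b = vscale X t (ract X x b)"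
    and ract_vscale_right: "\<lbrakk>x \<in> vcarrier X; b \<in> vcarrier B\<rbrakk>
      \<Longrightarrow> ract X x (vscale B t b) = vscale X t (ract X x b)"
    and lact_ract: "\<lbrakk>a \<in> vcarrier A; x \<in> vcarrier X; b \<in> vcarrier B\<rbrakk>
      \<Longrightarrow> ract X (lact X a x) b = lact X a (ract X x b)"

locale imprimitivity_bimodule = A: cstar_algebra A + B: cstar_algebra B + bimodule A B X
  for A :: "('a, 'm) cstar_alg_scheme" and B :: "('b, 'n) cstar_alg_scheme"
    and X :: "('a, 'b, 'x, 'k) bimod_scheme" +
  assumes linner_closed: "\<lbrakk>x \<in> vcarrier X; y \<in> vcarrier X\<rbrakk> \<Longrightarrow> linner X x y \<in> vcarrier A"
    and linner_vplus: "\<lbrakk>x \<in> vcarrier X; y \<in> vcarrier X; z \<in> vcarrier X\<rbrakk>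
      \<Longrightarrow> linner X (vplus X x y) z = vplus A (linner X x z) (linner X y z)"
    and linner_vscale: "\<lbrakk>x \<in> vcarrier X; y \<in> vcarrier X\<rbrakk>
      \<Longrightarrow> linner X (vscale X t x) y = vscale A t (linner X x y)"
    and linner_lact: "\<lbrakk>a \<in> vcarrier A; x \<in> vcarrier X; y \<in> vcarrier X\<rbrakk>
      \<Longrightarrow> linner X (lact X a x) y = amult A a (linner X x y)"
    and linner_star: "\<lbrakk>x \<in> vcarrier X; y \<in> vcarrier X\<rbrakk>
      \<Longrightarrow> astar A (linner X x y) = linner X y x"
    and linner_pos: "x \<in> vcarrier X \<Longrightarrow> linner X x x \<in> positive_elements A"
    and linner_eq_0: "x \<in> vcarrier X \<Longrightarrow> linner X x x = vzero A \<Longrightarrow> x = vzero X"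
    and linner_complete: "Metric_space.mcomplete (vcarrier X)
      (norm_dist X (\<lambda>x. sqrt (anorm A (linner X x x))))"
    and linner_full: "dense_span A {linner X x y |x y. x \<in> vcarrier X \<and> y \<in> vcarrier X}"
    and rinner_closed: "\<lbrakk>x \<in> vcarrier X; y \<in> vcarrier X\<rbrakk> \<Longrightarrow> rinner X x y \<in> vcarrier B"
    and rinner_vplus: "\<lbrakk>x \<in> vcarrier X; y \<in> vcarrier X; z \<in> vcarrier X\<rbrakk>
      \<Longrightarrow> rinner X x (vplus X y z) = vplus B (rinner X x y) (rinner X x z)"
    and rinner_vscale: "\<lbrakk>x \<in> vcarrier X; y \<in> vcarrier X\<rbrakk>
      \<Longrightarrow> rinner X x (vscale X t y) = vscale B t (rinner X x y)"
    and rinner_ract: "\<lbrakk>x \<in> vcarrier X; y \<in> vcarrier X; b \<in> vcarrier B\<rbrakk>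
      \<Longrightarrow> rinner X x (ract X y b) = amult B (rinner X x y) b"
    and rinner_star: "\<lbrakk>x \<in> vcarrier X; y \<in> vcarrier X\<rbrakk>
      \<Longrightarrow> astar B (rinner X x y) = rinner X y x"
    and rinner_pos: "x \<in> vcarrier X \<Longrightarrow> rinner X x x \<in> positive_elements B"
    and rinner_eq_0: "x \<in> vcarrier X \<Longrightarrow> rinner X x x = vzero B \<Longrightarrow> x = vzero X"
    and rinner_complete: "Metric_space.mcomplete (vcarrier X)
      (norm_dist X (\<lambda>x. sqrt (anorm B (rinner X x x))))"
    and rinner_full: "dense_span B {rinner X x y |x y. x \<in> vcarrier X \<and> y \<in> vcarrier X}"
    and rinner_lact: "\<lbrakk>a \<in> vcarrier A; x \<in> vcarrier X; y \<in> vcarrier X\<rbrakk>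
      \<Longrightarrow> rinner X (lact X a x) y = rinner X x (lact X (astar A a) y)"
    and linner_ract: "\<lbrakk>b \<in> vcarrier B; x \<in> vcarrier X; y \<in> vcarrier X\<rbrakk>
      \<Longrightarrow> linner X (ract X x b) y = linner X x (ract X y (astar B b))"
    and linner_rinner: "\<lbrakk>x \<in> vcarrier X; y \<in> vcarrier X; z \<in> vcarrier X\<rbrakk>
      \<Longrightarrow> lact X (linner X x y) z = ract X x (rinner X y z)"

text \<open>
  The carrier of the bimodule is taken inside the type \<open>'a \<times> 'b\<close>. This loses nothing: writing
  elements of a dense subset of \<open>A\<close> as limits of finite sums of inner products shows that an
  imprimitivity bimodule has a dense subset no larger than a product of dense subsets of \<open>A\<close>
  and \<open>B\<close>, so its cardinality is at most that of \<open>A \<times> B\<close>.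
\<close>

definition morita_equivalent ::
    "('a, 'm) cstar_alg_scheme \<Rightarrow> ('b, 'n) cstar_alg_scheme \<Rightarrow> bool" where
  "morita_equivalent A B \<longleftrightarrow>
    (\<exists>X :: ('a, 'b, 'a \<times> 'b) bimod. imprimitivity_bimodule A B X)"

section \<open>The C*-algebra of a groupoid\<close>

text \<open>
  The convolution algebra of continuous compactly supported functions on a Hausdorff etale groupoid.
  For such functions the sum defining the convolution is finite once zero terms are removed.
\<close>

definition convolution_algebra :: "('g, 'm) top_groupoid_scheme \<Rightarrow> ('g \<Rightarrow> complex) star_alg" where
  "convolution_algebra G =
    \<lparr>vcarrier = {f. continuous_map (gtop G) euclidean f
       \<and> (\<exists>K. compactin (gtop G) K \<and> (\<forall>g. g \<notin> K \<longrightarrow> f g = 0))},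
     vzero = (\<lambda>g. 0), vplus = (\<lambda>f h g. f g + h g), vscale = (\<lambda>c f g. c * f g),
     amult = (\<lambda>f h g. \<Sum>(a, b) \<in> {(a, b). composable G a b \<and> gmult G a b = g \<and> f a \<noteq> 0 \<and> h b \<noteq> 0}.
                f a * h b),
     astar = (\<lambda>f g. if g \<in> arrows G then cnj (f (ginv G g)) else 0)\<rparr>"

text \<open>
  The largest C*-seminorm. Since C*-seminorms are exactly the functions \<open>a \<mapsto> \<parallel>\<pi>(a)\<parallel>\<close> for
  *-representations \<open>\<pi>\<close> by bounded operators on Hilbert spaces, this is the supremum of \<open>\<parallel>\<pi>(a)\<parallel>\<close>
  over all of them; it is finite for the convolution algebra of an etale groupoid.
\<close>

definition universal_seminorm :: "('a, 'm) star_alg_scheme \<Rightarrow> 'a \<Rightarrow> real" where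
  "universal_seminorm A a = (SUP \<rho> \<in> {\<rho>. cstar_seminorm A \<rho>}. \<rho> a)"

text \<open>Hausdorff completion by Cauchy sequences modulo null sequences.\<close>

definition cauchy_seqs :: "('a, 'm) cvect_scheme \<Rightarrow> ('a \<Rightarrow> real) \<Rightarrow> (nat \<Rightarrow> 'a) set" where
  "cauchy_seqs A \<rho> = {u. (\<forall>n. u n \<in> vcarrier A) \<and>
     (\<forall>\<epsilon>>0. \<exists>N. \<forall>m\<ge>N. \<forall>n\<ge>N. \<rho> (vminus A (u m) (u n)) < \<epsilon>)}"

definition null_rel :: "('a, 'm) cvect_scheme \<Rightarrow> ('a \<Rightarrow> real) \<Rightarrow> ((nat \<Rightarrow> 'a) \<times> (nat \<Rightarrow> 'a)) set" where
  "null_rel A \<rho> = {(u, v). u \<in> cauchy_seqs A \<rho> \<and> v \<in> cauchy_seqs A \<rho> \<and>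
     (\<lambda>n. \<rho> (vminus A (u n) (v n))) \<longlonglongrightarrow> 0}"

definition cstar_completion ::
    "('a, 'm) star_alg_scheme \<Rightarrow> ('a \<Rightarrow> real) \<Rightarrow> (nat \<Rightarrow> 'a) set cstar_alg" where
  "cstar_completion A \<rho> =
    (let R = null_rel A \<rho> in
    \<lparr>vcarrier = cauchy_seqs A \<rho> // R,
     vzero = R `` {\<lambda>n. vzero A},
     vplus = (\<lambda>P Q. \<Union>u\<in>P. \<Union>v\<in>Q. R `` {\<lambda>n. vplus A (u n) (v n)}),
     vscale = (\<lambda>c P. \<Union>u\<in>P. R `` {\<lambda>n. vscale A c (u n)}),
     amult = (\<lambda>P Q. \<Union>u\<in>P. \<Union>v\<in>Q. R `` {\<lambda>n. amult A (u n) (v n)}),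
     astar = (\<lambda>P. \<Union>u\<in>P. R `` {\<lambda>n. astar A (u n)}),
     anorm = (\<lambda>P. the_elem ((\<lambda>u. lim (\<lambda>n. \<rho> (u n))) ` P))\<rparr>)"

definition groupoid_cstar ::
    "('g, 'm) top_groupoid_scheme \<Rightarrow> (nat \<Rightarrow> 'g \<Rightarrow> complex) set cstar_alg" where
  "groupoid_cstar G =
    (let A = convolution_algebra G in cstar_completion A (universal_seminorm A))"

definition two_graph_cstar ::
    "('a, 'm) two_graph_scheme \<Rightarrow> (nat \<Rightarrow> 'a path_arrow \<Rightarrow> complex) set cstar_alg" where
  "two_graph_cstar \<Lambda> = groupoid_cstar (path_groupoid \<Lambda>)"

end

(*
  Beyond level N there is exactly one edge of each colour leaving the only vertex
  of a level, so every infinite path ends in the same tail and is determined by a finite initial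
  segment. Hence the path space Y is discrete, and the path groupoid is the discrete groupoid of
  all (x, (level y - level x, j), y) with x, y in Y and j an integer. Its convolution algebra
  consists of the finitely supported Y x Y matrices over the Laurent polynomials. For a diagonal
  matrix unit p the corner p C* p is C(T), and C* p is an imprimitivity bimodule between C* and
  this corner.

  The universal seminorm is needed only on the corner, where it is the supremum norm on the
  circle: evaluation of the matrices at a point of the circle, followed by the operator norm,
  gives one inequality; the other one is a spectral radius argument that works for every
  C*-seminorm.
*)
theory Submission
  imports Defs
begin

section \<open>Seminormed spaces\<close>

text \<open>The circle comes from the red loops of the tail: a shift along red edges keeps the
  level, so the red lag \<open>j\<close> of two paths is arbitrary, while the blue lag is forced by
  their levels. The isotropy group of a path is therefore a copy of the integers, whose dual is the
  circle. The obstacle is that the universal seminorm is a supremum over all C*-seminorms, of which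
  only the axioms are known. The identity for the norm of \<open>amult A (astar A a) a\<close> has
  to do all the work. It bounds the point masses \<open>delta g\<close>, which are partial
  isometries, by 1, so the supremum is finite; and iterated it removes the factor
  \<open>2 * D + 1\<close> from the crude bound of a corner element with exponents between
  \<open>-D\<close> and \<open>D\<close>. The norm of an element outside the corner is never
  computed. The bimodule needs only that the corner is isometric to C(T), that \<open>x* x\<close>
  is positive in C(T) for \<open>x\<close> in the left ideal, and that finite sums of inner products
  are dense. Positivity means being of the form \<open>b* b\<close>, and the root \<open>b\<close>
  is found pointwise on the circle.\<close>

context complex_vector_space
begin

lemmas vclosed [simp, intro] = vzero_closed vplus_closed vscale_closed

lemma vminus_closed [simp, intro]: "x \<in> vcarrier E \<Longrightarrow> y \<in> vcarrier E \<Longrightarrow> vminus E x y \<in> vcarrier E"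
  by (simp add: vminus_def)

lemma vplus_left_commute:
  "\<lbrakk>x \<in> vcarrier E; y \<in> vcarrier E; z \<in> vcarrier E\<rbrakk> \<Longrightarrow> vplus E x (vplus E y z) = vplus E y (vplus E x z)"
  by (metis vplus_assoc vplus_commute)

lemmas vplus_ac = vplus_assoc vplus_commute vplus_left_commute

lemma vzero_vplus [simp]: "x \<in> vcarrier E \<Longrightarrow> vplus E (vzero E) x = x"
  by (metis vplus_commute vplus_vzero vzero_closed)

declare vplus_vzero [simp]

text \<open>Add the negative of \<open>x\<close> on both sides. The identities with value zero
  below, for scalars, products and adjoints, follow by checking that the term equals its own
  double.\<close>

lemma vplus_idem: "x \<in> vcarrier E \<Longrightarrow> vplus E x x = x \<Longrightarrow> x = vzero E"
  by (metis vplus_assoc vplus_neg vplus_vzero vscale_closed)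

lemma vscale_vzero [simp]: "vscale E c (vzero E) = vzero E"
  by (rule vplus_idem) (simp_all flip: vscale_vplus)

lemma vscale_0 [simp]: "x \<in> vcarrier E \<Longrightarrow> vscale E 0 x = vzero E"
  by (rule vplus_idem) (simp_all flip: vscale_add)

lemma vminus_self [simp]: "x \<in> vcarrier E \<Longrightarrow> vminus E x x = vzero E"
  by (simp add: vminus_def vplus_neg)

lemma vminus_vzero [simp]: "x \<in> vcarrier E \<Longrightarrow> vminus E x (vzero E) = x"
  by (simp add: vminus_def)

lemma vplus_vminus_cancel: "\<lbrakk>x \<in> vcarrier E; y \<in> vcarrier E\<rbrakk> \<Longrightarrow> vplus E y (vminus E x y) = x"
  unfolding vminus_def by (metis vplus_left_commute vplus_neg vplus_vzero vscale_closed)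

lemma vminus_eq_0: "\<lbrakk>x \<in> vcarrier E; y \<in> vcarrier E; vminus E x y = vzero E\<rbrakk> \<Longrightarrow> x = y"
  by (metis vplus_vminus_cancel vplus_vzero)

lemma vscale_vminus:
  "\<lbrakk>x \<in> vcarrier E; y \<in> vcarrier E\<rbrakk> \<Longrightarrow> vscale E c (vminus E x y) = vminus E (vscale E c x) (vscale E c y)"
  by (simp add: vminus_def vscale_vplus vscale_assoc mult.commute)

lemma vminus_vplus_vplus:
  "\<lbrakk>x \<in> vcarrier E; y \<in> vcarrier E; z \<in> vcarrier E; w \<in> vcarrier E\<rbrakk>
   \<Longrightarrow> vminus E (vplus E x y) (vplus E z w) = vplus E (vminus E x z) (vminus E y w)"
  by (simp add: vminus_def vscale_vplus vplus_ac)

lemma vminus_trans: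
  "\<lbrakk>x \<in> vcarrier E; y \<in> vcarrier E; z \<in> vcarrier E\<rbrakk>
   \<Longrightarrow> vplus E (vminus E x y) (vminus E y z) = vminus E x z"
  unfolding vminus_def
  by (smt (verit) vplus_assoc vplus_commute vplus_neg vplus_vzero vscale_closed vplus_closed)

lemma vminus_swap:
  "\<lbrakk>x \<in> vcarrier E; y \<in> vcarrier E\<rbrakk> \<Longrightarrow> vscale E (-1) (vminus E x y) = vminus E y x"
  by (simp add: vminus_def vscale_vplus vscale_assoc vscale_one vplus_commute)

end

context star_algebra
begin

lemmas aclosed [simp, intro] = amult_closed astar_closed

lemma amult_vzero_left [simp]: "a \<in> vcarrier A \<Longrightarrow> amult A (vzero A) a = vzero A"
  by (rule vplus_idem) (simp_all flip: amult_vplus_left)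

lemma amult_vzero_right [simp]: "a \<in> vcarrier A \<Longrightarrow> amult A a (vzero A) = vzero A"
  by (rule vplus_idem) (simp_all flip: amult_vplus_right)

lemma astar_vzero [simp]: "astar A (vzero A) = vzero A"
  by (rule vplus_idem) (simp_all flip: astar_vplus)

lemma amult_vminus_left:
  "\<lbrakk>a \<in> vcarrier A; b \<in> vcarrier A; c \<in> vcarrier A\<rbrakk>
   \<Longrightarrow> amult A (vminus A a b) c = vminus A (amult A a c) (amult A b c)"
  by (simp add: vminus_def amult_vplus_left amult_vscale_left)

lemma amult_vminus_right:
  "\<lbrakk>a \<in> vcarrier A; b \<in> vcarrier A; c \<in> vcarrier A\<rbrakk>
   \<Longrightarrow> amult A a (vminus A b c) = vminus A (amult A a b) (amult A a c)"
  by (simp add: vminus_def amult_vplus_right amult_vscale_right)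

lemma astar_vminus:
  "\<lbrakk>a \<in> vcarrier A; b \<in> vcarrier A\<rbrakk> \<Longrightarrow> astar A (vminus A a b) = vminus A (astar A a) (astar A b)"
  by (simp add: vminus_def astar_vplus astar_vscale)

end

section \<open>Seminorms, their distances and completeness\<close>

locale seminormed_space = complex_vector_space E for E :: "('a, 'm) cvect_scheme" +
  fixes \<nu> :: "'a \<Rightarrow> real"
  assumes norm_nonneg [simp]: "x \<in> vcarrier E \<Longrightarrow> 0 \<le> \<nu> x"
    and norm_vscale: "x \<in> vcarrier E \<Longrightarrow> \<nu> (vscale E t x) = cmod t * \<nu> x"
    and norm_triangle: "\<lbrakk>x \<in> vcarrier E; y \<in> vcarrier E\<rbrakk> \<Longrightarrow> \<nu> (vplus E x y) \<le> \<nu> x + \<nu> y"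
begin

lemma norm_vzero [simp]: "\<nu> (vzero E) = 0"
  using norm_vscale[of "vzero E" 0] by simp

lemma norm_vminus_commute: "\<lbrakk>x \<in> vcarrier E; y \<in> vcarrier E\<rbrakk> \<Longrightarrow> \<nu> (vminus E x y) = \<nu> (vminus E y x)"
  using norm_vscale[of "vminus E x y" "-1"] by (simp add: vminus_swap)

lemma norm_vminus_triangle:
  "\<lbrakk>x \<in> vcarrier E; y \<in> vcarrier E; z \<in> vcarrier E\<rbrakk>
   \<Longrightarrow> \<nu> (vminus E x z) \<le> \<nu> (vminus E x y) + \<nu> (vminus E y z)"
  using norm_triangle[of "vminus E x y" "vminus E y z"] by (simp add: vminus_trans)

lemma norm_diff_le: "\<lbrakk>x \<in> vcarrier E; y \<in> vcarrier E\<rbrakk> \<Longrightarrow> \<bar>\<nu> x - \<nu> y\<bar> \<le> \<nu> (vminus E x y)"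
  using norm_triangle[of y "vminus E x y"] norm_triangle[of x "vminus E y x"] norm_vminus_commute[of x y]
  by (simp add: vplus_vminus_cancel)

lemma norm_le_diff: "\<lbrakk>x \<in> vcarrier E; y \<in> vcarrier E\<rbrakk> \<Longrightarrow> \<nu> x \<le> \<nu> y + \<nu> (vminus E x y)"
  using norm_diff_le[of x y] by simp

lemma Metric_space_norm_dist:
  assumes "\<And>x. x \<in> vcarrier E \<Longrightarrow> \<nu> x = 0 \<Longrightarrow> x = vzero E"
  shows "Metric_space (vcarrier E) (norm_dist E \<nu>)"
proof
  show "0 \<le> norm_dist E \<nu> x y" for x y by (simp add: norm_dist_def)
  show "norm_dist E \<nu> x y = norm_dist E \<nu> y x" for x y by (simp add: norm_dist_def norm_vminus_commute)
  show "(norm_dist E \<nu> x y = 0) = (x = y)" if "x \<in> vcarrier E" "y \<in> vcarrier E" for x y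
    using that assms[OF vminus_closed[OF that]] vminus_eq_0[OF that] by (auto simp: norm_dist_def)
  show "norm_dist E \<nu> x z \<le> norm_dist E \<nu> x y + norm_dist E \<nu> y z"
    if "x \<in> vcarrier E" "y \<in> vcarrier E" "z \<in> vcarrier E" for x y z
    using that by (simp add: norm_dist_def norm_vminus_triangle)
qed

text \<open>Turns the completeness demanded of C*-algebras and bimodules into a statement about real
  null sequences. Used for the completion, for C(T) and for the bimodule.\<close>

lemma mcomplete_norm_dist_iff:
  assumes definite: "\<And>x. x \<in> vcarrier E \<Longrightarrow> \<nu> x = 0 \<Longrightarrow> x = vzero E"
  shows "Metric_space.mcomplete (vcarrier E) (norm_dist E \<nu>) \<longleftrightarrow>
    (\<forall>s. s \<in> cauchy_seqs E \<nu> \<longrightarrow> (\<exists>l \<in> vcarrier E. (\<lambda>n. \<nu> (vminus E (s n) l)) \<longlonglongrightarrow> 0))"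
proof -
  interpret M: Metric_space "vcarrier E" "norm_dist E \<nu>"
    by (rule Metric_space_norm_dist) fact
  have C: "M.MCauchy s \<longleftrightarrow> s \<in> cauchy_seqs E \<nu>" for s
  proof (cases "\<forall>n. s n \<in> vcarrier E")
    case True
    then show ?thesis
      by (auto simp: M.MCauchy_def cauchy_seqs_def norm_dist_def image_subset_iff)
  next
    case False
    then show ?thesis by (auto simp: M.MCauchy_def cauchy_seqs_def)
  qed
  have L: "limitin M.mtopology s l sequentially \<longleftrightarrow>
      l \<in> vcarrier E \<and> (\<lambda>n. \<nu> (vminus E (s n) l)) \<longlonglongrightarrow> 0" if "\<And>n. s n \<in> vcarrier E" for s l
  proof -
    have "(\<lambda>n. norm_dist E \<nu> (s n) l) = (\<lambda>n. \<nu> (vminus E (s n) l))" if "l \<in> vcarrier E"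
      using that \<open>\<And>n. s n \<in> vcarrier E\<close> by (simp add: norm_dist_def)
    then show ?thesis
      using that by (auto simp: M.limitin_metric_dist_null)
  qed
  show ?thesis
    unfolding M.mcomplete_def C
    by (rule iff_allI) (use L in \<open>auto simp: cauchy_seqs_def\<close>)
qed

end

lemma cstar_seminorm_imp_seminormed:
  assumes "star_algebra A" "cstar_seminorm A \<rho>"
  shows "seminormed_space A \<rho>"
proof -
  interpret star_algebra A by fact
  show ?thesis using assms(2) by unfold_locales (auto simp: cstar_seminorm_def)
qed

section \<open>Completions\<close>

locale star_algebra_seminorm = star_algebra A for A :: "('a, 'm) star_alg_scheme" +
  fixes \<rho> :: "'a \<Rightarrow> real"
  assumes cstar: "cstar_seminorm A \<rho>"
begin

sublocale seminormed_space A \<rho>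
  using cstar by unfold_locales (auto simp: cstar_seminorm_def)

lemma norm_amult: "a \<in> vcarrier A \<Longrightarrow> b \<in> vcarrier A \<Longrightarrow> \<rho> (amult A a b) \<le> \<rho> a * \<rho> b"
  and norm_star_amult: "a \<in> vcarrier A \<Longrightarrow> \<rho> (amult A (astar A a) a) = (\<rho> a)\<^sup>2"
  using cstar by (auto simp: cstar_seminorm_def)

text \<open>The C*-identity and submultiplicativity give
  \<open>\<rho> a * \<rho> a \<le> \<rho> (astar A a) * \<rho> a\<close>. Cancel
  \<open>\<rho> a\<close>, then apply the result to the adjoint.\<close>

lemma norm_astar [simp]: "a \<in> vcarrier A \<Longrightarrow> \<rho> (astar A a) = \<rho> a"
proof -
  have *: "\<rho> a \<le> \<rho> (astar A a)" if "a \<in> vcarrier A" for a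
  proof -
    have "\<rho> a * \<rho> a \<le> \<rho> (astar A a) * \<rho> a"
      using norm_amult[of "astar A a" a] norm_star_amult[of a] that by (simp add: power2_eq_square)
    moreover have "0 \<le> \<rho> a" "0 \<le> \<rho> (astar A a)" using that by auto
    ultimately show ?thesis by (cases "\<rho> a = 0") auto
  qed
  show "a \<in> vcarrier A \<Longrightarrow> \<rho> (astar A a) = \<rho> a"
    using *[of a] *[of "astar A a"] by (auto simp: astar_astar)
qed

abbreviation "CS \<equiv> cauchy_seqs A \<rho>"
abbreviation "\<C> \<equiv> cstar_completion A \<rho>"
definition cls :: "(nat \<Rightarrow> 'a) \<Rightarrow> (nat \<Rightarrow> 'a) set" where "cls u = null_rel A \<rho> `` {u}"

lemma CS_D: "u \<in> CS \<Longrightarrow> \<epsilon> > 0 \<Longrightarrow> \<exists>N. \<forall>m\<ge>N. \<forall>n\<ge>N. \<rho> (vminus A (u m) (u n)) < \<epsilon>"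
  by (simp add: cauchy_seqs_def)

lemma CS_E:
  assumes "u \<in> CS" "\<epsilon> > 0"
  obtains N where "\<And>m n. m \<ge> N \<Longrightarrow> n \<ge> N \<Longrightarrow> \<rho> (vminus A (u m) (u n)) < \<epsilon>"
  using CS_D[OF assms] by blast

lemma CS_I:
  "(\<And>n. u n \<in> vcarrier A) \<Longrightarrow> (\<And>\<epsilon>. \<epsilon> > 0 \<Longrightarrow> \<exists>N. \<forall>m\<ge>N. \<forall>n\<ge>N. \<rho> (vminus A (u m) (u n)) < \<epsilon>) \<Longrightarrow> u \<in> CS"
  by (simp add: cauchy_seqs_def)

lemma CS_carrier [simp]: "u \<in> CS \<Longrightarrow> u n \<in> vcarrier A"
  by (simp add: cauchy_seqs_def)

lemma equiv_null_rel: "equiv CS (null_rel A \<rho>)"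
proof (rule equivI)
  show "null_rel A \<rho> \<subseteq> CS \<times> CS" by (auto simp: null_rel_def)
  show "refl_on CS (null_rel A \<rho>)" by (auto simp: refl_on_def null_rel_def)
  show "sym (null_rel A \<rho>)"
  proof (rule symI)
    fix u v assume "(u, v) \<in> null_rel A \<rho>"
    moreover from this have "(\<lambda>n. \<rho> (vminus A (v n) (u n))) = (\<lambda>n. \<rho> (vminus A (u n) (v n)))"
      by (intro ext norm_vminus_commute) (auto simp: null_rel_def)
    ultimately show "(v, u) \<in> null_rel A \<rho>" by (simp add: null_rel_def)
  qed
  show "trans (null_rel A \<rho>)"
  proof (rule transI)
    fix u v w assume uv: "(u, v) \<in> null_rel A \<rho>" and vw: "(v, w) \<in> null_rel A \<rho>"
    have "(\<lambda>n. \<rho> (vminus A (u n) (w n))) \<longlonglongrightarrow> 0"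
    proof (rule real_tendsto_sandwich[where f = "\<lambda>_. 0"])
      show "(\<lambda>n. \<rho> (vminus A (u n) (v n)) + \<rho> (vminus A (v n) (w n))) \<longlonglongrightarrow> 0"
        using tendsto_add[of "\<lambda>n. \<rho> (vminus A (u n) (v n))" 0 sequentially] uv vw
        by (auto simp: null_rel_def)
    qed (use uv vw in \<open>auto simp: null_rel_def intro!: norm_vminus_triangle always_eventually\<close>)
    with uv vw show "(u, w) \<in> null_rel A \<rho>" by (auto simp: null_rel_def)
  qed
qed

lemma cls_eq_iff:
  "\<lbrakk>u \<in> CS; v \<in> CS\<rbrakk> \<Longrightarrow> cls u = cls v \<longleftrightarrow> (\<lambda>n. \<rho> (vminus A (u n) (v n))) \<longlonglongrightarrow> 0"
  unfolding cls_def using eq_equiv_class_iff[OF equiv_null_rel] by (auto simp: null_rel_def)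

lemma mem_cls_iff: "u \<in> CS \<Longrightarrow> v \<in> cls u \<longleftrightarrow> v \<in> CS \<and> (\<lambda>n. \<rho> (vminus A (u n) (v n))) \<longlonglongrightarrow> 0"
  unfolding cls_def by (auto simp: null_rel_def)

lemma self_mem_cls: "u \<in> CS \<Longrightarrow> u \<in> cls u"
  by (simp add: mem_cls_iff)

lemma completion_carrier: "vcarrier \<C> = cls ` CS"
  unfolding cstar_completion_def Let_def cls_def quotient_def by auto

lemma cls_carrier [simp, intro]: "u \<in> CS \<Longrightarrow> cls u \<in> vcarrier \<C>"
  by (simp add: completion_carrier)

lemma completion_cases:
  assumes "P \<in> vcarrier \<C>" obtains u where "u \<in> CS" "P = cls u"
  using assms by (auto simp: completion_carrier)

lemma const_CS [simp, intro]: "a \<in> vcarrier A \<Longrightarrow> (\<lambda>n. a) \<in> CS"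
  by (rule CS_I) auto

lemma CS_bounded: "u \<in> CS \<Longrightarrow> \<exists>K>0. \<forall>n. \<rho> (u n) \<le> K"
proof -
  assume u: "u \<in> CS"
  then obtain N where N: "\<And>m n. m \<ge> N \<Longrightarrow> n \<ge> N \<Longrightarrow> \<rho> (vminus A (u m) (u n)) < 1"
    using CS_D[of u 1] by auto
  have *: "\<rho> (u n) \<le> \<rho> (u N) + 1" if "n \<ge> N" for n
    using norm_le_diff[of "u n" "u N"] N[of n N] that u by fastforce
  \<comment> \<open>The terms up to \<open>N\<close> are bounded by the maximum, the later ones by
    \<open>\<rho> (u N) + 1\<close>. The added 1 also makes \<open>K\<close> positive, so that it
    can serve as a divisor.\<close>
  define K where "K = Max ((\<lambda>n. \<rho> (u n)) ` {..N}) + 1"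
  have M: "\<rho> (u n) \<le> K - 1" if "n \<le> N" for n
    unfolding K_def using that by simp
  have "\<rho> (u n) \<le> K" for n
    using *[of n] M[of n] M[of N] by (cases "n \<le> N") auto
  moreover have "K > 0" using M[of N] norm_nonneg[OF CS_carrier[OF u], of N] by simp
  ultimately show ?thesis by blast
qed

lemma CS_vplus [simp, intro]: "\<lbrakk>u \<in> CS; v \<in> CS\<rbrakk> \<Longrightarrow> (\<lambda>n. vplus A (u n) (v n)) \<in> CS"
proof (rule CS_I)
  fix \<epsilon> :: real assume "u \<in> CS" "v \<in> CS" "\<epsilon> > 0"
  have "\<epsilon>/2 > 0" using \<open>\<epsilon> > 0\<close> by simp
  obtain N where N: "\<And>m n. m\<ge>N \<Longrightarrow> n \<ge> N \<Longrightarrow> \<rho> (vminus A (u m) (u n)) < \<epsilon>/2"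
    using CS_E[OF \<open>u \<in> CS\<close> \<open>\<epsilon>/2 > 0\<close>] by blast
  obtain N' where N': "\<And>m n. m\<ge>N' \<Longrightarrow> n \<ge> N' \<Longrightarrow> \<rho> (vminus A (v m) (v n)) < \<epsilon>/2"
    using CS_E[OF \<open>v \<in> CS\<close> \<open>\<epsilon>/2 > 0\<close>] by blast
  show "\<exists>N. \<forall>m\<ge>N. \<forall>n\<ge>N. \<rho> (vminus A (vplus A (u m) (v m)) (vplus A (u n) (v n))) < \<epsilon>"
  proof (intro exI allI impI)
    fix m n assume "m \<ge> max N N'" "n \<ge> max N N'"
    then show "\<rho> (vminus A (vplus A (u m) (v m)) (vplus A (u n) (v n))) < \<epsilon>"
      using N[of m n] N'[of m n] norm_triangle[of "vminus A (u m) (u n)" "vminus A (v m) (v n)"]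
        \<open>u \<in> CS\<close> \<open>v \<in> CS\<close> by (simp add: vminus_vplus_vplus)
  qed
qed auto

lemma CS_lipschitz:
  assumes "u \<in> CS" "\<And>n. f n \<in> vcarrier A" "K \<ge> 0"
    and "\<And>m n. \<rho> (vminus A (f m) (f n)) \<le> K * \<rho> (vminus A (u m) (u n))"
  shows "f \<in> CS"
proof (rule CS_I)
  fix \<epsilon> :: real assume "\<epsilon> > 0"
  \<comment> \<open>Dividing by \<open>K + 1\<close> covers the case \<open>K = 0\<close>.\<close>
  then obtain N where N: "\<And>m n. m\<ge>N \<Longrightarrow> n \<ge> N \<Longrightarrow> \<rho> (vminus A (u m) (u n)) < \<epsilon>/(K+1)"
    using CS_D[OF \<open>u \<in> CS\<close>, of "\<epsilon>/(K+1)"] \<open>K \<ge> 0\<close> by auto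
  show "\<exists>N. \<forall>m\<ge>N. \<forall>n\<ge>N. \<rho> (vminus A (f m) (f n)) < \<epsilon>"
  proof (intro exI allI impI)
    fix m n assume "m \<ge> N" "n \<ge> N"
    have "\<rho> (vminus A (f m) (f n)) \<le> (K+1) * \<rho> (vminus A (u m) (u n))"
      using assms(4)[of m n] norm_nonneg[OF vminus_closed[OF CS_carrier CS_carrier], OF assms(1,1), of m n]
      by (simp add: distrib_right)
    also have "\<dots> < (K+1) * (\<epsilon>/(K+1))"
      using N[OF \<open>m \<ge> N\<close> \<open>n \<ge> N\<close>] \<open>K \<ge> 0\<close> by (intro mult_strict_left_mono) auto
    also have "\<dots> = \<epsilon>" using \<open>K \<ge> 0\<close> by simp
    finally show "\<rho> (vminus A (f m) (f n)) < \<epsilon>" .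
  qed
qed (use assms in auto)

lemma CS_vscale [simp, intro]: "u \<in> CS \<Longrightarrow> (\<lambda>n. vscale A c (u n)) \<in> CS"
  by (rule CS_lipschitz[of u _ "cmod c"]) (auto simp: norm_vscale simp flip: vscale_vminus)

lemma CS_astar [simp, intro]: "u \<in> CS \<Longrightarrow> (\<lambda>n. astar A (u n)) \<in> CS"
  by (rule CS_lipschitz[of u _ 1]) (auto simp flip: astar_vminus)

text \<open>From \<open>ab - cd = a(b - d) + (a - c)d\<close>. The estimate shows both that products
  of Cauchy sequences are Cauchy and that the product of classes does not depend on the
  representatives.\<close>

lemma norm_amult_vminus:
  assumes "a \<in> vcarrier A" "b \<in> vcarrier A" "c \<in> vcarrier A" "d \<in> vcarrier A"
  shows "\<rho> (vminus A (amult A a b) (amult A c d)) \<le> \<rho> a * \<rho> (vminus A b d) + \<rho> (vminus A a c) * \<rho> d"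
proof -
  have "\<rho> (vminus A (amult A a b) (amult A c d))
      \<le> \<rho> (vminus A (amult A a b) (amult A a d)) + \<rho> (vminus A (amult A a d) (amult A c d))"
    using assms by (intro norm_vminus_triangle) auto
  also have "\<dots> = \<rho> (amult A a (vminus A b d)) + \<rho> (amult A (vminus A a c) d)"
    using assms by (simp add: amult_vminus_left amult_vminus_right)
  also have "\<dots> \<le> \<rho> a * \<rho> (vminus A b d) + \<rho> (vminus A a c) * \<rho> d"
    using assms by (intro add_mono norm_amult) auto
  finally show ?thesis .
qed

lemma CS_amult [simp, intro]: "\<lbrakk>u \<in> CS; v \<in> CS\<rbrakk> \<Longrightarrow> (\<lambda>n. amult A (u n) (v n)) \<in> CS"
proof (rule CS_I)
  fix \<epsilon> :: real assume uv: "u \<in> CS" "v \<in> CS" "\<epsilon> > 0"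
  obtain K where K: "K > 0" "\<And>n. \<rho> (u n) \<le> K" "\<And>n. \<rho> (v n) \<le> K"
    using CS_bounded[OF uv(1)] CS_bounded[OF uv(2)]
    by (metis max.strict_coboundedI1 max.coboundedI1 max.coboundedI2)
  have "\<epsilon>/2/K > 0" using \<open>\<epsilon> > 0\<close> \<open>K > 0\<close> by simp
  obtain N where N: "\<And>m n. m\<ge>N \<Longrightarrow> n \<ge> N \<Longrightarrow> \<rho> (vminus A (u m) (u n)) < \<epsilon>/2/K"
    using CS_E[OF uv(1) \<open>\<epsilon>/2/K > 0\<close>] by blast
  obtain N' where N': "\<And>m n. m\<ge>N' \<Longrightarrow> n \<ge> N' \<Longrightarrow> \<rho> (vminus A (v m) (v n)) < \<epsilon>/2/K"
    using CS_E[OF uv(2) \<open>\<epsilon>/2/K > 0\<close>] by blast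
  show "\<exists>N. \<forall>m\<ge>N. \<forall>n\<ge>N. \<rho> (vminus A (amult A (u m) (v m)) (amult A (u n) (v n))) < \<epsilon>"
  proof (intro exI allI impI)
    fix m n assume mn: "m \<ge> max N N'" "n \<ge> max N N'"
    have "\<rho> (vminus A (amult A (u m) (v m)) (amult A (u n) (v n)))
      \<le> \<rho> (u m) * \<rho> (vminus A (v m) (v n)) + \<rho> (vminus A (u m) (u n)) * \<rho> (v n)"
      using uv by (intro norm_amult_vminus) auto
    also have "\<dots> \<le> K * \<rho> (vminus A (v m) (v n)) + \<rho> (vminus A (u m) (u n)) * K"
      using uv K by (intro add_mono mult_mono) auto
    also have "\<dots> < K * (\<epsilon>/2/K) + (\<epsilon>/2/K) * K"
      using uv K mn N[of m n] N'[of m n] by (intro add_strict_mono mult_strict_left_mono mult_strict_right_mono) auto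
    also have "\<dots> = \<epsilon>" using \<open>K > 0\<close> by simp
    finally show "\<rho> (vminus A (amult A (u m) (v m)) (amult A (u n) (v n))) < \<epsilon>" .
  qed
qed auto

text \<open>Operations of the completion are unions over all representatives. Such a union collapses
  to one class once every representative yields the same class, because \<open>cls u\<close> is
  inhabited by \<open>u\<close>.\<close>

lemma UN_cls1:
  assumes "u \<in> CS" "\<And>u'. u' \<in> cls u \<Longrightarrow> F u' = F u"
  shows "(\<Union>u'\<in>cls u. F u') = F u"
  using assms self_mem_cls by blast

lemma UN_cls2:
  assumes "u \<in> CS" "v \<in> CS" "\<And>u' v'. u' \<in> cls u \<Longrightarrow> v' \<in> cls v \<Longrightarrow> F u' v' = F u v"
  shows "(\<Union>u'\<in>cls u. \<Union>v'\<in>cls v. F u' v') = F u v"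
  using assms self_mem_cls by blast

lemma vzero_completion: "vzero \<C> = cls (\<lambda>n. vzero A)"
  by (simp add: cstar_completion_def Let_def cls_def)

lemma null_sandwich:
  assumes "f \<longlonglongrightarrow> 0" "\<And>n. 0 \<le> g n" "\<And>n. g n \<le> f n" shows "g \<longlonglongrightarrow> (0::real)"
  using real_tendsto_sandwich[of "\<lambda>_. 0" g sequentially f 0] assms by simp

lemma cls_eqI:
  assumes "f \<longlonglongrightarrow> 0" "u \<in> CS" "v \<in> CS" "\<And>n. \<rho> (vminus A (u n) (v n)) \<le> f n" shows "cls v = cls u"
proof -
  have "(\<lambda>n. \<rho> (vminus A (u n) (v n))) \<longlonglongrightarrow> 0"
    by (rule null_sandwich[OF assms(1)]) (use assms in auto)
  then show ?thesis using cls_eq_iff[OF assms(2,3)] by simp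
qed

lemma vplus_completion [simp]:
  assumes uv: "u \<in> CS" "v \<in> CS"
  shows "vplus \<C> (cls u) (cls v) = cls (\<lambda>n. vplus A (u n) (v n))"
proof -
  have "(\<Union>u'\<in>cls u. \<Union>v'\<in>cls v. cls (\<lambda>n. vplus A (u' n) (v' n))) = cls (\<lambda>n. vplus A (u n) (v n))"
  proof (rule UN_cls2[OF uv])
    fix u' v' assume "u' \<in> cls u" "v' \<in> cls v"
    then have *: "u' \<in> CS" "v' \<in> CS" "(\<lambda>n. \<rho> (vminus A (u n) (u' n))) \<longlonglongrightarrow> 0" "(\<lambda>n. \<rho> (vminus A (v n) (v' n))) \<longlonglongrightarrow> 0"
      using uv by (auto simp: mem_cls_iff)
    show "cls (\<lambda>n. vplus A (u' n) (v' n)) = cls (\<lambda>n. vplus A (u n) (v n))"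
      by (rule cls_eqI[OF tendsto_add_zero[OF *(3,4)]])
        (use * uv in \<open>auto simp: vminus_vplus_vplus intro!: norm_triangle\<close>)
  qed
  then show ?thesis by (simp add: cstar_completion_def Let_def cls_def)
qed

lemma vscale_completion [simp]:
  assumes u: "u \<in> CS" shows "vscale \<C> c (cls u) = cls (\<lambda>n. vscale A c (u n))"
proof -
  have "(\<Union>u'\<in>cls u. cls (\<lambda>n. vscale A c (u' n))) = cls (\<lambda>n. vscale A c (u n))"
  proof (rule UN_cls1[OF u])
    fix u' assume "u' \<in> cls u"
    then have *: "u' \<in> CS" "(\<lambda>n. \<rho> (vminus A (u n) (u' n))) \<longlonglongrightarrow> 0" using u by (auto simp: mem_cls_iff)
    show "cls (\<lambda>n. vscale A c (u' n)) = cls (\<lambda>n. vscale A c (u n))"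
      by (rule cls_eqI[OF tendsto_mult_right_zero[OF *(2), of "cmod c"]])
        (use * u in \<open>auto simp: norm_vscale simp flip: vscale_vminus\<close>)
  qed
  then show ?thesis by (simp add: cstar_completion_def Let_def cls_def)
qed

lemma astar_completion [simp]:
  assumes u: "u \<in> CS" shows "astar \<C> (cls u) = cls (\<lambda>n. astar A (u n))"
proof -
  have "(\<Union>u'\<in>cls u. cls (\<lambda>n. astar A (u' n))) = cls (\<lambda>n. astar A (u n))"
  proof (rule UN_cls1[OF u])
    fix u' assume "u' \<in> cls u"
    then have *: "u' \<in> CS" "(\<lambda>n. \<rho> (vminus A (u n) (u' n))) \<longlonglongrightarrow> 0" using u by (auto simp: mem_cls_iff)
    show "cls (\<lambda>n. astar A (u' n)) = cls (\<lambda>n. astar A (u n))"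
      by (rule cls_eqI[OF *(2)]) (use * u in \<open>auto simp flip: astar_vminus\<close>)
  qed
  then show ?thesis by (simp add: cstar_completion_def Let_def cls_def)
qed

lemma amult_completion [simp]:
  assumes uv: "u \<in> CS" "v \<in> CS"
  shows "amult \<C> (cls u) (cls v) = cls (\<lambda>n. amult A (u n) (v n))"
proof -
  have "(\<Union>u'\<in>cls u. \<Union>v'\<in>cls v. cls (\<lambda>n. amult A (u' n) (v' n))) = cls (\<lambda>n. amult A (u n) (v n))"
  proof (rule UN_cls2[OF uv])
    fix u' v' assume "u' \<in> cls u" "v' \<in> cls v"
    then have *: "u' \<in> CS" "v' \<in> CS" "(\<lambda>n. \<rho> (vminus A (u n) (u' n))) \<longlonglongrightarrow> 0" "(\<lambda>n. \<rho> (vminus A (v n) (v' n))) \<longlonglongrightarrow> 0"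
      using uv by (auto simp: mem_cls_iff)
    obtain K where K: "\<And>n. \<rho> (u n) \<le> K" "\<And>n. \<rho> (v' n) \<le> K" "K > 0"
      using CS_bounded[OF uv(1)] CS_bounded[OF *(2)]
      by (metis max.strict_coboundedI1 max.coboundedI1 max.coboundedI2)
    show "cls (\<lambda>n. amult A (u' n) (v' n)) = cls (\<lambda>n. amult A (u n) (v n))"
    proof (rule cls_eqI)
      show "(\<lambda>n. K * \<rho> (vminus A (v n) (v' n)) + \<rho> (vminus A (u n) (u' n)) * K) \<longlonglongrightarrow> 0"
        by (intro tendsto_add_zero tendsto_mult_right_zero tendsto_mult_left_zero *)
      fix n
      have "\<rho> (vminus A (amult A (u n) (v n)) (amult A (u' n) (v' n)))
        \<le> \<rho> (u n) * \<rho> (vminus A (v n) (v' n)) + \<rho> (vminus A (u n) (u' n)) * \<rho> (v' n)"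
        using uv * by (intro norm_amult_vminus) auto
      also have "\<dots> \<le> K * \<rho> (vminus A (v n) (v' n)) + \<rho> (vminus A (u n) (u' n)) * K"
        using uv * K by (intro add_mono mult_mono) auto
      finally show "\<rho> (vminus A (amult A (u n) (v n)) (amult A (u' n) (v' n)))
        \<le> K * \<rho> (vminus A (v n) (v' n)) + \<rho> (vminus A (u n) (u' n)) * K" .
    qed (use uv * in auto)
  qed
  then show ?thesis by (simp add: cstar_completion_def Let_def cls_def)
qed

lemma CS_norm_convergent:
  assumes u: "u \<in> CS" shows "convergent (\<lambda>n. \<rho> (u n))"
proof (rule Cauchy_convergent, rule metric_CauchyI)
  fix e :: real assume "e > 0"
  then obtain N where N: "\<And>m n. m\<ge>N \<Longrightarrow> n \<ge> N \<Longrightarrow> \<rho> (vminus A (u m) (u n)) < e"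
    using CS_E[OF u] by blast
  have "dist (\<rho> (u m)) (\<rho> (u n)) < e" if "m \<ge> N" "n \<ge> N" for m n
    unfolding dist_real_def
    by (rule le_less_trans[OF norm_diff_le N]) (use that u in auto)
  then show "\<exists>M. \<forall>m\<ge>M. \<forall>n\<ge>M. dist (\<rho> (u m)) (\<rho> (u n)) < e" by blast
qed

text \<open>The norm of the completion is \<open>the_elem\<close> of the set of limits over all
  representatives. The reverse triangle inequality shows that equivalent sequences have the same
  limit, so this set is a singleton.\<close>

lemma anorm_completion: "u \<in> CS \<Longrightarrow> (\<lambda>n. \<rho> (u n)) \<longlonglongrightarrow> anorm \<C> (cls u)"
proof -
  assume u: "u \<in> CS"
  have "lim (\<lambda>n. \<rho> (v n)) = lim (\<lambda>n. \<rho> (u n))" if "v \<in> cls u" for v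
  proof -
    have v: "v \<in> CS" "(\<lambda>n. \<rho> (vminus A (u n) (v n))) \<longlonglongrightarrow> 0" using that u by (auto simp: mem_cls_iff)
    have "(\<lambda>n. \<rho> (u n) - \<rho> (v n)) \<longlonglongrightarrow> 0"
      by (rule Lim_null_comparison[OF _ v(2)]) (use norm_diff_le u v in auto)
    then have "(\<lambda>n. \<rho> (u n) - (\<rho> (u n) - \<rho> (v n))) \<longlonglongrightarrow> lim (\<lambda>n. \<rho> (u n)) - 0"
      using CS_norm_convergent[OF u] by (intro tendsto_diff) (auto simp: convergent_LIMSEQ_iff)
    then show ?thesis by (simp add: limI)
  qed
  then have "(\<lambda>v. lim (\<lambda>n. \<rho> (v n))) ` cls u = (\<lambda>_. lim (\<lambda>n. \<rho> (u n))) ` cls u"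
    by (rule image_cong[OF refl])
  also have "\<dots> = {lim (\<lambda>n. \<rho> (u n))}"
    using self_mem_cls[OF u] by blast
  finally have "(\<lambda>v. lim (\<lambda>n. \<rho> (v n))) ` cls u = {lim (\<lambda>n. \<rho> (u n))}" .
  then have "anorm \<C> (cls u) = lim (\<lambda>n. \<rho> (u n))"
    by (simp add: cstar_completion_def Let_def)
  then show ?thesis using CS_norm_convergent[OF u] by (simp add: convergent_LIMSEQ_iff)
qed

lemma anorm_const [simp]: "a \<in> vcarrier A \<Longrightarrow> anorm \<C> (cls (\<lambda>n. a)) = \<rho> a"
  using anorm_completion[of "\<lambda>n. a"] by (simp add: LIMSEQ_const_iff)

lemma vminus_completion [simp]:
  "\<lbrakk>u \<in> CS; v \<in> CS\<rbrakk> \<Longrightarrow> vminus \<C> (cls u) (cls v) = cls (\<lambda>n. vminus A (u n) (v n))"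
  by (simp add: vminus_def)

lemma CS_vminus [simp, intro]: "\<lbrakk>u \<in> CS; v \<in> CS\<rbrakk> \<Longrightarrow> (\<lambda>n. vminus A (u n) (v n)) \<in> CS"
  by (simp add: vminus_def)

text \<open>Each axiom holds term by term for representing sequences.\<close>

lemma star_algebra_completion: "star_algebra \<C>"
proof
  show "vzero \<C> \<in> vcarrier \<C>" by (auto simp: vzero_completion)
qed (auto elim!: completion_cases simp: vzero_completion vplus_neg vscale_one vplus_assoc vscale_assoc
    vscale_vplus vscale_add amult_assoc amult_vplus_left amult_vplus_right amult_vscale_left amult_vscale_right
    astar_astar astar_vplus astar_vscale astar_amult vplus_commute vplus_left_commute)

lemma cstar_seminorm_completion: "cstar_seminorm \<C> (anorm \<C>)"
  unfolding cstar_seminorm_def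
proof (safe elim!: completion_cases)
  fix u assume u: "u \<in> CS"
  show "0 \<le> anorm \<C> (cls u)"
    by (rule LIMSEQ_le_const[OF anorm_completion[OF u]]) (use u in auto)
  show "anorm \<C> (vscale \<C> t (cls u)) = cmod t * anorm \<C> (cls u)" for t
  proof (rule LIMSEQ_unique)
    show "(\<lambda>n. cmod t * \<rho> (u n)) \<longlonglongrightarrow> anorm \<C> (vscale \<C> t (cls u))"
      using anorm_completion[OF CS_vscale[OF u, of t]] u by (simp add: norm_vscale)
    show "(\<lambda>n. cmod t * \<rho> (u n)) \<longlonglongrightarrow> cmod t * anorm \<C> (cls u)"
      by (intro tendsto_mult_left anorm_completion u)
  qed
  show "anorm \<C> (amult \<C> (astar \<C> (cls u)) (cls u)) = (anorm \<C> (cls u))\<^sup>2"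
  proof (rule LIMSEQ_unique)
    show "(\<lambda>n. (\<rho> (u n))\<^sup>2) \<longlonglongrightarrow> anorm \<C> (amult \<C> (astar \<C> (cls u)) (cls u))"
      using anorm_completion[OF CS_amult[OF CS_astar[OF u] u]] u by (simp add: norm_star_amult)
    show "(\<lambda>n. (\<rho> (u n))\<^sup>2) \<longlonglongrightarrow> (anorm \<C> (cls u))\<^sup>2"
      by (intro tendsto_power anorm_completion u)
  qed
  fix v assume v: "v \<in> CS"
  show "anorm \<C> (vplus \<C> (cls u) (cls v)) \<le> anorm \<C> (cls u) + anorm \<C> (cls v)"
    using LIMSEQ_le[OF anorm_completion[OF CS_vplus[OF u v]] tendsto_add[OF anorm_completion[OF u] anorm_completion[OF v]]] u v
    by (simp add: norm_triangle)
  show "anorm \<C> (amult \<C> (cls u) (cls v)) \<le> anorm \<C> (cls u) * anorm \<C> (cls v)"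
    using LIMSEQ_le[OF anorm_completion[OF CS_amult[OF u v]] tendsto_mult[OF anorm_completion[OF u] anorm_completion[OF v]]] u v
    by (simp add: norm_amult)
qed

lemma completion_definite: "P \<in> vcarrier \<C> \<Longrightarrow> anorm \<C> P = 0 \<Longrightarrow> P = vzero \<C>"
proof (elim completion_cases)
  fix u assume "anorm \<C> P = 0" and u: "u \<in> CS" "P = cls u"
  then have "(\<lambda>n. \<rho> (u n)) \<longlonglongrightarrow> 0" using anorm_completion[of u] by simp
  then show "P = vzero \<C>" using u by (simp add: vzero_completion cls_eq_iff)
qed

text \<open>The Cauchy estimate between two terms passes to the limit in one of the indices. This
  weakens \<open><\<close> to \<open>\<le>\<close>, hence the \<open>r/2\<close>. Read as a density
  statement: the image of \<open>A\<close> is dense in its completion.\<close>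

lemma cls_dense:
  assumes "u \<in> CS" shows "(\<lambda>n. anorm \<C> (vminus \<C> (cls u) (cls (\<lambda>k. u n)))) \<longlonglongrightarrow> 0"
proof (rule LIMSEQ_I)
  fix r :: real assume "r > 0"
  then obtain N where N: "\<And>m n. m\<ge>N \<Longrightarrow> n \<ge> N \<Longrightarrow> \<rho> (vminus A (u m) (u n)) < r/2"
    using CS_D[OF assms, of "r/2"] by auto
  interpret C: seminormed_space \<C> "anorm \<C>"
    using star_algebra_completion cstar_seminorm_completion by (rule cstar_seminorm_imp_seminormed)
  have "anorm \<C> (vminus \<C> (cls u) (cls (\<lambda>k. u n))) \<le> r/2" if "n \<ge> N" for n
  proof (rule LIMSEQ_le_const2)
    show "(\<lambda>m. \<rho> (vminus A (u m) (u n))) \<longlonglongrightarrow> anorm \<C> (vminus \<C> (cls u) (cls (\<lambda>k. u n)))"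
      using anorm_completion[of "\<lambda>m. vminus A (u m) (u n)"] assms CS_vminus[of u "\<lambda>k. u n"] by simp
    show "\<exists>N. \<forall>m\<ge>N. \<rho> (vminus A (u m) (u n)) \<le> r/2" using N that by (meson less_imp_le)
  qed
  moreover have "0 \<le> anorm \<C> (vminus \<C> (cls u) (cls (\<lambda>k. u n)))" for n
    by (rule C.norm_nonneg, rule C.vminus_closed) (use assms in auto)
  ultimately show "\<exists>N. \<forall>n\<ge>N. norm (anorm \<C> (vminus \<C> (cls u) (cls (\<lambda>k. u n))) - 0) < r"
    using \<open>r > 0\<close> by (intro exI[of _ N]) force
qed

text \<open>Completeness is a diagonal argument: choose \<open>a k\<close> in \<open>A\<close>
  within \<open>1 / Suc k\<close> of the \<open>k\<close>-th class. These elements form a Cauchy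
  sequence, and its class is the limit.\<close>

lemma cstar_algebra_completion: "cstar_algebra \<C>"
proof -
  interpret C: seminormed_space \<C> "anorm \<C>"
    using star_algebra_completion cstar_seminorm_completion by (rule cstar_seminorm_imp_seminormed)
  have "Metric_space.mcomplete (vcarrier \<C>) (norm_dist \<C> (anorm \<C>)) \<longleftrightarrow>
      (\<forall>s. s \<in> cauchy_seqs \<C> (anorm \<C>) \<longrightarrow> (\<exists>l \<in> vcarrier \<C>. (\<lambda>n. anorm \<C> (vminus \<C> (s n) l)) \<longlonglongrightarrow> 0))"
    by (rule C.mcomplete_norm_dist_iff) (rule completion_definite)
  moreover have "\<exists>l \<in> vcarrier \<C>. (\<lambda>n. anorm \<C> (vminus \<C> (S n) l)) \<longlonglongrightarrow> 0"
    if S: "S \<in> cauchy_seqs \<C> (anorm \<C>)" for S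
  proof -
    have Sc: "S k \<in> vcarrier \<C>" for k using S by (simp add: cauchy_seqs_def)
    have "\<exists>a \<in> vcarrier A. anorm \<C> (vminus \<C> (S k) (cls (\<lambda>_. a))) < 1 / Suc k" for k
    proof -
      obtain u where u: "u \<in> CS" "S k = cls u" using Sc completion_cases by blast
      have "eventually (\<lambda>n. anorm \<C> (vminus \<C> (cls u) (cls (\<lambda>k. u n))) < 1 / Suc k) sequentially"
        using cls_dense[OF u(1)] by (rule order_tendstoD) simp
      then obtain n where "anorm \<C> (vminus \<C> (cls u) (cls (\<lambda>k. u n))) < 1 / Suc k"
        by (auto simp: eventually_sequentially)
      then show ?thesis using u by (intro bexI[of _ "u n"]) auto
    qed
    then obtain a where a: "\<And>k. a k \<in> vcarrier A" "\<And>k. anorm \<C> (vminus \<C> (S k) (cls (\<lambda>_. a k))) < 1 / Suc k"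
      by metis
    have aC: "cls (\<lambda>_. a k) \<in> vcarrier \<C>" for k using a by auto
    have aCS: "a \<in> CS"
    proof (rule CS_I)
      fix e :: real assume "e > 0"
      have "e/3 > 0" using \<open>e > 0\<close> by simp
      then obtain N where N: "\<And>m n. m\<ge>N \<Longrightarrow> n \<ge> N \<Longrightarrow> anorm \<C> (vminus \<C> (S m) (S n)) < e/3"
        using S unfolding cauchy_seqs_def by blast
      obtain M where M: "1 / Suc M < e/3" using \<open>e > 0\<close> nat_approx_posE[of "e/3"] by auto
      show "\<exists>N. \<forall>m\<ge>N. \<forall>n\<ge>N. \<rho> (vminus A (a m) (a n)) < e"
      proof (intro exI allI impI)
        fix m n assume mn: "m \<ge> max N M" "n \<ge> max N M"
        have i: "1 / Suc k < e/3" if "k \<ge> max N M" for k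
          using that by (intro le_less_trans[OF _ M]) (simp add: frac_le)
        have "\<rho> (vminus A (a m) (a n)) = anorm \<C> (vminus \<C> (cls (\<lambda>_. a m)) (cls (\<lambda>_. a n)))"
          using a(1) by simp
        also have "\<dots> \<le> anorm \<C> (vminus \<C> (cls (\<lambda>_. a m)) (S m)) + anorm \<C> (vminus \<C> (S m) (cls (\<lambda>_. a n)))"
          by (intro C.norm_vminus_triangle aC Sc)
        also have "\<dots> \<le> anorm \<C> (vminus \<C> (cls (\<lambda>_. a m)) (S m)) + (anorm \<C> (vminus \<C> (S m) (S n)) + anorm \<C> (vminus \<C> (S n) (cls (\<lambda>_. a n))))"
          by (intro add_left_mono C.norm_vminus_triangle aC Sc)
        also have "anorm \<C> (vminus \<C> (cls (\<lambda>_. a m)) (S m)) = anorm \<C> (vminus \<C> (S m) (cls (\<lambda>_. a m)))"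
          by (intro C.norm_vminus_commute aC Sc)
        finally show "\<rho> (vminus A (a m) (a n)) < e"
          using a(2)[of m] a(2)[of n] i[OF mn(1)] i[OF mn(2)] N[of m n] mn by auto
      qed
    qed (use a in auto)
    have "(\<lambda>n. anorm \<C> (vminus \<C> (S n) (cls a))) \<longlonglongrightarrow> 0"
    proof (rule null_sandwich)
      show "(\<lambda>n. 1 / Suc n + anorm \<C> (vminus \<C> (cls a) (cls (\<lambda>_. a n)))) \<longlonglongrightarrow> 0"
        using cls_dense[OF aCS] LIMSEQ_Suc[OF lim_const_over_n[of 1]] by (intro tendsto_add_zero) auto
      fix n
      have "anorm \<C> (vminus \<C> (S n) (cls a)) \<le> anorm \<C> (vminus \<C> (S n) (cls (\<lambda>_. a n))) + anorm \<C> (vminus \<C> (cls (\<lambda>_. a n)) (cls a))"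
        using aCS by (intro C.norm_vminus_triangle aC Sc) auto
      also have "anorm \<C> (vminus \<C> (cls (\<lambda>_. a n)) (cls a)) = anorm \<C> (vminus \<C> (cls a) (cls (\<lambda>_. a n)))"
        using aCS by (intro C.norm_vminus_commute aC) auto
      finally show "anorm \<C> (vminus \<C> (S n) (cls a)) \<le> 1 / Suc n + anorm \<C> (vminus \<C> (cls a) (cls (\<lambda>_. a n)))"
        using a(2)[of n] by simp
      show "0 \<le> anorm \<C> (vminus \<C> (S n) (cls a))"
        using aCS Sc by (intro C.norm_nonneg C.vminus_closed) auto
    qed
    then show "\<exists>l\<in>vcarrier \<C>. (\<lambda>n. anorm \<C> (vminus \<C> (S n) l)) \<longlonglongrightarrow> 0" using aCS by blast
  qed
  ultimately have "Metric_space.mcomplete (vcarrier \<C>) (norm_dist \<C> (anorm \<C>))" by blast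
  then show ?thesis
    using star_algebra_completion cstar_seminorm_completion completion_definite
    by (simp add: cstar_algebra_def cstar_algebra_axioms_def)
qed

end

section \<open>Corners\<close>

lemma dense_spanI:
  assumes "cstar_algebra A"
    and "\<And>a \<epsilon>. \<lbrakk>a \<in> vcarrier A; 0 < \<epsilon>\<rbrakk> \<Longrightarrow> \<exists>b \<in> vcarrier A \<inter> (vsubspace A hull S). anorm A (vminus A a b) < \<epsilon>"
  shows "dense_span A S"
proof -
  interpret cstar_algebra A by fact
  interpret seminormed_space A "anorm A"
    by (rule cstar_seminorm_imp_seminormed[OF star_algebra_axioms anorm_cstar])
  interpret M: Metric_space "vcarrier A" "norm_dist A (anorm A)"
    by (rule Metric_space_norm_dist[OF anorm_eq_0])
  have "vcarrier A \<subseteq> M.mtopology closure_of (vsubspace A hull S)"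
  proof
    fix a assume a: "a \<in> vcarrier A"
    show "a \<in> M.mtopology closure_of (vsubspace A hull S)"
      unfolding M.metric_closure_of
    proof (intro CollectI conjI a allI impI)
      fix r :: real assume "0 < r"
      with assms(2)[OF a] obtain b where "b \<in> vcarrier A" "b \<in> vsubspace A hull S" "anorm A (vminus A a b) < r"
        by auto
      then show "\<exists>y\<in>vsubspace A hull S. y \<in> M.mball a r"
        using a by (intro bexI[of _ b]) (auto simp: norm_dist_def)
    qed
  qed
  moreover have "M.mtopology closure_of (vsubspace A hull S) \<subseteq> vcarrier A"
    using closure_of_subset_topspace[of M.mtopology] by simp
  ultimately show ?thesis unfolding dense_span_def by blast
qed

text \<open>The bimodule is the left ideal \<open>Ap\<close>, with inner products
  \<open>x y*\<close> in \<open>A\<close> and \<open>x* y\<close> in the corner \<open>pAp\<close>,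
  which \<open>\<psi>\<close> identifies with \<open>B\<close>. Positivity of
  \<open>\<psi> (x* x)\<close> is assumed separately: \<open>x\<close> lies in \<open>Ap\<close> and
  need not lie in \<open>pAp\<close>, so \<open>x\<close> itself does not provide a root inside the
  corner.\<close>

theorem morita_equivalent_corner:
  fixes A :: "('a, 'm) cstar_alg_scheme" and B :: "('b, 'n) cstar_alg_scheme"
    and p :: 'a and \<psi> :: "'a \<Rightarrow> 'b" and K L :: "'a set"
  defines "K \<equiv> {a \<in> vcarrier A. amult A p a = a \<and> amult A a p = a}"
    and "L \<equiv> {a \<in> vcarrier A. amult A a p = a}"
  assumes A: "cstar_algebra A" and B: "cstar_algebra B"
    and p: "p \<in> vcarrier A" "astar A p = p" "amult A p p = p"
    and bij: "bij_betw \<psi> K (vcarrier B)"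
    and \<psi>_vplus: "\<And>a b. a \<in> K \<Longrightarrow> b \<in> K \<Longrightarrow> \<psi> (vplus A a b) = vplus B (\<psi> a) (\<psi> b)"
    and \<psi>_vscale: "\<And>t a. a \<in> K \<Longrightarrow> \<psi> (vscale A t a) = vscale B t (\<psi> a)"
    and \<psi>_amult: "\<And>a b. a \<in> K \<Longrightarrow> b \<in> K \<Longrightarrow> \<psi> (amult A a b) = amult B (\<psi> a) (\<psi> b)"
    and \<psi>_astar: "\<And>a. a \<in> K \<Longrightarrow> \<psi> (astar A a) = astar B (\<psi> a)"
    and \<psi>_norm: "\<And>a. a \<in> K \<Longrightarrow> anorm B (\<psi> a) = anorm A a"
    and \<psi>_pos: "\<And>x. x \<in> L \<Longrightarrow> \<psi> (amult A (astar A x) x) \<in> positive_elements B"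
    and full: "dense_span A {amult A x (astar A y) |x y. x \<in> L \<and> y \<in> L}"
  shows "morita_equivalent A B"
proof -
  interpret A: cstar_algebra A by fact
  interpret B: cstar_algebra B by fact
  interpret AN: star_algebra_seminorm A "anorm A" by unfold_locales (rule A.anorm_cstar)
  define \<phi> where "\<phi> = inv_into K \<psi>"
  have \<phi>K: "\<phi> b \<in> K" if "b \<in> vcarrier B" for b
    using bij that unfolding \<phi>_def by (auto simp: bij_betw_def intro: inv_into_into)
  have \<phi>A [simp, intro]: "\<phi> b \<in> vcarrier A" if "b \<in> vcarrier B" for b
    using \<phi>K[OF that] by (simp add: K_def)
  have \<phi>L: "amult A p (\<phi> b) = \<phi> b" "amult A (\<phi> b) p = \<phi> b" if "b \<in> vcarrier B" for b
    using \<phi>K[OF that] by (simp_all add: K_def)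
  have \<psi>\<phi>: "\<psi> (\<phi> b) = b" if "b \<in> vcarrier B" for b
    using bij that unfolding \<phi>_def by (auto simp: bij_betw_def f_inv_into_f)
  have \<psi>B: "\<psi> a \<in> vcarrier B" if "a \<in> K" for a using bij that by (auto simp: bij_betw_def)
  have \<phi>\<psi>: "\<phi> (\<psi> a) = a" if "a \<in> K" for a
    using bij that unfolding \<phi>_def by (auto simp: bij_betw_def)
  have \<phi>I: "\<phi> b = a" if "a \<in> K" "\<psi> a = b" for a b using \<phi>\<psi> that by blast
  have KA: "a \<in> K \<Longrightarrow> a \<in> vcarrier A" for a by (simp add: K_def)
  have KI: "a \<in> vcarrier A \<Longrightarrow> amult A p a = a \<Longrightarrow> amult A a p = a \<Longrightarrow> a \<in> K" for a by (simp add: K_def)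
  have LI: "a \<in> vcarrier A \<Longrightarrow> amult A a p = a \<Longrightarrow> a \<in> L" for a by (simp add: L_def)
  have pLK: "p \<in> L" "b \<in> K \<Longrightarrow> b \<in> L" for b using p by (auto simp: L_def K_def)
  have Lp: "a \<in> L \<Longrightarrow> amult A a p = a" for a by (simp add: L_def)
  have LA [simp, intro]: "a \<in> L \<Longrightarrow> a \<in> vcarrier A" for a by (simp add: L_def)
  have K_ops: "vplus A a b \<in> K" "vscale A t a \<in> K" "amult A a b \<in> K" "astar A a \<in> K"
    if "a \<in> K" "b \<in> K" for a b t
    using that p A.astar_amult[of p a] A.astar_amult[of a p]
    by (auto simp: K_def A.amult_vplus_left A.amult_vplus_right A.amult_vscale_left A.amult_vscale_right A.amult_assoc)
       (simp_all flip: A.amult_assoc)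
  have \<phi>_vplus: "\<phi> (vplus B b d) = vplus A (\<phi> b) (\<phi> d)" if "b \<in> vcarrier B" "d \<in> vcarrier B" for b d
    using that by (intro \<phi>I K_ops \<phi>K) (auto simp: \<psi>_vplus \<phi>K \<psi>\<phi>)
  have \<phi>_vscale: "\<phi> (vscale B t b) = vscale A t (\<phi> b)" if "b \<in> vcarrier B" for b t
    using that by (intro \<phi>I K_ops[OF \<phi>K \<phi>K] \<phi>K) (auto simp: \<psi>_vscale \<phi>K \<psi>\<phi>)
  have \<phi>_amult: "\<phi> (amult B b d) = amult A (\<phi> b) (\<phi> d)" if "b \<in> vcarrier B" "d \<in> vcarrier B" for b d
    using that by (intro \<phi>I K_ops \<phi>K) (auto simp: \<psi>_amult \<phi>K \<psi>\<phi>)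
  have \<phi>_astar: "\<phi> (astar B b) = astar A (\<phi> b)" if "b \<in> vcarrier B" for b
    using that by (intro \<phi>I K_ops[OF \<phi>K \<phi>K] \<phi>K) (auto simp: \<psi>_astar \<phi>K \<psi>\<phi>)
  have L_ops [simp]: "vzero A \<in> L" "\<And>a b. a \<in> L \<Longrightarrow> b \<in> L \<Longrightarrow> vplus A a b \<in> L" "\<And>a t. a \<in> L \<Longrightarrow> vscale A t a \<in> L"
    "\<And>a b. a \<in> vcarrier A \<Longrightarrow> b \<in> L \<Longrightarrow> amult A a b \<in> L"
    using p by (auto intro!: LI simp: A.amult_vplus_left A.amult_vscale_left A.amult_assoc Lp)
  have L_\<phi> [simp]: "amult A a (\<phi> b) \<in> L" if "a \<in> L" "b \<in> vcarrier B" for a b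
    using that p by (auto intro!: LI simp: A.amult_assoc \<phi>L)
  have LK: "amult A (astar A x) y \<in> K" if "x \<in> L" "y \<in> L" for x y
  proof -
    have "amult A p (astar A x) = astar A x"
      using A.astar_amult[of x p] that p by (simp add: Lp)
    then show ?thesis using that p by (intro KI) (auto simp: A.amult_assoc Lp simp flip: A.amult_assoc[of p])
  qed
  have \<psi>_LL\<phi>: "\<psi> (amult A (astar A x) (amult A y (\<phi> b))) = amult B (\<psi> (amult A (astar A x) y)) b"
    if "x \<in> L" "y \<in> L" "b \<in> vcarrier B" for x y b
  proof -
    have "amult A (astar A x) (amult A y (\<phi> b)) = amult A (amult A (astar A x) y) (\<phi> b)"
      using that by (simp add: A.amult_assoc)
    then show ?thesis using that by (simp add: \<psi>_amult LK \<phi>K \<psi>\<phi>)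
  qed
  \<comment> \<open>Morita equivalence asks for a bimodule of type \<open>'a \<times> 'b\<close>. An
    element \<open>x\<close> of \<open>L\<close> is stored as \<open>(x, vzero B)\<close>.\<close>
  define X :: "('a, 'b, 'a \<times> 'b) bimod" where "X =
    \<lparr>vcarrier = (\<lambda>x. (x, vzero B)) ` L, vzero = (vzero A, vzero B),
     vplus = (\<lambda>x y. (vplus A (fst x) (fst y), vzero B)), vscale = (\<lambda>t x. (vscale A t (fst x), vzero B)),
     lact = (\<lambda>a x. (amult A a (fst x), vzero B)), ract = (\<lambda>x b. (amult A (fst x) (\<phi> b), vzero B)),
     linner = (\<lambda>x y. amult A (fst x) (astar A (fst y))), rinner = (\<lambda>x y. \<psi> (amult A (astar A (fst x)) (fst y)))\<rparr>"
  have X_simps [simp]: "vcarrier X = (\<lambda>x. (x, vzero B)) ` L" "vzero X = (vzero A, vzero B)"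
     "vplus X x y = (vplus A (fst x) (fst y), vzero B)" "vscale X t x = (vscale A t (fst x), vzero B)"
     "lact X a x = (amult A a (fst x), vzero B)" "ract X x b = (amult A (fst x) (\<phi> b), vzero B)"
     "linner X x y = amult A (fst x) (astar A (fst y))" "rinner X x y = \<psi> (amult A (astar A (fst x)) (fst y))"
    for x y t a b by (simp_all add: X_def)
  interpret X: seminormed_space X "\<lambda>x. anorm A (fst x)"
    by unfold_locales
      (auto simp: A.vplus_assoc A.vplus_neg A.vscale_one A.vscale_assoc A.vscale_vplus A.vscale_add
        AN.norm_vscale AN.norm_triangle intro: A.vplus_commute)
  \<comment> \<open>Both inner products induce on \<open>L\<close> the norm of \<open>A\<close>, so
    one argument proves both completeness axioms.\<close>
  have X_complete: "Metric_space.mcomplete (vcarrier X) (norm_dist X \<nu>)"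
    if \<nu>: "\<And>x. x \<in> L \<Longrightarrow> \<nu> (x, vzero B) = anorm A x" for \<nu>
  proof -
    have eq: "norm_dist X \<nu> = norm_dist X (\<lambda>x. anorm A (fst x))"
      using \<nu> by (auto simp: norm_dist_def vminus_def fun_eq_iff)
    have "Metric_space.mcomplete (vcarrier X) (norm_dist X (\<lambda>x. anorm A (fst x))) \<longleftrightarrow>
      (\<forall>s. s \<in> cauchy_seqs X (\<lambda>x. anorm A (fst x)) \<longrightarrow>
        (\<exists>l \<in> vcarrier X. (\<lambda>n. anorm A (fst (vminus X (s n) l))) \<longlonglongrightarrow> 0))"
      by (rule X.mcomplete_norm_dist_iff) (auto intro: A.anorm_eq_0)
    moreover have "\<exists>l \<in> vcarrier X. (\<lambda>n. anorm A (fst (vminus X (s n) l))) \<longlonglongrightarrow> 0"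
      if s: "s \<in> cauchy_seqs X (\<lambda>x. anorm A (fst x))" for s
    proof -
      define u where "u n = fst (s n)" for n
      have "s n \<in> vcarrier X" for n using s unfolding cauchy_seqs_def by blast
      then have uL: "u n \<in> L" for n unfolding u_def by (metis (no_types, lifting) X_simps(1) fst_conv imageE)
      have "fst (vminus X (s m) (s n)) = vminus A (u m) (u n)" for m n
        by (simp add: vminus_def u_def)
      then have "u \<in> cauchy_seqs A (anorm A)"
        using s LA[OF uL] unfolding cauchy_seqs_def by simp
      moreover have "Metric_space.mcomplete (vcarrier A) (norm_dist A (anorm A)) \<longleftrightarrow>
          (\<forall>s. s \<in> cauchy_seqs A (anorm A) \<longrightarrow> (\<exists>l \<in> vcarrier A. (\<lambda>n. anorm A (vminus A (s n) l)) \<longlonglongrightarrow> 0))"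
        by (rule AN.mcomplete_norm_dist_iff) (rule A.anorm_eq_0)
      ultimately obtain l where l: "l \<in> vcarrier A" "(\<lambda>n. anorm A (vminus A (u n) l)) \<longlonglongrightarrow> 0"
        using A.anorm_complete by blast
      \<comment> \<open>The limit \<open>l\<close> belongs to \<open>L\<close>: since
        \<open>u n\<close> times \<open>p\<close> is \<open>u n\<close>, the sequence converges to
        both \<open>l\<close> and \<open>l\<close> times \<open>p\<close>.\<close>
      have "(\<lambda>n. anorm A (vminus A (amult A l p) l)) \<longlonglongrightarrow> 0"
      proof (rule AN.null_sandwich)
        show "(\<lambda>n. anorm A (vminus A (u n) l) * anorm A p + anorm A (vminus A (u n) l)) \<longlonglongrightarrow> 0"
          by (intro tendsto_add_zero tendsto_mult_left_zero l)
        fix n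
        have "anorm A (vminus A (amult A l p) l) \<le> anorm A (vminus A (amult A l p) (u n)) + anorm A (vminus A (u n) l)"
          using l p uL by (intro AN.norm_vminus_triangle) auto
        also have "vminus A (amult A l p) (u n) = amult A (vminus A l (u n)) p"
          using l p uL by (simp add: A.amult_vminus_left Lp)
        also have "anorm A \<dots> \<le> anorm A (vminus A l (u n)) * anorm A p"
          using l p uL by (intro AN.norm_amult) auto
        also have "anorm A (vminus A l (u n)) = anorm A (vminus A (u n) l)"
          using l p uL by (intro AN.norm_vminus_commute) auto
        finally show "anorm A (vminus A (amult A l p) l) \<le> anorm A (vminus A (u n) l) * anorm A p + anorm A (vminus A (u n) l)"
          by simp
      qed (use l p in auto)
      then have "anorm A (vminus A (amult A l p) l) = 0" by (simp add: LIMSEQ_const_iff)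
      then have "amult A l p = l"
        using l p by (metis A.anorm_eq_0 A.amult_closed A.vminus_closed A.vminus_eq_0)
      then have "l \<in> L" using l by (intro LI)
      moreover have "fst (vminus X (s n) (l, vzero B)) = vminus A (u n) l" for n
        by (simp add: vminus_def u_def)
      ultimately show ?thesis using l(2) by (intro bexI[of _ "(l, vzero B)"]) auto
    qed
    ultimately show ?thesis unfolding eq by blast
  qed
  have "imprimitivity_bimodule A B X"
  proof
    show "Metric_space.mcomplete (vcarrier X) (norm_dist X (\<lambda>x. sqrt (anorm A (linner X x x))))"
    proof (rule X_complete)
      fix x assume "x \<in> L"
      then have "anorm A (amult A x (astar A x)) = (anorm A x)\<^sup>2"
        using AN.norm_star_amult[of "astar A x"] by (simp add: A.astar_astar)
      then show "sqrt (anorm A (linner X (x, vzero B) (x, vzero B))) = anorm A x"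
        using \<open>x \<in> L\<close> by simp
    qed
    show "Metric_space.mcomplete (vcarrier X) (norm_dist X (\<lambda>x. sqrt (anorm B (rinner X x x))))"
    proof (rule X_complete)
      fix x assume "x \<in> L"
      then show "sqrt (anorm B (rinner X (x, vzero B) (x, vzero B))) = anorm A x"
        using AN.norm_star_amult[of x] by (simp add: \<psi>_norm LK)
    qed
    have "{linner X x y |x y. x \<in> vcarrier X \<and> y \<in> vcarrier X} = {amult A x (astar A y) |x y. x \<in> L \<and> y \<in> L}"
      by auto blast
    with full show "dense_span A {linner X x y |x y. x \<in> vcarrier X \<and> y \<in> vcarrier X}" by simp
    show "dense_span B {rinner X x y |x y. x \<in> vcarrier X \<and> y \<in> vcarrier X}"
    proof (rule dense_spanI[OF B])
      fix b and \<epsilon> :: real assume b: "b \<in> vcarrier B" and "0 < \<epsilon>"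
      have "b = rinner X (p, vzero B) (\<phi> b, vzero B)"
        using b p by (simp add: \<phi>L \<psi>\<phi>)
      then have "b \<in> {rinner X x y |x y. x \<in> vcarrier X \<and> y \<in> vcarrier X}"
        using b \<phi>K[of b] pLK by (simp del: X_simps(8)) blast
      then have "b \<in> vsubspace B hull {rinner X x y |x y. x \<in> vcarrier X \<and> y \<in> vcarrier X}"
        by (rule hull_inc)
      moreover interpret BN: star_algebra_seminorm B "anorm B" by unfold_locales (rule B.anorm_cstar)
      have "anorm B (vminus B b b) < \<epsilon>" using b \<open>0 < \<epsilon>\<close> by simp
      ultimately show "\<exists>d\<in>vcarrier B \<inter> (vsubspace B hull {rinner X x y |x y. x \<in> vcarrier X \<and> y \<in> vcarrier X}).
          anorm B (vminus B b d) < \<epsilon>" using b by blast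
    qed
    fix x assume x: "x \<in> vcarrier X"
    show "linner X x x \<in> positive_elements A"
      using x by (auto simp: positive_elements_def A.astar_astar intro!: image_eqI[of _ _ "astar A (fst x)"])
    show "rinner X x x \<in> positive_elements B" using x \<psi>_pos by auto
    show "x = vzero X" if "linner X x x = vzero A"
    proof -
      have "(anorm A (fst x))\<^sup>2 = anorm A (amult A (fst x) (astar A (fst x)))"
        using AN.norm_star_amult[of "astar A (fst x)"] x by (auto simp: A.astar_astar)
      then show ?thesis using that x by (auto intro: A.anorm_eq_0)
    qed
    show "x = vzero X" if r0: "rinner X x x = vzero B"
    proof -
      have xL: "fst x \<in> L" using x by auto
      interpret BN: star_algebra_seminorm B "anorm B" by unfold_locales (rule B.anorm_cstar)
      have "(anorm A (fst x))\<^sup>2 = anorm A (amult A (astar A (fst x)) (fst x))"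
        using AN.norm_star_amult[of "fst x"] xL by simp
      also have "\<dots> = anorm B (rinner X x x)" using xL by (simp add: \<psi>_norm LK)
      finally have "(anorm A (fst x))\<^sup>2 = 0" using r0 by simp
      then show ?thesis using x by (auto intro: A.anorm_eq_0)
    qed
  qed (auto simp: A.amult_assoc A.amult_vplus_left A.amult_vplus_right A.amult_vscale_left A.amult_vscale_right
      A.astar_vplus A.astar_vscale A.astar_amult A.astar_astar \<phi>_vplus \<phi>_vscale \<phi>_amult \<phi>_astar \<psi>B LK
      \<psi>_vplus \<psi>_vscale \<psi>_amult \<phi>K \<psi>\<phi> \<phi>\<psi> \<psi>_LL\<phi> simp flip: \<psi>_astar \<psi>_vplus \<psi>_vscale)
  then show ?thesis unfolding morita_equivalent_def by blast
qed

section \<open>The universal seminorm\<close>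

text \<open>The pointwise bound makes the real supremum meaningful. The axioms then pass to the
  supremum one by one; for the C*-identity this uses that squares and square roots are monotone on
  nonnegative numbers.\<close>

lemma (in star_algebra) cstar_seminorm_universal:
  assumes bounded: "\<And>a. a \<in> vcarrier A \<Longrightarrow> \<exists>M. \<forall>\<rho>. cstar_seminorm A \<rho> \<longrightarrow> \<rho> a \<le> M"
  shows cstar_seminorm_le_universal:
      "\<And>\<rho> a. cstar_seminorm A \<rho> \<Longrightarrow> a \<in> vcarrier A \<Longrightarrow> \<rho> a \<le> universal_seminorm A a"
    and "cstar_seminorm A (universal_seminorm A)"
proof -
  let ?S = "{\<rho>. cstar_seminorm A \<rho>}" and ?U = "universal_seminorm A"
  \<comment> \<open>The zero seminorm makes the set of seminorms non-empty and the supremum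
    nonnegative.\<close>
  have zero: "cstar_seminorm A (\<lambda>_. 0)" by (simp add: cstar_seminorm_def)
  then have ne: "?S \<noteq> {}" by blast
  show le: "\<rho> a \<le> ?U a" if "cstar_seminorm A \<rho>" "a \<in> vcarrier A" for \<rho> a
    unfolding universal_seminorm_def
    by (rule cSUP_upper) (use that bounded[OF that(2)] in \<open>auto simp: bdd_above_def\<close>)
  have least: "?U a \<le> M" if "\<And>\<rho>. cstar_seminorm A \<rho> \<Longrightarrow> \<rho> a \<le> M" for a M
    unfolding universal_seminorm_def by (rule cSUP_least[OF ne]) (use that in auto)
  have nonneg: "0 \<le> ?U a" if "a \<in> vcarrier A" for a using le[OF zero that] by simp
  have scale_le: "?U (vscale A t a) \<le> cmod t * ?U a" if "a \<in> vcarrier A" for t a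
  proof (rule least)
    fix \<rho> assume \<rho>: "cstar_seminorm A \<rho>"
    then have "\<rho> (vscale A t a) = cmod t * \<rho> a" using that by (simp add: cstar_seminorm_def)
    then show "\<rho> (vscale A t a) \<le> cmod t * ?U a" using le[OF \<rho> that] by (simp add: mult_left_mono)
  qed
  \<comment> \<open>For \<open>t \<noteq> 0\<close> the missing inequality is the proved one for
    \<open>1 / t\<close>, applied to the scaled element.\<close>
  have scale: "?U (vscale A t a) = cmod t * ?U a" if a: "a \<in> vcarrier A" for t a
  proof (cases "t = 0")
    case True
    then show ?thesis using scale_le[OF a, of 0] nonneg[of "vscale A 0 a"] a by simp
  next
    case False
    have "?U a = ?U (vscale A (1 / t) (vscale A t a))" using False a by (simp add: vscale_assoc vscale_one)
    also have "\<dots> \<le> cmod (1 / t) * ?U (vscale A t a)" using a by (intro scale_le) simp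
    finally have "cmod t * ?U a \<le> ?U (vscale A t a)" using False by (simp add: norm_divide field_simps)
    then show ?thesis using scale_le[OF a, of t] by simp
  qed
  have star: "?U (amult A (astar A a) a) = (?U a)\<^sup>2" if a: "a \<in> vcarrier A" for a
  proof (rule antisym)
    show "?U (amult A (astar A a) a) \<le> (?U a)\<^sup>2"
    proof (rule least)
      fix \<rho> assume \<rho>: "cstar_seminorm A \<rho>"
      then have "\<rho> (amult A (astar A a) a) = (\<rho> a)\<^sup>2" "0 \<le> \<rho> a" using a by (auto simp: cstar_seminorm_def)
      then show "\<rho> (amult A (astar A a) a) \<le> (?U a)\<^sup>2" using le[OF \<rho> a] by (simp add: power_mono)
    qed
    have aa: "amult A (astar A a) a \<in> vcarrier A" using a by simp
    have "?U a \<le> sqrt (?U (amult A (astar A a) a))"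
    proof (rule least)
      fix \<rho> assume \<rho>: "cstar_seminorm A \<rho>"
      then have "\<rho> (amult A (astar A a) a) = (\<rho> a)\<^sup>2" "0 \<le> \<rho> a" using a by (auto simp: cstar_seminorm_def)
      then show "\<rho> a \<le> sqrt (?U (amult A (astar A a) a))" using le[OF \<rho> aa] by (simp add: real_le_rsqrt)
    qed
    then show "(?U a)\<^sup>2 \<le> ?U (amult A (astar A a) a)"
      using nonneg[OF a] nonneg[OF aa] by (metis power_mono real_sqrt_pow2)
  qed
  have triangle: "?U (vplus A a b) \<le> ?U a + ?U b" if "a \<in> vcarrier A" "b \<in> vcarrier A" for a b
  proof (rule least)
    fix \<rho> assume \<rho>: "cstar_seminorm A \<rho>"
    then have "\<rho> (vplus A a b) \<le> \<rho> a + \<rho> b" using that by (auto simp: cstar_seminorm_def)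
    also have "\<dots> \<le> ?U a + ?U b" using le[OF \<rho>] that by (intro add_mono) auto
    finally show "\<rho> (vplus A a b) \<le> ?U a + ?U b" .
  qed
  have mult: "?U (amult A a b) \<le> ?U a * ?U b" if "a \<in> vcarrier A" "b \<in> vcarrier A" for a b
  proof (rule least)
    fix \<rho> assume \<rho>: "cstar_seminorm A \<rho>"
    then have "0 \<le> \<rho> b" using that by (auto simp: cstar_seminorm_def)
    have "\<rho> (amult A a b) \<le> \<rho> a * \<rho> b" using \<rho> that by (auto simp: cstar_seminorm_def)
    also have "\<rho> a * \<rho> b \<le> ?U a * ?U b" using le[OF \<rho>] that nonneg[of a] \<open>0 \<le> \<rho> b\<close> by (intro mult_mono) auto
    finally show "\<rho> (amult A a b) \<le> ?U a * ?U b" .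
  qed
  show "cstar_seminorm A ?U"
    unfolding cstar_seminorm_def
    by (intro conjI ballI allI) (rule nonneg scale star triangle mult; assumption)+
qed

section \<open>Continuous functions on the circle\<close>

abbreviation "\<T> \<equiv> circle_algebra"

lemma circle_algebra_simps [simp]:
  "vzero \<T> = (\<lambda>z. 0)"
  "vplus \<T> f g = (\<lambda>z. f z + g z)"
  "vscale \<T> c f = (\<lambda>z. c * f z)"
  "amult \<T> f g = (\<lambda>z. f z * g z)"
  "astar \<T> f = (\<lambda>z. cnj (f z))"
  by (simp_all add: circle_algebra_def)

lemma vminus_circle [simp]: "vminus \<T> f g = (\<lambda>z. f z - g z)"
  by (simp add: vminus_def)

lemma circle_carrier_iff:
  "f \<in> vcarrier \<T> \<longleftrightarrow> continuous_on (sphere 0 1) f \<and> (\<forall>z. z \<notin> sphere 0 1 \<longrightarrow> f z = 0)"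
  by (simp add: circle_algebra_def)

lemma anorm_circle: "anorm \<T> f = (SUP z\<in>sphere 0 1. cmod (f z))"
  by (simp add: circle_algebra_def)

text \<open>On the circle the supremum is finite by compactness. Elsewhere \<open>f\<close>
  vanishes, and the norm is nonnegative because it dominates the absolute value of \<open>f\<close>
  at 1.\<close>

lemma circle_norm_upper:
  assumes "f \<in> vcarrier \<T>"
  shows "cmod (f z) \<le> anorm \<T> f"
proof -
  have "compact ((\<lambda>z. cmod (f z)) ` sphere 0 1)"
    using assms by (intro compact_continuous_image continuous_on_norm) (auto simp: circle_carrier_iff)
  then have bdd: "bdd_above ((\<lambda>z. cmod (f z)) ` sphere 0 1)"
    by (intro bounded_imp_bdd_above compact_imp_bounded)
  then have *: "cmod (f z) \<le> anorm \<T> f" if "z \<in> sphere 0 1" for z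
    unfolding anorm_circle by (rule cSUP_upper[OF that])
  show ?thesis
    using *[of z] order_trans[OF norm_ge_zero *[of 1]] assms
    by (cases "z \<in> sphere 0 1") (auto simp: circle_carrier_iff)
qed

lemma circle_norm_least: "(\<And>z. cmod z = 1 \<Longrightarrow> cmod (f z) \<le> M) \<Longrightarrow> anorm \<T> f \<le> M"
  unfolding anorm_circle by (rule cSUP_least) (auto intro: exI[of _ 1])

lemma star_algebra_circle: "star_algebra \<T>"
  by unfold_locales
    (auto simp: circle_carrier_iff algebra_simps intro!: continuous_intros)

lemma cstar_seminorm_circle: "cstar_seminorm \<T> (anorm \<T>)"
proof -
  interpret star_algebra \<T> by (rule star_algebra_circle)
  have nn: "0 \<le> anorm \<T> f" if "f \<in> vcarrier \<T>" for f
    using order_trans[OF norm_ge_zero circle_norm_upper[OF that]] .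
  have scale_le: "anorm \<T> (\<lambda>z. t * f z) \<le> cmod t * anorm \<T> f"
    if "f \<in> vcarrier \<T>" for t f
    by (rule circle_norm_least) (simp add: norm_mult mult_left_mono circle_norm_upper[OF that])
  show ?thesis
    unfolding cstar_seminorm_def
  proof (intro conjI ballI allI)
    fix f t assume f: "f \<in> vcarrier \<T>"
    show "0 \<le> anorm \<T> f" by (rule nn[OF f])
    show "anorm \<T> (vscale \<T> t f) = cmod t * anorm \<T> f"
    proof (cases "t = 0")
      case True
      then show ?thesis using scale_le[OF f, of 0] nn[OF vzero_closed] by simp
    next
      case False
      have "anorm \<T> f \<le> cmod (1/t) * anorm \<T> (\<lambda>z. t * f z)"
        using scale_le[OF vscale_closed[OF f, of t], of "1/t"] False by simp
      then show ?thesis using False scale_le[OF f, of t] by (simp add: norm_divide field_simps)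
    qed
    have star: "cmod (cnj (f z) * f z) = (cmod (f z))\<^sup>2" for z
      by (simp add: norm_mult power2_eq_square)
    show "anorm \<T> (amult \<T> (astar \<T> f) f) = (anorm \<T> f)\<^sup>2"
    proof (rule antisym)
      show "anorm \<T> (amult \<T> (astar \<T> f) f) \<le> (anorm \<T> f)\<^sup>2"
        by (rule circle_norm_least) (simp add: star power_mono circle_norm_upper[OF f])
      have ff: "amult \<T> (astar \<T> f) f \<in> vcarrier \<T>"
        using f by (intro amult_closed astar_closed)
      have "anorm \<T> f \<le> sqrt (anorm \<T> (amult \<T> (astar \<T> f) f))"
      proof (rule circle_norm_least)
        fix z show "cmod (f z) \<le> sqrt (anorm \<T> (amult \<T> (astar \<T> f) f))"
          using circle_norm_upper[OF ff, of z] star[of z] by (intro real_le_rsqrt) simp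
      qed
      then show "(anorm \<T> f)\<^sup>2 \<le> anorm \<T> (amult \<T> (astar \<T> f) f)"
        using nn[OF f] nn[OF ff] by (metis power_mono real_sqrt_pow2)
    qed
    fix g assume g: "g \<in> vcarrier \<T>"
    show "anorm \<T> (vplus \<T> f g) \<le> anorm \<T> f + anorm \<T> g"
      by (rule circle_norm_least) (auto intro!: order_trans[OF norm_triangle_ineq] add_mono circle_norm_upper f g)
    show "anorm \<T> (amult \<T> f g) \<le> anorm \<T> f * anorm \<T> g"
      by (rule circle_norm_least) (auto simp: norm_mult intro!: mult_mono circle_norm_upper f g nn)
  qed
qed

lemma circle_anorm_eq_0: "f \<in> vcarrier \<T> \<Longrightarrow> anorm \<T> f = 0 \<Longrightarrow> f = vzero \<T>"
  using circle_norm_upper[of f] by (simp add: fun_eq_iff)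

lemma cstar_algebra_circle: "cstar_algebra \<T>"
proof -
  interpret star_algebra \<T> by (rule star_algebra_circle)
  interpret star_algebra_seminorm \<T> "anorm \<T>"
    by unfold_locales (rule cstar_seminorm_circle)
  have "Metric_space.mcomplete (vcarrier \<T>) (norm_dist \<T> (anorm \<T>)) \<longleftrightarrow>
    (\<forall>s. s \<in> CS \<longrightarrow> (\<exists>l \<in> vcarrier \<T>. (\<lambda>n. anorm \<T> (vminus \<T> (s n) l)) \<longlonglongrightarrow> 0))"
    by (rule mcomplete_norm_dist_iff) (rule circle_anorm_eq_0)
  moreover have "\<exists>l \<in> vcarrier \<T>. (\<lambda>n. anorm \<T> (vminus \<T> (s n) l)) \<longlonglongrightarrow> 0"
    if s: "s \<in> CS" for s
  proof -
    have sc: "s n \<in> vcarrier \<T>" for n using s by simp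
    have "uniformly_Cauchy_on (sphere 0 1) s"
    proof (rule uniformly_Cauchy_onI)
      fix e :: real assume "e > 0"
      then obtain N where N: "\<And>m n. m \<ge> N \<Longrightarrow> n \<ge> N \<Longrightarrow> anorm \<T> (vminus \<T> (s m) (s n)) < e"
        using CS_E[OF s] by blast
      have "dist (s m z) (s n z) < e" if "m \<ge> N" "n \<ge> N" for m n z
        using circle_norm_upper[OF vminus_closed[OF sc sc], of m n z] N[OF that] by (simp add: dist_norm)
      then show "\<exists>M. \<forall>z\<in>sphere 0 1. \<forall>m\<ge>M. \<forall>n\<ge>M. dist (s m z) (s n z) < e" by blast
    qed
    then obtain g where g: "uniform_limit (sphere 0 1) s g sequentially"
      using Cauchy_uniformly_convergent uniformly_convergent_on_def by blast
    \<comment> \<open>The uniform limit is controlled only on the circle; membership in the carrier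
      prescribes the value zero elsewhere.\<close>
    define l where "l z = (if z \<in> sphere 0 1 then g z else 0)" for z
    have "continuous_on (sphere 0 1) g"
      by (rule uniform_limit_theorem[OF _ g]) (use sc in \<open>auto simp: circle_carrier_iff\<close>)
    then have l: "l \<in> vcarrier \<T>"
      unfolding circle_carrier_iff by (auto simp: l_def intro: continuous_on_eq)
    have "(\<lambda>n. anorm \<T> (vminus \<T> (s n) l)) \<longlonglongrightarrow> 0"
    proof (rule LIMSEQ_I)
      fix r :: real assume "r > 0"
      then have "r/2 > 0" by simp
      from uniform_limitD[OF g this] obtain N where N: "\<And>n z. n \<ge> N \<Longrightarrow> z \<in> sphere 0 1 \<Longrightarrow> dist (s n z) (g z) < r/2"
        unfolding eventually_sequentially by blast
      have "anorm \<T> (vminus \<T> (s n) l) \<le> r/2" if "n \<ge> N" for n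
        by (rule circle_norm_least) (use N[OF that] in \<open>auto simp: l_def dist_norm less_imp_le\<close>)
      then show "\<exists>no. \<forall>n\<ge>no. norm (anorm \<T> (vminus \<T> (s n) l) - 0) < r"
        using \<open>r > 0\<close> norm_nonneg[OF vminus_closed[OF sc l]] by (intro exI[of _ N]) fastforce
    qed
    then show ?thesis using l by blast
  qed
  ultimately show ?thesis
    using circle_anorm_eq_0 cstar_seminorm_circle by unfold_locales auto
qed

text \<open>The pointwise square root of \<open>Re (f z)\<close> is continuous and is a self-adjoint
  root of \<open>f\<close>.\<close>

lemma circle_positiveI:
  assumes "f \<in> vcarrier \<T>" "\<And>z. cmod z = 1 \<Longrightarrow> \<exists>r\<ge>0. f z = of_real r"
  shows "f \<in> positive_elements \<T>"
proof -
  define g where "g z = complex_of_real (sqrt (Re (f z)))" for z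
  have "g \<in> vcarrier \<T>"
    using assms(1) unfolding circle_carrier_iff g_def by (auto intro!: continuous_intros)
  moreover have "f z = cnj (g z) * g z" for z
  proof (cases "cmod z = 1")
    case True
    with assms(2) obtain r where "r \<ge> 0" "f z = of_real r" by blast
    then show ?thesis by (simp add: g_def flip: of_real_mult)
  next
    case False
    then show ?thesis using assms(1) by (simp add: circle_carrier_iff g_def)
  qed
  ultimately show ?thesis unfolding positive_elements_def by (intro image_eqI[of _ _ g]) auto
qed

section \<open>Laurent polynomials and their density in C(T)\<close>

definition laurent :: "(int \<Rightarrow> complex) \<Rightarrow> complex \<Rightarrow> complex" where
  "laurent c z = (\<Sum>j | c j \<noteq> 0. c j * z powi j)"

text \<open>\<open>laurent\<close> sums over the exact support and has value 0 by convention when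
  the support is infinite. A larger finite index set allows several Laurent polynomials to be summed
  over the same exponents.\<close>

lemma laurent_eq_sum: "finite J \<Longrightarrow> {j. c j \<noteq> 0} \<subseteq> J \<Longrightarrow> laurent c z = (\<Sum>j\<in>J. c j * z powi j)"
  unfolding laurent_def by (rule sum.mono_neutral_left) auto

lemma continuous_on_laurent: "continuous_on (sphere 0 1) (laurent c)"
proof -
  have "continuous_on (sphere 0 1) (\<lambda>z::complex. z powi j)" for j
    by (intro continuous_intros) auto
  then show ?thesis unfolding laurent_def
    by (intro continuous_on_sum continuous_on_mult continuous_on_const)
qed

text \<open>Equality is required only on the circle, where conjugation is
  \<open>z powi (-1)\<close>. With an arbitrary finite index set instead of the support, cancelling
  coefficients need no attention.\<close>

definition laurent_on_circle :: "(complex \<Rightarrow> complex) \<Rightarrow> bool" where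
  "laurent_on_circle f \<longleftrightarrow>
    (\<exists>(J :: int set) c. finite J \<and> (\<forall>z. cmod z = 1 \<longrightarrow> f z = (\<Sum>j\<in>J. c j * z powi j)))"

lemma laurent_on_circle_const: "laurent_on_circle (\<lambda>z. a)"
  unfolding laurent_on_circle_def by (intro exI[of _ "{0}"] exI[of _ "\<lambda>_. a"]) auto

lemma laurent_on_circle_add:
  assumes "laurent_on_circle f" "laurent_on_circle g" shows "laurent_on_circle (\<lambda>z. f z + g z)"
proof -
  obtain J c where f: "finite J" "\<And>z. cmod z = 1 \<Longrightarrow> f z = (\<Sum>j\<in>J. c j * z powi j)"
    using assms(1) unfolding laurent_on_circle_def by blast
  obtain K d where g: "finite K" "\<And>z. cmod z = 1 \<Longrightarrow> g z = (\<Sum>j\<in>K. d j * z powi j)"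
    using assms(2) unfolding laurent_on_circle_def by blast
  have "f z + g z = (\<Sum>j\<in>J \<union> K. ((if j \<in> J then c j else 0) + (if j \<in> K then d j else 0)) * z powi j)"
    if "cmod z = 1" for z
  proof -
    have "(\<Sum>j\<in>J. c j * z powi j) = (\<Sum>j\<in>J \<union> K. (if j \<in> J then c j else 0) * z powi j)"
      by (rule sum.mono_neutral_cong_left) (use f g in auto)
    moreover have "(\<Sum>j\<in>K. d j * z powi j) = (\<Sum>j\<in>J \<union> K. (if j \<in> K then d j else 0) * z powi j)"
      by (rule sum.mono_neutral_cong_left) (use f g in auto)
    ultimately show ?thesis
      using f(2)[OF that] g(2)[OF that] by (simp only: sum.distrib distrib_right)
  qed
  then show ?thesis unfolding laurent_on_circle_def using f(1) g(1)
    by (intro exI[of _ "J \<union> K"] exI[of _ "\<lambda>j. (if j \<in> J then c j else 0) + (if j \<in> K then d j else 0)"]) auto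
qed

lemma laurent_on_circle_mult:
  assumes "laurent_on_circle f" "laurent_on_circle g" shows "laurent_on_circle (\<lambda>z. f z * g z)"
proof -
  obtain J c where f: "finite J" "\<And>z. cmod z = 1 \<Longrightarrow> f z = (\<Sum>j\<in>J. c j * z powi j)"
    using assms(1) unfolding laurent_on_circle_def by blast
  obtain K d where g: "finite K" "\<And>z. cmod z = 1 \<Longrightarrow> g z = (\<Sum>j\<in>K. d j * z powi j)"
    using assms(2) unfolding laurent_on_circle_def by blast
  \<comment> \<open>The convolution of the coefficients, written as a sum over pairs so that
    grouping the double sum by the total exponent produces it.\<close>
  define e where "e k = (\<Sum>p | p \<in> J \<times> K \<and> fst p + snd p = k. c (fst p) * d (snd p))" for k
  have "f z * g z = (\<Sum>k\<in>(\<lambda>p. fst p + snd p) ` (J \<times> K). e k * z powi k)" if z: "cmod z = 1" for z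
  proof -
    have "z \<noteq> 0" using z by auto
    have "f z * g z = (\<Sum>p\<in>J \<times> K. c (fst p) * d (snd p) * z powi (fst p + snd p))"
      using \<open>z \<noteq> 0\<close>
      by (simp add: f(2)[OF z] g(2)[OF z] sum_product sum.cartesian_product power_int_add split_beta mult_ac)
    also have "\<dots> = (\<Sum>k\<in>(\<lambda>p. fst p + snd p) ` (J \<times> K).
        \<Sum>p | p \<in> J \<times> K \<and> fst p + snd p = k. c (fst p) * d (snd p) * z powi (fst p + snd p))"
      using f(1) g(1) by (intro sum.image_gen) auto
    also have "\<dots> = (\<Sum>k\<in>(\<lambda>p. fst p + snd p) ` (J \<times> K). e k * z powi k)"
      unfolding e_def sum_distrib_right by (intro sum.cong refl) auto
    finally show ?thesis .
  qed
  then show ?thesis unfolding laurent_on_circle_def using f(1) g(1)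
    by (intro exI[of _ "(\<lambda>p. fst p + snd p) ` (J \<times> K)"] exI[of _ e]) auto
qed

lemma laurent_on_circle_id: "laurent_on_circle (\<lambda>z. z)"
  unfolding laurent_on_circle_def by (intro exI[of _ "{1}"] exI[of _ "\<lambda>_. 1"]) auto

lemma laurent_on_circle_cnj: "laurent_on_circle cnj"
proof -
  have "cnj z = z powi (-1)" if "cmod z = 1" for z
    using that complex_div_cnj[of 1 z] by (simp add: power_int_minus field_simps)
  then show ?thesis
    unfolding laurent_on_circle_def by (intro exI[of _ "{-1}"] exI[of _ "\<lambda>_. 1"]) auto
qed

text \<open>Only linear functions need a computation: a real-linear functional on the plane is a
  complex combination of \<open>z\<close> and \<open>cnj z\<close>.\<close>

lemma laurent_on_circle_real_polynomial:
  assumes "real_polynomial_function (f :: complex \<Rightarrow> real)"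
  shows "laurent_on_circle (\<lambda>z. complex_of_real (f z))"
  using assms
proof induction
  case (linear f)
  then interpret bounded_linear f .
  have "complex_of_real (f z) =
      (of_real (f 1) - \<i> * of_real (f \<i>)) / 2 * z + (of_real (f 1) + \<i> * of_real (f \<i>)) / 2 * cnj z" for z
  proof -
    have "z = Re z *\<^sub>R 1 + Im z *\<^sub>R \<i>" by (simp add: complex_eq_iff)
    then have "f z = Re z * f 1 + Im z * f \<i>" by (metis add scale real_scaleR_def)
    then show ?thesis by (simp add: complex_eq_iff algebra_simps) (simp flip: add_divide_distrib)
  qed
  then have "(\<lambda>z. complex_of_real (f z)) = (\<lambda>z.
      (of_real (f 1) - \<i> * of_real (f \<i>)) / 2 * z + (of_real (f 1) + \<i> * of_real (f \<i>)) / 2 * cnj z)"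
    by blast
  then show ?case
    by (rule ssubst) (intro laurent_on_circle_add laurent_on_circle_mult laurent_on_circle_const
      laurent_on_circle_id laurent_on_circle_cnj)
qed (auto intro: laurent_on_circle_const laurent_on_circle_add laurent_on_circle_mult)

text \<open>Stone-Weierstrass approximates by polynomial functions of the plane, and on the circle
  their real and imaginary parts are Laurent polynomials.\<close>

lemma laurent_dense:
  assumes "continuous_on (sphere 0 1) f" "\<epsilon> > 0"
  shows "\<exists>c. finite {j. c j \<noteq> 0} \<and> (\<forall>z. cmod z = 1 \<longrightarrow> cmod (f z - laurent c z) < \<epsilon>)"
proof -
  obtain g where g: "polynomial_function g" "\<And>z. z \<in> sphere 0 1 \<Longrightarrow> norm (f z - g z) < \<epsilon>"
    using Stone_Weierstrass_polynomial_function[OF compact_sphere assms] by blast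
  have "real_polynomial_function (\<lambda>z. Re (g z))" "real_polynomial_function (\<lambda>z. Im (g z))"
    using g(1) bounded_linear_Re bounded_linear_Im unfolding polynomial_function_def o_def by blast+
  then have "laurent_on_circle (\<lambda>z. complex_of_real (Re (g z)) + \<i> * complex_of_real (Im (g z)))"
    by (intro laurent_on_circle_add laurent_on_circle_mult laurent_on_circle_const laurent_on_circle_real_polynomial)
  then have "laurent_on_circle g" by (simp flip: complex_eq)
  then obtain J :: "int set" and c where J: "finite J" "\<And>z. cmod z = 1 \<Longrightarrow> g z = (\<Sum>j\<in>J. c j * z powi j)"
    unfolding laurent_on_circle_def by blast
  define d where "d j = (if j \<in> J then c j else 0)" for j
  have fin: "{j. d j \<noteq> 0} \<subseteq> J" by (auto simp: d_def)
  have "laurent d z = g z" if "cmod z = 1" for z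
    unfolding J(2)[OF that] laurent_eq_sum[OF J(1) fin, of z] by (rule sum.cong) (simp_all add: d_def)
  then show ?thesis
    using g(2) finite_subset[OF fin J(1)] by (intro exI[of _ d]) auto
qed

section \<open>The operator norm of a finite matrix\<close>

definition fnorm :: "('y \<Rightarrow> complex) \<Rightarrow> real" where
  "fnorm w = L2_set (\<lambda>y. cmod (w y)) {y. w y \<noteq> 0}"

definition fmatrix :: "('y \<Rightarrow> 'y \<Rightarrow> complex) \<Rightarrow> bool" where
  "fmatrix m \<longleftrightarrow> finite {(x, y). m x y \<noteq> 0}"

text \<open>Summing over the support of the row of a finite matrix keeps the sum finite for every
  vector \<open>w\<close>. \<open>mprod\<close> has the same form, so it is \<open>mapply\<close> on
  the columns of the second matrix.\<close>

definition mapply :: "('y \<Rightarrow> 'y \<Rightarrow> complex) \<Rightarrow> ('y \<Rightarrow> complex) \<Rightarrow> 'y \<Rightarrow> complex" where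
  "mapply m w x = (\<Sum>y | m x y \<noteq> 0. m x y * w y)"

definition mprod :: "('y \<Rightarrow> 'y \<Rightarrow> complex) \<Rightarrow> ('y \<Rightarrow> 'y \<Rightarrow> complex) \<Rightarrow> 'y \<Rightarrow> 'y \<Rightarrow> complex" where
  "mprod m n x z = (\<Sum>y | m x y \<noteq> 0. m x y * n y z)"

definition madj :: "('y \<Rightarrow> 'y \<Rightarrow> complex) \<Rightarrow> 'y \<Rightarrow> 'y \<Rightarrow> complex" where
  "madj m x y = cnj (m y x)"

text \<open>The operator norm on square-summable families, taken over the dense subspace of finitely
  supported vectors, so that no Hilbert space has to be formed.\<close>

definition opnorm :: "('y \<Rightarrow> 'y \<Rightarrow> complex) \<Rightarrow> real" where
  "opnorm m = (SUP w \<in> {w. finite {y. w y \<noteq> 0} \<and> fnorm w \<le> 1}. fnorm (mapply m w))"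

lemma fnorm_eq_L2_set: "finite S \<Longrightarrow> {y. w y \<noteq> 0} \<subseteq> S \<Longrightarrow> fnorm w = L2_set (\<lambda>y. cmod (w y)) S"
  unfolding fnorm_def L2_set_def by (intro arg_cong[where f = sqrt] sum.mono_neutral_left) auto

lemma fnorm_nonneg [simp]: "0 \<le> fnorm w"
  by (simp add: fnorm_def)

lemma norm_le_fnorm: "finite {y. w y \<noteq> 0} \<Longrightarrow> cmod (w x) \<le> fnorm w"
  by (cases "w x = 0") (auto simp: fnorm_def intro: member_le_L2_set)

lemma fmatrix_support:
  assumes "fmatrix m" obtains S where "finite S" "\<And>x y. m x y \<noteq> 0 \<Longrightarrow> x \<in> S \<and> y \<in> S"
proof
  let ?P = "{(x, y). m x y \<noteq> 0}"
  show "finite (fst ` ?P \<union> snd ` ?P)" using assms by (simp add: fmatrix_def)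
  show "x \<in> fst ` ?P \<union> snd ` ?P \<and> y \<in> fst ` ?P \<union> snd ` ?P" if "m x y \<noteq> 0" for x y
    using that by (auto simp: image_iff)
qed

lemma fmatrixI: "finite S \<Longrightarrow> (\<And>x y. m x y \<noteq> 0 \<Longrightarrow> x \<in> S \<and> y \<in> S) \<Longrightarrow> fmatrix m"
  unfolding fmatrix_def by (rule finite_subset[of _ "S \<times> S"]) auto

text \<open>Replaces the row support by any finite set that contains the relevant indices. With one
  set for all rows, sums can be exchanged.\<close>

lemma mapply_eq_sum:
  "finite S \<Longrightarrow> (\<And>y. m x y \<noteq> 0 \<Longrightarrow> w y \<noteq> 0 \<Longrightarrow> y \<in> S) \<Longrightarrow> fmatrix m \<Longrightarrow> mapply m w x = (\<Sum>y\<in>S. m x y * w y)"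
proof -
  assume S: "finite S" "\<And>y. m x y \<noteq> 0 \<Longrightarrow> w y \<noteq> 0 \<Longrightarrow> y \<in> S" and "fmatrix m"
  then obtain T where T: "finite T" "\<And>x y. m x y \<noteq> 0 \<Longrightarrow> x \<in> T \<and> y \<in> T" using fmatrix_support by blast
  then have fin: "finite {y. m x y \<noteq> 0}" by (auto intro: finite_subset[of _ T])
  have "mapply m w x = (\<Sum>y | m x y * w y \<noteq> 0. m x y * w y)"
    unfolding mapply_def by (rule sum.mono_neutral_right[OF fin]) auto
  also have "\<dots> = (\<Sum>y\<in>S. m x y * w y)"
    by (rule sum.mono_neutral_left) (use S in auto)
  finally show ?thesis .
qed

lemma mprod_eq_sum:
  "finite S \<Longrightarrow> (\<And>y. m x y \<noteq> 0 \<Longrightarrow> n y z \<noteq> 0 \<Longrightarrow> y \<in> S) \<Longrightarrow> fmatrix m \<Longrightarrow> mprod m n x z = (\<Sum>y\<in>S. m x y * n y z)"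
  using mapply_eq_sum[of S m x "\<lambda>y. n y z"] by (simp add: mapply_def mprod_def)

lemma mapply_support:
  assumes "\<And>x y. m x y \<noteq> 0 \<Longrightarrow> x \<in> S" shows "{x. mapply m w x \<noteq> 0} \<subseteq> S"
proof
  fix x assume "x \<in> {x. mapply m w x \<noteq> 0}"
  then obtain y where "m x y \<noteq> 0" unfolding mapply_def by (metis (mono_tags, lifting) mem_Collect_eq sum.neutral mult_zero_left)
  then show "x \<in> S" using assms by blast
qed

lemma finite_mapply_support [intro]: "fmatrix m \<Longrightarrow> finite {x. mapply m w x \<noteq> 0}"
  by (metis fmatrix_support mapply_support finite_subset)

lemma mprod_support: "mprod m n x z \<noteq> 0 \<Longrightarrow> \<exists>y. m x y \<noteq> 0 \<and> n y z \<noteq> 0"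
  unfolding mprod_def by (metis (mono_tags, lifting) mem_Collect_eq sum.neutral mult_zero_right)

lemma fmatrix_mprod: "fmatrix m \<Longrightarrow> fmatrix n \<Longrightarrow> fmatrix (mprod m n)"
proof -
  assume "fmatrix m" "fmatrix n"
  then obtain S T where "finite S" "\<And>x y. m x y \<noteq> 0 \<Longrightarrow> x \<in> S \<and> y \<in> S" "finite T" "\<And>x y. n x y \<noteq> 0 \<Longrightarrow> x \<in> T \<and> y \<in> T"
    by (metis fmatrix_support)
  then show ?thesis by (intro fmatrixI[of "S \<union> T"]) (auto dest!: mprod_support)
qed

lemma fmatrix_madj: "fmatrix m \<Longrightarrow> fmatrix (madj m)"
  by (metis fmatrixI fmatrix_support madj_def complex_cnj_zero_iff)

lemma mapply_mprod:
  assumes "fmatrix m" "fmatrix n" shows "mapply (mprod m n) w = mapply m (mapply n w)"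
proof
  fix x
  obtain S T where S: "finite S" "\<And>x y. m x y \<noteq> 0 \<Longrightarrow> x \<in> S \<and> y \<in> S" "finite T" "\<And>x y. n x y \<noteq> 0 \<Longrightarrow> x \<in> T \<and> y \<in> T"
    by (metis fmatrix_support assms)
  have "mapply (mprod m n) w x = (\<Sum>z\<in>T. mprod m n x z * w z)"
    by (rule mapply_eq_sum) (use S in \<open>auto intro: fmatrix_mprod assms dest: mprod_support\<close>)
  also have "\<dots> = (\<Sum>z\<in>T. (\<Sum>y\<in>S. m x y * n y z) * w z)"
    by (rule sum.cong[OF refl], subst mprod_eq_sum[of S]) (use S assms in auto)
  also have "\<dots> = (\<Sum>y\<in>S. m x y * (\<Sum>z\<in>T. n y z * w z))"
    unfolding sum_distrib_left sum_distrib_right by (subst sum.swap) (simp add: mult_ac)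
  also have "\<dots> = (\<Sum>y\<in>S. m x y * mapply n w y)"
    by (rule sum.cong[OF refl], subst mapply_eq_sum[of T]) (use S assms in auto)
  also have "\<dots> = mapply m (mapply n w) x"
    by (subst mapply_eq_sum[of S]) (use S assms in auto)
  finally show "mapply (mprod m n) w x = mapply m (mapply n w) x" .
qed

lemma fnorm_scale: "finite {y. w y \<noteq> 0} \<Longrightarrow> fnorm (\<lambda>y. t * w y) = cmod t * fnorm w"
  using fnorm_eq_L2_set[of "{y. w y \<noteq> 0}" "\<lambda>y. t * w y"]
  by (auto simp: norm_mult L2_set_right_distrib fnorm_def)

lemma fnorm_add:
  assumes "finite {y. v y \<noteq> 0}" "finite {y. w y \<noteq> 0}"
  shows "fnorm (\<lambda>y. v y + w y) \<le> fnorm v + fnorm w"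
proof -
  let ?S = "{y. v y \<noteq> 0} \<union> {y. w y \<noteq> 0}"
  have fin: "finite ?S" using assms by simp
  have "fnorm (\<lambda>y. v y + w y) = L2_set (\<lambda>y. cmod (v y + w y)) ?S"
    by (rule fnorm_eq_L2_set[OF fin]) auto
  also have "\<dots> \<le> L2_set (\<lambda>y. cmod (v y) + cmod (w y)) ?S"
    by (rule L2_set_mono) (auto intro: norm_triangle_ineq)
  also have "\<dots> \<le> L2_set (\<lambda>y. cmod (v y)) ?S + L2_set (\<lambda>y. cmod (w y)) ?S"
    by (rule L2_set_triangle_ineq)
  also have "L2_set (\<lambda>y. cmod (v y)) ?S = fnorm v"
    by (rule fnorm_eq_L2_set[OF fin, symmetric]) blast
  also have "L2_set (\<lambda>y. cmod (w y)) ?S = fnorm w"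
    by (rule fnorm_eq_L2_set[OF fin, symmetric]) blast
  finally show ?thesis .
qed

lemma fnorm_cauchy_schwarz:
  assumes "finite S" "{y. v y \<noteq> 0} \<subseteq> S" "{y. w y \<noteq> 0} \<subseteq> S"
  shows "cmod (\<Sum>y\<in>S. cnj (v y) * w y) \<le> fnorm v * fnorm w"
proof -
  have "cmod (\<Sum>y\<in>S. cnj (v y) * w y) \<le> (\<Sum>y\<in>S. \<bar>cmod (v y)\<bar> * \<bar>cmod (w y)\<bar>)"
    by (rule sum_norm_le) (simp add: norm_mult)
  also have "\<dots> \<le> fnorm v * fnorm w"
    unfolding fnorm_eq_L2_set[OF assms(1,2)] fnorm_eq_L2_set[OF assms(1,3)] by (rule L2_set_mult_ineq)
  finally show ?thesis .
qed

lemma fnorm_power2: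
  assumes "finite S" "{y. w y \<noteq> 0} \<subseteq> S"
  shows "(fnorm w)\<^sup>2 = cmod (\<Sum>y\<in>S. cnj (w y) * w y)"
proof -
  have "(\<Sum>y\<in>S. cnj (w y) * w y) = complex_of_real (\<Sum>y\<in>S. (cmod (w y))\<^sup>2)"
    by (simp add: complex_norm_square mult.commute flip: of_real_power)
  then show ?thesis
    unfolding fnorm_eq_L2_set[OF assms] L2_set_def by (simp add: sum_nonneg flip: of_real_sum)
qed

text \<open>The sum of all entries in absolute value is a crude bound; it serves only to make the
  supremum in \<open>opnorm\<close> finite.\<close>

lemma mapply_bounded:
  assumes "fmatrix m" shows "\<exists>K. \<forall>w. finite {y. w y \<noteq> 0} \<longrightarrow> fnorm (mapply m w) \<le> K * fnorm w"
proof -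
  obtain S where S: "finite S" "\<And>x y. m x y \<noteq> 0 \<Longrightarrow> x \<in> S \<and> y \<in> S" using fmatrix_support[OF assms] by blast
  have "fnorm (mapply m w) \<le> (\<Sum>x\<in>S. \<Sum>y\<in>S. cmod (m x y)) * fnorm w" if w: "finite {y. w y \<noteq> 0}" for w
  proof -
    have "fnorm (mapply m w) = L2_set (\<lambda>x. cmod (mapply m w x)) S"
      using S by (intro fnorm_eq_L2_set mapply_support) auto
    also have "\<dots> \<le> (\<Sum>x\<in>S. cmod (mapply m w x))" by (rule L2_set_le_sum) simp
    also have "\<dots> \<le> (\<Sum>x\<in>S. \<Sum>y\<in>S. cmod (m x y) * fnorm w)"
    proof (rule sum_mono)
      fix x
      have "mapply m w x = (\<Sum>y\<in>S. m x y * w y)" by (rule mapply_eq_sum) (use S assms in auto)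
      then show "cmod (mapply m w x) \<le> (\<Sum>y\<in>S. cmod (m x y) * fnorm w)"
        by (auto simp: norm_mult intro!: sum_norm_le mult_left_mono norm_le_fnorm[OF w])
    qed
    finally show ?thesis by (simp add: sum_distrib_right)
  qed
  then show ?thesis by blast
qed

lemma
  assumes m: "fmatrix m"
  shows fnorm_mapply_le: "finite {y. w y \<noteq> 0} \<Longrightarrow> fnorm (mapply m w) \<le> opnorm m * fnorm w"
    and opnorm_nonneg: "0 \<le> opnorm m"
proof -
  obtain K where K: "\<And>w. finite {y. w y \<noteq> 0} \<Longrightarrow> fnorm (mapply m w) \<le> K * fnorm w"
    using mapply_bounded[OF m] by blast
  have le: "fnorm (mapply m w) \<le> opnorm m" if "finite {y. w y \<noteq> 0}" "fnorm w \<le> 1" for w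
    unfolding opnorm_def
  proof (rule cSUP_upper)
    show "bdd_above ((\<lambda>w. fnorm (mapply m w)) ` {w. finite {y. w y \<noteq> 0} \<and> fnorm w \<le> 1})"
    proof (rule bdd_aboveI2)
      fix w :: "'a \<Rightarrow> complex" assume w: "w \<in> {w. finite {y. w y \<noteq> 0} \<and> fnorm w \<le> 1}"
      then have "fnorm (mapply m w) \<le> K * fnorm w" using K by blast
      also have "\<dots> \<le> \<bar>K\<bar> * 1" using w by (intro mult_mono) auto
      finally show "fnorm (mapply m w) \<le> \<bar>K\<bar>" by simp
    qed
  qed (use that in auto)
  have "fnorm (\<lambda>_::'a. 0) = 0" by (simp add: fnorm_def)
  then show nn: "0 \<le> opnorm m" using le[of "\<lambda>_. 0"] order_trans[OF fnorm_nonneg] by (simp add: mapply_def)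
  show "fnorm (mapply m w) \<le> opnorm m * fnorm w" if w: "finite {y. w y \<noteq> 0}"
  proof (cases "fnorm w = 0")
    case True
    then have "w y = 0" for y using norm_le_fnorm[OF w, of y] by simp
    then have "mapply m w = (\<lambda>_. 0)" by (simp add: mapply_def fun_eq_iff)
    then show ?thesis using True \<open>fnorm (\<lambda>_. 0) = 0\<close> by simp
  next
    case False
    define t where "t = complex_of_real (1 / fnorm w)"
    have t: "cmod t = 1 / fnorm w" by (simp add: t_def norm_divide)
    have "fnorm (mapply m (\<lambda>y. t * w y)) \<le> opnorm m"
      by (rule le) (use w False in \<open>auto simp: fnorm_scale t intro: finite_subset[rotated]\<close>)
    also have "mapply m (\<lambda>y. t * w y) = (\<lambda>x. t * mapply m w x)"
      by (auto simp: mapply_def sum_distrib_left mult_ac)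
    also have "fnorm \<dots> = fnorm (mapply m w) / fnorm w"
      using finite_mapply_support[OF m] by (simp add: fnorm_scale t)
    finally show ?thesis using False fnorm_nonneg[of w] by (simp add: divide_simps split: if_splits)
  qed
qed

lemma opnorm_least:
  assumes "\<And>w. finite {y. w y \<noteq> 0} \<Longrightarrow> fnorm (mapply m w) \<le> M * fnorm w" "0 \<le> M"
  shows "opnorm m \<le> M"
  unfolding opnorm_def
proof (rule cSUP_least)
  have "(\<lambda>_::'a. 0) \<in> {w. finite {y. w y \<noteq> 0} \<and> fnorm w \<le> 1}" by (simp add: fnorm_def)
  then show "{w :: 'a \<Rightarrow> complex. finite {y. w y \<noteq> 0} \<and> fnorm w \<le> 1} \<noteq> {}" by (metis empty_iff)
  fix w :: "'a \<Rightarrow> complex" assume w: "w \<in> {w. finite {y. w y \<noteq> 0} \<and> fnorm w \<le> 1}"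
  then have "fnorm (mapply m w) \<le> M * fnorm w" using assms(1) by blast
  also have "\<dots> \<le> M * 1" using w assms(2) by (intro mult_left_mono) auto
  finally show "fnorm (mapply m w) \<le> M" by simp
qed

lemma opnorm_mprod: "fmatrix m \<Longrightarrow> fmatrix n \<Longrightarrow> opnorm (mprod m n) \<le> opnorm m * opnorm n"
proof (rule opnorm_least)
  assume m: "fmatrix m" and n: "fmatrix n"
  then show "0 \<le> opnorm m * opnorm n" by (simp add: opnorm_nonneg)
  fix w :: "'a \<Rightarrow> complex" assume w: "finite {y. w y \<noteq> 0}"
  have "fnorm (mapply (mprod m n) w) \<le> opnorm m * fnorm (mapply n w)"
    unfolding mapply_mprod[OF m n] by (rule fnorm_mapply_le[OF m finite_mapply_support[OF n]])
  also have "\<dots> \<le> opnorm m * (opnorm n * fnorm w)"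
    by (intro mult_left_mono fnorm_mapply_le n w opnorm_nonneg m)
  finally show "fnorm (mapply (mprod m n) w) \<le> opnorm m * opnorm n * fnorm w" by simp
qed

lemma opnorm_add:
  assumes m: "fmatrix m" and n: "fmatrix n"
  shows "opnorm (\<lambda>x y. m x y + n x y) \<le> opnorm m + opnorm n"
proof (rule opnorm_least)
  show "0 \<le> opnorm m + opnorm n" using m n by (simp add: opnorm_nonneg)
  fix w :: "'a \<Rightarrow> complex" assume w: "finite {y. w y \<noteq> 0}"
  obtain S T where S: "finite S" "\<And>x y. m x y \<noteq> 0 \<Longrightarrow> x \<in> S \<and> y \<in> S" "finite T" "\<And>x y. n x y \<noteq> 0 \<Longrightarrow> x \<in> T \<and> y \<in> T"
    by (metis fmatrix_support m n)
  have mn: "fmatrix (\<lambda>x y. m x y + n x y)" by (rule fmatrixI[of "S \<union> T"]) (use S in auto, (metis add_0)+)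
  have "mapply (\<lambda>x y. m x y + n x y) w x = mapply m w x + mapply n w x" for x
    using mapply_eq_sum[OF w _ mn, of x w] mapply_eq_sum[OF w _ m, of x w] mapply_eq_sum[OF w _ n, of x w]
    by (simp add: sum.distrib distrib_right)
  then have "fnorm (mapply (\<lambda>x y. m x y + n x y) w) \<le> fnorm (mapply m w) + fnorm (mapply n w)"
    using fnorm_add[OF finite_mapply_support[OF m, of w] finite_mapply_support[OF n, of w]] by presburger
  then show "fnorm (mapply (\<lambda>x y. m x y + n x y) w) \<le> (opnorm m + opnorm n) * fnorm w"
    using fnorm_mapply_le[OF m w] fnorm_mapply_le[OF n w] by (simp add: distrib_right)
qed

lemma opnorm_scale_le:
  assumes m: "fmatrix m" shows "opnorm (\<lambda>x y. t * m x y) \<le> cmod t * opnorm m"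
proof (rule opnorm_least)
  show "0 \<le> cmod t * opnorm m" using m by (simp add: opnorm_nonneg)
  fix w :: "'a \<Rightarrow> complex" assume w: "finite {y. w y \<noteq> 0}"
  obtain S where S: "finite S" "\<And>x y. m x y \<noteq> 0 \<Longrightarrow> x \<in> S \<and> y \<in> S"
    by (metis fmatrix_support m)
  have tm: "fmatrix (\<lambda>x y. t * m x y)" by (rule fmatrixI[of S]) (use S in auto)
  have "mapply (\<lambda>x y. t * m x y) w = (\<lambda>x. t * mapply m w x)"
    using mapply_eq_sum[OF w _ tm, of _ w] mapply_eq_sum[OF w _ m, of _ w]
    by (simp add: fun_eq_iff sum_distrib_left mult_ac)
  then have "fnorm (mapply (\<lambda>x y. t * m x y) w) = cmod t * fnorm (mapply m w)"
    using fnorm_scale[OF finite_mapply_support[OF m]] by simp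
  then show "fnorm (mapply (\<lambda>x y. t * m x y) w) \<le> cmod t * opnorm m * fnorm w"
    using mult_left_mono[OF fnorm_mapply_le[OF m w], of "cmod t"] by (simp add: mult.assoc)
qed

lemma opnorm_scale:
  assumes m: "fmatrix m" shows "opnorm (\<lambda>x y. t * m x y) = cmod t * opnorm m"
proof (cases "t = 0")
  case True
  have "fmatrix (\<lambda>x y. t * m x y)" using True by (simp add: fmatrix_def)
  then show ?thesis using opnorm_scale_le[OF m, of t] opnorm_nonneg[of "\<lambda>x y. t * m x y"] True by simp
next
  case False
  obtain S where S: "finite S" "\<And>x y. m x y \<noteq> 0 \<Longrightarrow> x \<in> S \<and> y \<in> S"
    by (metis fmatrix_support m)
  have tm: "fmatrix (\<lambda>x y. t * m x y)" by (rule fmatrixI[of S]) (use S in auto)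
  have "opnorm m \<le> cmod (1 / t) * opnorm (\<lambda>x y. t * m x y)"
    using opnorm_scale_le[OF tm, of "1 / t"] False by simp
  then have "cmod t * opnorm m \<le> opnorm (\<lambda>x y. t * m x y)"
    using False by (simp add: norm_divide field_simps)
  then show ?thesis using opnorm_scale_le[OF m, of t] by simp
qed

text \<open>The squared norm of \<open>m w\<close> is the inner product of \<open>w\<close> with
  \<open>m* m w\<close>; Cauchy-Schwarz bounds it.\<close>

lemma fnorm_mapply_power2_le:
  assumes m: "fmatrix m" and w: "finite {y. w y \<noteq> 0}"
  shows "(fnorm (mapply m w))\<^sup>2 \<le> opnorm (mprod (madj m) m) * (fnorm w)\<^sup>2"
proof -
  obtain S0 where S0: "finite S0" "\<And>x y. m x y \<noteq> 0 \<Longrightarrow> x \<in> S0 \<and> y \<in> S0"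
    by (metis fmatrix_support m)
  define S where "S = S0 \<union> {y. w y \<noteq> 0}"
  have S: "finite S" "\<And>x y. m x y \<noteq> 0 \<Longrightarrow> x \<in> S \<and> y \<in> S" "{y. w y \<noteq> 0} \<subseteq> S"
    using S0 w by (auto simp: S_def)
  note a = fmatrix_madj[OF m]
  have aS: "madj m x y \<noteq> 0 \<Longrightarrow> x \<in> S \<and> y \<in> S" for x y using S(2) by (auto simp: madj_def)
  let ?v = "mapply m w"
  have v: "{x. ?v x \<noteq> 0} \<subseteq> S" by (rule mapply_support) (use S in auto)
  have "(\<Sum>x\<in>S. cnj (?v x) * ?v x) = (\<Sum>x\<in>S. \<Sum>y\<in>S. cnj (w y) * (cnj (m x y) * ?v x))"
  proof (rule sum.cong[OF refl])
    fix x
    have "?v x = (\<Sum>y\<in>S. m x y * w y)" by (rule mapply_eq_sum) (use S m in auto)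
    then have "cnj (?v x) = (\<Sum>y\<in>S. cnj (w y) * cnj (m x y))" by (simp add: mult_ac)
    then show "cnj (?v x) * ?v x = (\<Sum>y\<in>S. cnj (w y) * (cnj (m x y) * ?v x))"
      by (simp only: sum_distrib_right mult.assoc)
  qed
  also have "\<dots> = (\<Sum>y\<in>S. cnj (w y) * (\<Sum>x\<in>S. madj m y x * ?v x))"
    by (subst sum.swap) (simp add: sum_distrib_left madj_def)
  also have "\<dots> = (\<Sum>y\<in>S. cnj (w y) * mapply (mprod (madj m) m) w y)"
    unfolding mapply_mprod[OF a m]
    by (rule sum.cong[OF refl], subst (2) mapply_eq_sum[of S]) (use S a aS in auto)
  finally have "(fnorm ?v)\<^sup>2 = cmod (\<Sum>y\<in>S. cnj (w y) * mapply (mprod (madj m) m) w y)"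
    using fnorm_power2[OF S(1) v] by simp
  also have "\<dots> \<le> fnorm w * fnorm (mapply (mprod (madj m) m) w)"
  proof (rule fnorm_cauchy_schwarz[OF S(1) S(3)])
    show "{y. mapply (mprod (madj m) m) w y \<noteq> 0} \<subseteq> S"
      by (rule mapply_support) (use aS in \<open>auto dest!: mprod_support\<close>)
  qed
  also have "\<dots> \<le> fnorm w * (opnorm (mprod (madj m) m) * fnorm w)"
    by (intro mult_left_mono fnorm_mapply_le fmatrix_mprod a m w) simp
  finally show ?thesis by (simp add: power2_eq_square mult_ac)
qed

text \<open>The preceding estimate gives one inequality. With submultiplicativity it also yields
  that a matrix is bounded in norm by its adjoint, hence equality of the two norms, and this gives
  the other inequality.\<close>

lemma opnorm_star:
  assumes m: "fmatrix m" shows "opnorm (mprod (madj m) m) = (opnorm m)\<^sup>2"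
proof -
  have le: "(opnorm m)\<^sup>2 \<le> opnorm (mprod (madj m) m)" if m: "fmatrix m" for m :: "'a \<Rightarrow> 'a \<Rightarrow> complex"
  proof -
    have nn: "0 \<le> opnorm (mprod (madj m) m)" by (intro opnorm_nonneg fmatrix_mprod fmatrix_madj m)
    have "opnorm m \<le> sqrt (opnorm (mprod (madj m) m))"
    proof (rule opnorm_least)
      fix w :: "'a \<Rightarrow> complex" assume "finite {y. w y \<noteq> 0}"
      from fnorm_mapply_power2_le[OF m this]
      have "fnorm (mapply m w) \<le> sqrt (opnorm (mprod (madj m) m) * (fnorm w)\<^sup>2)" by (rule real_le_rsqrt)
      then show "fnorm (mapply m w) \<le> sqrt (opnorm (mprod (madj m) m)) * fnorm w" by (simp add: real_sqrt_mult)
    qed (use nn in simp)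
    then show ?thesis using nn opnorm_nonneg[OF m] by (metis power_mono real_sqrt_pow2)
  qed
  have le_adj: "opnorm m \<le> opnorm (madj m)" if m: "fmatrix m" for m :: "'a \<Rightarrow> 'a \<Rightarrow> complex"
  proof -
    have "opnorm m * opnorm m \<le> opnorm (madj m) * opnorm m"
      using le[OF m] opnorm_mprod[OF fmatrix_madj[OF m] m] by (simp add: power2_eq_square)
    then show ?thesis using opnorm_nonneg[OF m] opnorm_nonneg[OF fmatrix_madj[OF m]]
      by (cases "opnorm m = 0") auto
  qed
  have "madj (madj m) = m" by (simp add: madj_def fun_eq_iff)
  then have "opnorm (madj m) = opnorm m"
    using le_adj[OF m] le_adj[OF fmatrix_madj[OF m]] by simp
  then show ?thesis
    using le[OF m] opnorm_mprod[OF fmatrix_madj[OF m] m] by (simp add: power2_eq_square)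
qed

text \<open>Apply the matrix to the basis vector at \<open>y\<close> and read off coordinate
  \<open>x\<close>.\<close>

lemma norm_entry_le_opnorm:
  assumes m: "fmatrix m" shows "cmod (m x y) \<le> opnorm m"
proof -
  let ?w = "\<lambda>y'. if y' = y then 1 else 0 :: complex"
  have supp: "{y'. ?w y' \<noteq> 0} = {y}" by auto
  have "mapply m ?w x = m x y"
    by (subst mapply_eq_sum[of "{y}"]) (use m in \<open>auto split: if_splits\<close>)
  moreover have "fnorm ?w = 1" unfolding fnorm_def supp by (simp add: L2_set_def)
  moreover have "cmod (mapply m ?w x) \<le> opnorm m * fnorm ?w"
    using norm_le_fnorm[OF finite_mapply_support[OF m]] fnorm_mapply_le[OF m, of ?w] supp
    by (metis order_trans finite.emptyI finite_insert)
  ultimately show ?thesis by simp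
qed

section \<open>Fourier coefficients of Laurent polynomials\<close>

text \<open>A geometric sum whose ratio is an \<open>n\<close>-th root of unity. The bound on
  \<open>d\<close> excludes nonzero multiples of \<open>n\<close>, so the ratio is 1 only for
  \<open>d = 0\<close>.\<close>

lemma sum_root_of_unity_powers:
  fixes d :: int
  assumes "\<bar>d\<bar> < int n"
  shows "(\<Sum>k<n. (cis (2 * pi / n) ^ k) powi d) = (if d = 0 then of_nat n else 0)"
proof (cases "d = 0")
  case False
  have "n > 0" using assms by (cases n) auto
  let ?w = "cis (2 * pi / n) powi d"
  have w: "?w = cis (2 * pi * d / n)"
    by (simp add: cis_power_int mult_ac)
  have "?w \<noteq> 1"
  proof
    assume "?w = 1"
    then have "cis (2 * pi * d / n) = 1" by (simp only: w)
    then have "exp (\<i> * of_real (2 * pi * d / n)) = 1" by (simp only: cis_conv_exp)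
    then obtain m :: int where "2 * pi * d / n = of_int (2 * m) * pi" by (auto simp: exp_eq_1)
    then have "real_of_int d = of_int (m * int n)" using \<open>n > 0\<close> by (simp add: field_simps)
    then have "d = m * int n" by (simp only: of_int_eq_iff)
    then show False using assms False by (auto simp: abs_mult)
  qed
  moreover have "?w ^ n = 1"
  proof -
    have "?w ^ n = (cis (2 * pi / n) ^ n) powi d" by (simp add: power_int_power power_int_power' mult.commute)
    also have "cis (2 * pi / n) ^ n = 1" using \<open>n > 0\<close> by (simp add: Complex.DeMoivre)
    finally show ?thesis by simp
  qed
  ultimately have "(\<Sum>k<n. ?w ^ k) = 0" by (simp add: geometric_sum)
  moreover have "(cis (2 * pi / n) ^ k) powi d = ?w ^ k" for k
    by (simp add: power_int_power power_int_power' mult.commute)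
  ultimately show ?thesis using False by simp
qed simp

text \<open>A Fourier coefficient is an average of \<open>laurent c z * z powi (-j)\<close>. The
  average over the \<open>n\<close>-th roots of unity takes the place of the integral;
  \<open>n\<close> exceeds every \<open>\<bar>i - j\<bar>\<close> with \<open>i\<close> in the
  support, so that no other coefficient survives.\<close>

lemma laurent_coeff_bound:
  assumes fin: "finite {j. c j \<noteq> 0}" and M: "\<And>z. cmod z = 1 \<Longrightarrow> cmod (laurent c z) \<le> M"
  shows "cmod (c j) \<le> M"
proof -
  let ?J = "insert j {i. c i \<noteq> 0}"
  define n where "n = Suc (Max ((\<lambda>i. nat \<bar>i - j\<bar>) ` ?J))"
  have n: "\<bar>i - j\<bar> < int n" if "i \<in> ?J" for i
  proof -
    have "nat \<bar>i - j\<bar> \<le> Max ((\<lambda>i. nat \<bar>i - j\<bar>) ` ?J)" using fin that by (intro Max_ge) auto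
    then show ?thesis by (simp add: n_def)
  qed
  define w where "w k = cis (2 * pi / n) ^ k" for k
  have w: "cmod (w k) = 1" "w k \<noteq> 0" for k by (simp_all add: w_def norm_power)
  have "(\<Sum>k<n. laurent c (w k) * w k powi (-j)) = (\<Sum>k<n. \<Sum>i\<in>?J. c i * w k powi (i - j))"
  proof (rule sum.cong[OF refl])
    fix k
    have "laurent c (w k) = (\<Sum>i\<in>?J. c i * w k powi i)" using fin by (intro laurent_eq_sum) auto
    then show "laurent c (w k) * w k powi (-j) = (\<Sum>i\<in>?J. c i * w k powi (i - j))"
      using w(2) by (simp only: sum_distrib_right diff_conv_add_uminus power_int_add mult.assoc simp_thms disj_not1)
  qed
  also have "\<dots> = (\<Sum>i\<in>?J. c i * (\<Sum>k<n. w k powi (i - j)))"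
    by (subst sum.swap) (simp add: sum_distrib_left)
  also have "\<dots> = (\<Sum>i\<in>?J. if i = j then c j * of_nat n else 0)"
    by (rule sum.cong[OF refl]) (use n in \<open>auto simp: w_def sum_root_of_unity_powers\<close>)
  also have "\<dots> = c j * of_nat n" using fin by (subst sum.delta) auto
  finally have "cmod (c j * of_nat n) = cmod (\<Sum>k<n. laurent c (w k) * w k powi (-j))" by simp
  also have "\<dots> \<le> (\<Sum>k<n. M)"
    by (rule sum_norm_le) (use M w in \<open>simp add: norm_mult norm_power_int\<close>)
  finally have "real n * cmod (c j) \<le> real n * M" by (simp add: norm_mult mult.commute)
  moreover have "n > 0" by (simp add: n_def)
  ultimately show ?thesis by simp
qed

text \<open>If \<open>M < r\<close>, then with \<open>N = 2 ^ n\<close> the product of the linear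
  factor \<open>2 * N * D + 1\<close> and \<open>(M / r) ^ N\<close> tends to 0, whereas the
  assumption keeps it at least 1.\<close>

lemma root_growth_le:
  fixes r M D :: real
  assumes "0 \<le> r" "0 \<le> M" and le: "\<And>n. r ^ (2 ^ n) \<le> (2 * (2 ^ n * D) + 1) * M ^ (2 ^ n)"
  shows "r \<le> M"
proof (rule ccontr)
  assume "\<not> r \<le> M"
  then have "r > 0" "M < r" using assms by auto
  define x where "x = M / r"
  have x: "0 \<le> x" "x < 1" using \<open>r > 0\<close> \<open>M < r\<close> assms by (auto simp: x_def)
  have "(\<lambda>N. 2 * D * (of_nat N * x ^ N) + x ^ N) \<longlonglongrightarrow> 2 * D * 0 + 0"
    using x by (intro tendsto_intros powser_times_n_limit_0 LIMSEQ_power_zero) auto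
  then have "eventually (\<lambda>N. 2 * D * (of_nat N * x ^ N) + x ^ N < 1) sequentially"
    by (rule order_tendstoD) simp
  then obtain N0 where N0: "\<And>N. N \<ge> N0 \<Longrightarrow> 2 * D * (of_nat N * x ^ N) + x ^ N < 1"
    by (auto simp: eventually_sequentially)
  \<comment> \<open>The assumption concerns only exponents that are powers of two;
    \<open>2 ^ N0\<close> is one beyond the threshold.\<close>
  have "N0 \<le> 2 ^ N0" using less_exp[of N0] by simp
  from N0[OF this] have "(2 * (2 ^ N0 * D) + 1) * x ^ (2 ^ N0) < 1" by (simp add: algebra_simps)
  then have "(2 * (2 ^ N0 * D) + 1) * M ^ (2 ^ N0) < r ^ (2 ^ N0)"
    using \<open>r > 0\<close> by (simp add: x_def power_divide field_simps)
  then show False using le[of N0] by simp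
qed

section \<open>The convolution algebra of a transitive groupoid\<close>

locale triple_groupoid =
  fixes Y :: "'y set" and lev :: "'y \<Rightarrow> int" and G :: "('y \<times> (int \<times> int) \<times> 'y) top_groupoid"
  assumes arrows_eq: "arrows G = {(x, (lev y - lev x, j), y) |x j y. x \<in> Y \<and> y \<in> Y}"
    and gmult_eq: "gmult G = (\<lambda>(x, k, y) (y', l, z). (x, k + l, z))"
    and ginv_eq: "ginv G = (\<lambda>(x, k, y). (y, - k, x))"
    and gtop_eq: "gtop G = discrete_topology (arrows G)"
begin

text \<open>The first integer is a coboundary of \<open>lev\<close> and adds up automatically along
  composable arrows. Without it, composition is addition of the remaining integers
  \<open>j\<close>.\<close>

definition arr :: "'y \<Rightarrow> int \<Rightarrow> 'y \<Rightarrow> 'y \<times> (int \<times> int) \<times> 'y" where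
  "arr x j y = (x, (lev y - lev x, j), y)"

abbreviation "\<A> \<equiv> convolution_algebra G"

lemma arr_eq_iff [simp]: "arr x j y = arr x' j' y' \<longleftrightarrow> x = x' \<and> j = j' \<and> y = y'"
  by (auto simp: arr_def)

lemma arr_in_arrows [simp]: "arr x j y \<in> arrows G \<longleftrightarrow> x \<in> Y \<and> y \<in> Y"
  by (auto simp: arr_def arrows_eq)

lemma arrows_cases: "g \<in> arrows G \<Longrightarrow> (\<And>x j y. x \<in> Y \<Longrightarrow> y \<in> Y \<Longrightarrow> g = arr x j y \<Longrightarrow> P) \<Longrightarrow> P"
  by (auto simp: arr_def arrows_eq)

lemma gmult_arr [simp]: "gmult G (arr x i y) (arr y j z) = arr x (i + j) z"
  by (simp add: gmult_eq arr_def)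

lemma ginv_arr [simp]: "ginv G (arr x i y) = arr y (- i) x"
  by (simp add: ginv_eq arr_def)

lemma composable_arr [simp]:
  "composable G (arr x i y) (arr y' j z) \<longleftrightarrow> x \<in> Y \<and> y \<in> Y \<and> z \<in> Y \<and> y = y'"
  by (auto simp: composable_def)

lemma conv_simps [simp]:
  "vzero \<A> = (\<lambda>g. 0)" "vplus \<A> f h = (\<lambda>g. f g + h g)" "vscale \<A> c f = (\<lambda>g. c * f g)"
  by (simp_all add: convolution_algebra_def)

text \<open>In the discrete topology every function is continuous and the compact sets are the
  finite ones.\<close>

lemma carrier_iff: "f \<in> vcarrier \<A> \<longleftrightarrow> finite {g. f g \<noteq> 0} \<and> {g. f g \<noteq> 0} \<subseteq> arrows G"
proof -
  have "f \<in> vcarrier \<A> \<longleftrightarrow> (\<exists>K. (K \<subseteq> arrows G \<and> finite K) \<and> (\<forall>g. g \<notin> K \<longrightarrow> f g = 0))"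
    by (simp add: convolution_algebra_def gtop_eq compactin_discrete_topology)
  also have "\<dots> \<longleftrightarrow> finite {g. f g \<noteq> 0} \<and> {g. f g \<noteq> 0} \<subseteq> arrows G"
  proof
    assume "\<exists>K. (K \<subseteq> arrows G \<and> finite K) \<and> (\<forall>g. g \<notin> K \<longrightarrow> f g = 0)"
    then obtain K where "K \<subseteq> arrows G" "finite K" "{g. f g \<noteq> 0} \<subseteq> K" by blast
    then show "finite {g. f g \<noteq> 0} \<and> {g. f g \<noteq> 0} \<subseteq> arrows G" using finite_subset by blast
  qed blast
  finally show ?thesis .
qed

lemma carrierI: "finite S \<Longrightarrow> (\<And>g. f g \<noteq> 0 \<Longrightarrow> g \<in> S \<and> g \<in> arrows G) \<Longrightarrow> f \<in> vcarrier \<A>"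
  unfolding carrier_iff by (auto intro: finite_subset[of _ S])

lemma carrier_support: "f \<in> vcarrier \<A> \<Longrightarrow> f g \<noteq> 0 \<Longrightarrow> g \<in> arrows G"
  and carrier_finite: "f \<in> vcarrier \<A> \<Longrightarrow> finite {g. f g \<noteq> 0}"
  by (auto simp: carrier_iff)

lemma carrier_arr_Y: "f \<in> vcarrier \<A> \<Longrightarrow> f (arr x j y) \<noteq> 0 \<Longrightarrow> x \<in> Y \<and> y \<in> Y"
  using carrier_support by fastforce

lemma carrier_ext:
  assumes "f \<in> vcarrier \<A>" "h \<in> vcarrier \<A>" "\<And>x j y. f (arr x j y) = h (arr x j y)"
  shows "f = h"
proof
  fix g show "f g = h g"
    using assms carrier_support[of f g] carrier_support[of h g] by (metis arrows_cases)
qed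

text \<open>Indices for convolution sums with \<open>f\<close> as left factor: the integer and the
  right end of an arrow in its support, the latter being the vertex in the middle of the
  composition.\<close>

definition mids :: "('y \<times> (int \<times> int) \<times> 'y \<Rightarrow> complex) \<Rightarrow> (int \<times> 'y) set" where
  "mids f = (\<lambda>(x, (a, j), y). (j, y)) ` {g. f g \<noteq> 0}"

lemma mids: "f (arr x j y) \<noteq> 0 \<Longrightarrow> (j, y) \<in> mids f"
  unfolding mids_def by (rule image_eqI[of _ _ "arr x j y"]) (auto simp: arr_def)

lemma finite_mids [simp]: "f \<in> vcarrier \<A> \<Longrightarrow> finite (mids f)"
  by (simp add: mids_def carrier_finite)

lemma finite_coeffs: "f \<in> vcarrier \<A> \<Longrightarrow> finite {j. f (arr x j y) \<noteq> 0}"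
  by (rule finite_subset[of _ "fst ` mids f"]) (auto dest: mids intro: image_eqI[of _ fst "(_, y)"])

text \<open>A factorisation of \<open>arr x k w\<close> is determined by the middle vertex
  \<open>y\<close> and the integer \<open>i\<close> of its left part. The index set may be any
  finite set that covers the nonzero terms, so that different products can share one set.\<close>

lemma amult_arr:
  assumes f: "f \<in> vcarrier \<A>" and h: "h \<in> vcarrier \<A>" and F: "finite F"
    and "\<And>i y. f (arr x i y) \<noteq> 0 \<Longrightarrow> h (arr y (k - i) w) \<noteq> 0 \<Longrightarrow> (i, y) \<in> F"
  shows "amult \<A> f h (arr x k w) = (\<Sum>(i, y)\<in>F. f (arr x i y) * h (arr y (k - i) w))"
proof -
  let ?F = "{(i, y). f (arr x i y) \<noteq> 0 \<and> h (arr y (k - i) w) \<noteq> 0}"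
  have "(\<Sum>(i, y)\<in>F. f (arr x i y) * h (arr y (k - i) w)) = (\<Sum>(i, y)\<in>?F. f (arr x i y) * h (arr y (k - i) w))"
    by (rule sum.mono_neutral_right) (use assms in auto)
  also have "\<dots> = (\<Sum>(a, b) \<in> {(a, b). composable G a b \<and> gmult G a b = arr x k w \<and> f a \<noteq> 0 \<and> h b \<noteq> 0}. f a * h b)"
  proof (rule sum.reindex_bij_witness[where
      j = "\<lambda>(i, y). (arr x i y, arr y (k - i) w)" and i = "\<lambda>(a, b). (snd (fst (snd a)), snd (snd a))"])
    fix ab assume "ab \<in> {(a, b). composable G a b \<and> gmult G a b = arr x k w \<and> f a \<noteq> 0 \<and> h b \<noteq> 0}"
    then obtain a b where ab: "ab = (a, b)" "composable G a b" "gmult G a b = arr x k w" "f a \<noteq> 0" "h b \<noteq> 0"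
      by blast
    from carrier_support[OF f ab(4)] obtain x' i y where a: "a = arr x' i y" by (rule arrows_cases)
    from carrier_support[OF h ab(5)] obtain y' j w' where b: "b = arr y' j w'" by (rule arrows_cases)
    have "y' = y" using ab(2) by (simp add: a b)
    then have eq: "ab = (arr x i y, arr y (k - i) w)" "f (arr x i y) \<noteq> 0" "h (arr y (k - i) w) \<noteq> 0"
      using ab by (auto simp: a b)
    then show "(case case ab of (a, b) \<Rightarrow> (snd (fst (snd a)), snd (snd a)) of
        (i, y) \<Rightarrow> (arr x i y, arr y (k - i) w)) = ab"
      by (simp add: arr_def)
    show "(case ab of (a, b) \<Rightarrow> (snd (fst (snd a)), snd (snd a))) \<in> ?F"
      using eq(2,3) unfolding eq(1) by (simp add: arr_def)
  next
    fix iy assume "iy \<in> ?F"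
    then obtain i y where iy: "iy = (i, y)" "f (arr x i y) \<noteq> 0" "h (arr y (k - i) w) \<noteq> 0" by blast
    then show "(case iy of (i, y) \<Rightarrow> (arr x i y, arr y (k - i) w)) \<in>
        {(a, b). composable G a b \<and> gmult G a b = arr x k w \<and> f a \<noteq> 0 \<and> h b \<noteq> 0}"
      using carrier_arr_Y[OF f iy(2)] carrier_arr_Y[OF h iy(3)] by simp
  qed (auto simp: arr_def)
  also have "\<dots> = amult \<A> f h (arr x k w)"
    by (simp add: convolution_algebra_def)
  finally show ?thesis by simp
qed

lemma astar_arr: "f \<in> vcarrier \<A> \<Longrightarrow> astar \<A> f (arr x j y) = cnj (f (arr y (- j) x))"
  using carrier_arr_Y[of f y "-j" x] by (auto simp: convolution_algebra_def)

lemma amult_carrier [simp, intro]: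
  assumes f: "f \<in> vcarrier \<A>" and h: "h \<in> vcarrier \<A>" shows "amult \<A> f h \<in> vcarrier \<A>"
proof (rule carrierI)
  show "finite ((\<lambda>(a, b). gmult G a b) ` ({a. f a \<noteq> 0} \<times> {b. h b \<noteq> 0}))"
    using carrier_finite f h by auto
  fix g assume "amult \<A> f h g \<noteq> 0"
  then have "(\<Sum>(a, b) \<in> {(a, b). composable G a b \<and> gmult G a b = g \<and> f a \<noteq> 0 \<and> h b \<noteq> 0}. f a * h b) \<noteq> 0"
    by (simp add: convolution_algebra_def)
  then have "{(a, b). composable G a b \<and> gmult G a b = g \<and> f a \<noteq> 0 \<and> h b \<noteq> 0} \<noteq> {}"
    by (metis (no_types, lifting) sum.empty)
  then obtain a b where ab: "composable G a b" "gmult G a b = g" "f a \<noteq> 0" "h b \<noteq> 0" by blast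
  moreover obtain x i y where "a = arr x i y" using carrier_support[OF f ab(3)] by (rule arrows_cases)
  moreover obtain y' j z where "b = arr y' j z" using carrier_support[OF h ab(4)] by (rule arrows_cases)
  ultimately have "g \<in> arrows G" by auto
  then show "g \<in> (\<lambda>(a, b). gmult G a b) ` ({a. f a \<noteq> 0} \<times> {b. h b \<noteq> 0}) \<and> g \<in> arrows G"
    using ab by auto
qed

lemma astar_carrier [simp, intro]:
  assumes f: "f \<in> vcarrier \<A>" shows "astar \<A> f \<in> vcarrier \<A>"
proof (rule carrierI)
  show "finite (ginv G ` {a. f a \<noteq> 0})" using carrier_finite[OF f] by simp
  fix g assume g: "astar \<A> f g \<noteq> 0"
  then have "g \<in> arrows G" "f (ginv G g) \<noteq> 0" by (auto simp: convolution_algebra_def split: if_splits)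
  moreover from this have "g = ginv G (ginv G g)" by (elim arrows_cases) simp
  ultimately show "g \<in> ginv G ` {a. f a \<noteq> 0} \<and> g \<in> arrows G" by blast
qed

lemma vzero_carrier: "(\<lambda>g. 0) \<in> vcarrier \<A>"
  by (simp add: carrier_iff)

lemma vplus_carrier [simp, intro]:
  assumes f: "f \<in> vcarrier \<A>" and h: "h \<in> vcarrier \<A>" shows "(\<lambda>g. f g + h g) \<in> vcarrier \<A>"
proof (rule carrierI)
  show "finite ({g. f g \<noteq> 0} \<union> {g. h g \<noteq> 0})" using carrier_finite[OF f] carrier_finite[OF h] by simp
  fix g assume "f g + h g \<noteq> 0"
  then have "f g \<noteq> 0 \<or> h g \<noteq> 0" by auto
  then show "g \<in> {g. f g \<noteq> 0} \<union> {g. h g \<noteq> 0} \<and> g \<in> arrows G"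
    using carrier_support[OF f] carrier_support[OF h] by blast
qed

lemma vscale_carrier [simp, intro]:
  assumes f: "f \<in> vcarrier \<A>" shows "(\<lambda>g. c * f g) \<in> vcarrier \<A>"
  by (rule carrierI[OF carrier_finite[OF f]]) (use carrier_support[OF f] in auto)

lemma amult_assoc_conv:
  assumes f: "f \<in> vcarrier \<A>" and h: "h \<in> vcarrier \<A>" and l: "l \<in> vcarrier \<A>"
  shows "amult \<A> (amult \<A> f h) l = amult \<A> f (amult \<A> h l)"
proof (rule carrier_ext)
  fix x k w
  \<comment> \<open>\<open>F2\<close> serves two sums: the outer sum of the left-hand side, and,
    translated by each \<open>i\<close>, the inner sum of the right-hand side. The latter requires
    the sums of integers from \<open>f\<close> and \<open>h\<close>.\<close>
  define F1 F2 where "F1 = mids f" and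
    "F2 = mids (amult \<A> f h) \<union> (\<lambda>((i, y), (j, z)). (i + j, z)) ` (mids f \<times> mids h)"
  have fin: "finite F1" "finite F2" using assms by (auto simp: F1_def F2_def)
  have "amult \<A> (amult \<A> f h) l (arr x k w) = (\<Sum>(j, z)\<in>F2. amult \<A> f h (arr x j z) * l (arr z (k - j) w))"
    by (rule amult_arr) (use assms fin in \<open>auto simp: F2_def intro: mids\<close>)
  also have "\<dots> = (\<Sum>(j, z)\<in>F2. \<Sum>(i, y)\<in>F1. f (arr x i y) * (h (arr y (j - i) z) * l (arr z (k - j) w)))"
  proof (intro sum.cong refl, clarify)
    fix j z
    have "amult \<A> f h (arr x j z) = (\<Sum>(i, y)\<in>F1. f (arr x i y) * h (arr y (j - i) z))"
      by (rule amult_arr) (use assms fin in \<open>auto simp: F1_def intro: mids\<close>)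
    then show "amult \<A> f h (arr x j z) * l (arr z (k - j) w)
        = (\<Sum>(i, y)\<in>F1. f (arr x i y) * (h (arr y (j - i) z) * l (arr z (k - j) w)))"
      by (simp add: sum_distrib_right split_beta mult.assoc)
  qed
  also have "\<dots> = (\<Sum>(i, y)\<in>F1. f (arr x i y) * (\<Sum>(j, z)\<in>F2. h (arr y (j - i) z) * l (arr z (k - j) w)))"
    by (simp add: sum_distrib_left split_beta) (rule sum.swap)
  also have "\<dots> = (\<Sum>(i, y)\<in>F1. f (arr x i y) * amult \<A> h l (arr y (k - i) w))"
  proof (intro sum.cong refl, clarify)
    fix i y assume iy: "(i, y) \<in> F1"
    have "amult \<A> h l (arr y (k - i) w)
        = (\<Sum>(j, z)\<in>(\<lambda>(j, z). (j - i, z)) ` F2. h (arr y j z) * l (arr z (k - i - j) w))"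
    proof (rule amult_arr[OF h l])
      fix j z assume "h (arr y j z) \<noteq> 0"
      then have "(i + j, z) \<in> F2" using iy unfolding F1_def F2_def by (force dest: mids)
      then show "(j, z) \<in> (\<lambda>(j, z). (j - i, z)) ` F2" by (rule rev_image_eqI) auto
    qed (use fin in auto)
    also have "\<dots> = (\<Sum>(j, z)\<in>F2. h (arr y (j - i) z) * l (arr z (k - j) w))"
      by (subst sum.reindex) (auto simp: inj_on_def split_beta)
    finally show "f (arr x i y) * (\<Sum>(j, z)\<in>F2. h (arr y (j - i) z) * l (arr z (k - j) w))
        = f (arr x i y) * amult \<A> h l (arr y (k - i) w)" by simp
  qed
  also have "\<dots> = amult \<A> f (amult \<A> h l) (arr x k w)"
    by (rule amult_arr[symmetric]) (use assms fin in \<open>auto simp: F1_def intro: mids\<close>)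
  finally show "amult \<A> (amult \<A> f h) l (arr x k w) = amult \<A> f (amult \<A> h l) (arr x k w)" .
qed (use assms in auto)

lemma amult_arr_left:
  "f \<in> vcarrier \<A> \<Longrightarrow> h \<in> vcarrier \<A> \<Longrightarrow> finite F \<Longrightarrow> mids f \<subseteq> F \<Longrightarrow>
    amult \<A> f h (arr x k w) = (\<Sum>(i, y)\<in>F. f (arr x i y) * h (arr y (k - i) w))"
  by (rule amult_arr) (auto dest: mids)

text \<open>The substitution \<open>j = k - i\<close> indexes the sum by the right factor, which is
  the better known one when it is an adjoint or a point mass.\<close>

lemma amult_arr_right:
  assumes f: "f \<in> vcarrier \<A>" and h: "h \<in> vcarrier \<A>" and F: "finite F"
    and "\<And>y j w. h (arr y j w) \<noteq> 0 \<Longrightarrow> (j, y) \<in> F"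
  shows "amult \<A> f h (arr x k w) = (\<Sum>(j, y)\<in>F. f (arr x (k - j) y) * h (arr y j w))"
proof -
  have "amult \<A> f h (arr x k w) = (\<Sum>(i, y)\<in>(\<lambda>(j, y). (k - j, y)) ` F. f (arr x i y) * h (arr y (k - i) w))"
  proof (rule amult_arr[OF f h])
    fix i y assume "h (arr y (k - i) w) \<noteq> 0"
    then have "(k - i, y) \<in> F" using assms by blast
    then show "(i, y) \<in> (\<lambda>(j, y). (k - j, y)) ` F" by (rule rev_image_eqI) auto
  qed (use F in auto)
  also have "\<dots> = (\<Sum>(j, y)\<in>F. f (arr x (k - j) y) * h (arr y j w))"
    by (subst sum.reindex) (auto simp: inj_on_def split_beta)
  finally show ?thesis .
qed

definition lefts :: "('y \<times> (int \<times> int) \<times> 'y \<Rightarrow> complex) \<Rightarrow> (int \<times> 'y) set" where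
  "lefts f = (\<lambda>(x, (a, j), y). (j, x)) ` {g. f g \<noteq> 0}"

lemma lefts: "f (arr x j y) \<noteq> 0 \<Longrightarrow> (j, x) \<in> lefts f"
  unfolding lefts_def by (rule image_eqI[of _ _ "arr x j y"]) (auto simp: arr_def)

lemma finite_lefts [simp]: "f \<in> vcarrier \<A> \<Longrightarrow> finite (lefts f)"
  by (simp add: lefts_def carrier_finite)

lemma astar_amult_conv:
  assumes f: "f \<in> vcarrier \<A>" and h: "h \<in> vcarrier \<A>"
  shows "astar \<A> (amult \<A> f h) = amult \<A> (astar \<A> h) (astar \<A> f)"
proof (rule carrier_ext)
  fix x k w
  have "astar \<A> (amult \<A> f h) (arr x k w) = cnj (\<Sum>(i, y)\<in>mids f. f (arr w i y) * h (arr y (- k - i) x))"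
    using assms by (simp add: astar_arr amult_arr_left[OF f h _ subset_refl])
  also have "\<dots> = (\<Sum>(i, y)\<in>mids f. astar \<A> h (arr x (k + i) y) * astar \<A> f (arr y (- i) w))"
    using assms by (simp add: astar_arr split_beta mult.commute)
  also have "\<dots> = (\<Sum>(j, y)\<in>(\<lambda>(i, y). (- i, y)) ` mids f. astar \<A> h (arr x (k - j) y) * astar \<A> f (arr y j w))"
    by (subst sum.reindex) (auto simp: inj_on_def split_beta)
  also have "\<dots> = amult \<A> (astar \<A> h) (astar \<A> f) (arr x k w)"
  proof (rule amult_arr_right[symmetric])
    fix y j w assume "astar \<A> f (arr y j w) \<noteq> 0"
    then have "(- j, y) \<in> mids f" using f by (auto simp: astar_arr dest: mids)
    then show "(j, y) \<in> (\<lambda>(i, y). (- i, y)) ` mids f" by (rule rev_image_eqI) auto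
  qed (use assms in auto)
  finally show "astar \<A> (amult \<A> f h) (arr x k w) = amult \<A> (astar \<A> h) (astar \<A> f) (arr x k w)" .
qed (use assms in auto)

sublocale conv: star_algebra \<A>
proof
  fix a b c :: "'y \<times> (int \<times> int) \<times> 'y \<Rightarrow> complex" and t :: complex
  assume a: "a \<in> vcarrier \<A>" and b: "b \<in> vcarrier \<A>"
  show "amult \<A> (vscale \<A> t a) b = vscale \<A> t (amult \<A> a b)"
    by (rule carrier_ext)
      (use a b in \<open>auto simp: amult_arr_left[of _ _ "mids a \<union> mids (\<lambda>g. t * a g)"] sum_distrib_left split_beta mult.assoc\<close>)
  show "amult \<A> a (vscale \<A> t b) = vscale \<A> t (amult \<A> a b)"
    by (rule carrier_ext)
      (use a b in \<open>auto simp: amult_arr_left[of _ _ "mids a"] sum_distrib_left split_beta mult_ac\<close>)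
  show "astar \<A> (amult \<A> a b) = amult \<A> (astar \<A> b) (astar \<A> a)"
    by (rule astar_amult_conv[OF a b])
  show "astar \<A> (vplus \<A> a b) = vplus \<A> (astar \<A> a) (astar \<A> b)"
    by (auto simp: convolution_algebra_def fun_eq_iff)
  assume c: "c \<in> vcarrier \<A>"
  show "amult \<A> (amult \<A> a b) c = amult \<A> a (amult \<A> b c)"
    by (rule amult_assoc_conv[OF a b c])
  show "amult \<A> (vplus \<A> a b) c = vplus \<A> (amult \<A> a c) (amult \<A> b c)"
    by (rule carrier_ext)
      (use a b c in \<open>auto simp: amult_arr_left[of _ _ "mids a \<union> mids b \<union> mids (\<lambda>g. a g + b g)"] sum.distrib split_beta distrib_right le_supI1\<close>)
  show "amult \<A> a (vplus \<A> b c) = vplus \<A> (amult \<A> a b) (amult \<A> a c)"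
    by (rule carrier_ext)
      (use a b c in \<open>auto simp: amult_arr_left[of _ _ "mids a"] sum.distrib split_beta distrib_left\<close>)
next
  fix a assume a: "a \<in> vcarrier \<A>"
  show "astar \<A> (astar \<A> a) = a" by (rule carrier_ext) (use a in \<open>auto simp: astar_arr\<close>)
qed (auto simp: vzero_carrier algebra_simps, auto simp: convolution_algebra_def)

end

section \<open>Algebraic rules for Laurent polynomials\<close>

lemma laurent_nonzero: "laurent c z \<noteq> 0 \<Longrightarrow> \<exists>j. c j \<noteq> 0"
  unfolding laurent_def by (metis (mono_tags, lifting) mem_Collect_eq sum.neutral)

lemma laurent_add:
  assumes "finite {j. c j \<noteq> 0}" "finite {j. d j \<noteq> 0}"
  shows "laurent (\<lambda>j. c j + d j) z = laurent c z + laurent d z"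
proof -
  let ?J = "{j. c j \<noteq> 0} \<union> {j. d j \<noteq> 0}"
  have "laurent (\<lambda>j. c j + d j) z = (\<Sum>j\<in>?J. (c j + d j) * z powi j)"
    "laurent c z = (\<Sum>j\<in>?J. c j * z powi j)" "laurent d z = (\<Sum>j\<in>?J. d j * z powi j)"
    by (rule laurent_eq_sum; use assms in auto)+
  then show ?thesis by (simp add: distrib_right sum.distrib)
qed

lemma laurent_scale: "laurent (\<lambda>j. t * c j) z = t * laurent c z"
  by (cases "t = 0") (auto simp: laurent_def sum_distrib_left mult.assoc)

text \<open>On the circle \<open>cnj z\<close> is \<open>inverse z\<close>, so conjugation reverses
  the exponents.\<close>

lemma laurent_cnj:
  assumes "cmod z = 1" shows "laurent (\<lambda>j. cnj (c (- j))) z = cnj (laurent c z)"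
proof -
  have z: "cnj z = inverse z"
    using assms complex_div_cnj[of 1 z] by (simp add: inverse_eq_divide)
  have "laurent (\<lambda>j. cnj (c (- j))) z = (\<Sum>j | c (- j) \<noteq> 0. cnj (c (- j)) * z powi j)"
    by (simp add: laurent_def)
  also have "\<dots> = (\<Sum>j | c j \<noteq> 0. cnj (c j) * z powi (- j))"
    by (rule sum.reindex_bij_witness[of _ uminus uminus]) auto
  also have "\<dots> = cnj (laurent c z)"
    by (simp add: laurent_def z power_int_minus power_int_inverse)
  finally show ?thesis .
qed

context triple_groupoid
begin

section \<open>Representations by Fourier transform\<close>

definition fourier :: "complex \<Rightarrow> ('y \<times> (int \<times> int) \<times> 'y \<Rightarrow> complex) \<Rightarrow> 'y \<Rightarrow> 'y \<Rightarrow> complex" where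
  "fourier z f x y = laurent (\<lambda>j. f (arr x j y)) z"

lemma fmatrix_fourier: "f \<in> vcarrier \<A> \<Longrightarrow> fmatrix (fourier z f)"
proof (rule fmatrixI)
  assume f: "f \<in> vcarrier \<A>"
  show "finite (snd ` lefts f \<union> snd ` mids f)" using f by simp
  fix x y assume "fourier z f x y \<noteq> 0"
  then obtain j where "f (arr x j y) \<noteq> 0" unfolding fourier_def using laurent_nonzero by blast
  from mids[of f, OF this] lefts[of f, OF this] show "x \<in> snd ` lefts f \<union> snd ` mids f \<and> y \<in> snd ` lefts f \<union> snd ` mids f"
    by (metis UnI1 UnI2 imageI snd_conv)
qed

lemma fourier_add: "f \<in> vcarrier \<A> \<Longrightarrow> h \<in> vcarrier \<A> \<Longrightarrow> fourier z (\<lambda>g. f g + h g) x y = fourier z f x y + fourier z h x y"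
  by (simp add: fourier_def laurent_add finite_coeffs)

lemma fourier_scale: "fourier z (\<lambda>g. t * f g) x y = t * fourier z f x y"
  by (simp add: fourier_def laurent_scale)

lemma fourier_star: "f \<in> vcarrier \<A> \<Longrightarrow> cmod z = 1 \<Longrightarrow> fourier z (astar \<A> f) = madj (fourier z f)"
  using laurent_cnj[of z "\<lambda>j. f (arr _ j _)"] by (simp add: fourier_def madj_def fun_eq_iff astar_arr)

text \<open>Convolution in the integer becomes multiplication of Laurent polynomials, and the sum
  over the middle vertex is the matrix product.\<close>

lemma fourier_amult:
  assumes f: "f \<in> vcarrier \<A>" and h: "h \<in> vcarrier \<A>" and "z \<noteq> 0"
  shows "fourier z (amult \<A> f h) = mprod (fourier z f) (fourier z h)"
proof (intro ext)
  fix x w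
  \<comment> \<open>\<open>J\<close> covers the exponents of the product and all sums of exponents
    of the factors. Translated by \<open>- i\<close> for \<open>i \<in> I\<close>, it therefore
    still covers the exponents of \<open>h\<close>.\<close>
  define I S J where "I = fst ` mids f" and "S = snd ` mids f"
    and "J = fst ` mids (amult \<A> f h) \<union> (\<lambda>(i, j). i + j) ` (fst ` mids f \<times> fst ` mids h)"
  have fin: "finite I" "finite S" "finite J" using f h by (simp_all add: I_def S_def J_def)
  have midsf: "i \<in> I" "y \<in> S" if "f (arr x i y) \<noteq> 0" for x i y
    using mids[of f, OF that] by (auto simp: I_def S_def intro: image_eqI[of _ fst "(i, y)"] image_eqI[of _ snd "(i, y)"])
  have "fourier z (amult \<A> f h) x w = (\<Sum>k\<in>J. amult \<A> f h (arr x k w) * z powi k)"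
    unfolding fourier_def by (rule laurent_eq_sum) (use fin in \<open>force simp: J_def dest: mids\<close>)+
  also have "\<dots> = (\<Sum>k\<in>J. (\<Sum>(i, y)\<in>I \<times> S. f (arr x i y) * h (arr y (k - i) w)) * z powi k)"
    by (rule sum.cong[OF refl], subst amult_arr[OF f h, of "I \<times> S"]) (use fin midsf in auto)
  also have "\<dots> = (\<Sum>(i, y)\<in>I \<times> S. \<Sum>k\<in>J. f (arr x i y) * h (arr y (k - i) w) * z powi k)"
    unfolding sum_distrib_right split_beta by (rule sum.swap)
  also have "\<dots> = (\<Sum>(i, y)\<in>I \<times> S. f (arr x i y) * z powi i * fourier z h y w)"
  proof (intro sum.cong refl, clarify)
    fix i y assume i: "i \<in> I"
    have "fourier z h y w = (\<Sum>j\<in>(\<lambda>k. k - i) ` J. h (arr y j w) * z powi j)"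
      unfolding fourier_def
    proof (rule laurent_eq_sum)
      show "{j. h (arr y j w) \<noteq> 0} \<subseteq> (\<lambda>k. k - i) ` J"
      proof
        fix j assume "j \<in> {j. h (arr y j w) \<noteq> 0}"
        then have "j \<in> fst ` mids h" using mids[of h y j w] by (auto intro: image_eqI[of _ fst "(j, w)"])
        then have "i + j \<in> J" using i unfolding I_def J_def by auto
        then show "j \<in> (\<lambda>k. k - i) ` J" by (rule rev_image_eqI) simp
      qed
    qed (use fin in simp)
    also have "\<dots> = (\<Sum>k\<in>J. h (arr y (k - i) w) * z powi (k - i))"
      by (subst sum.reindex) (auto simp: inj_on_def)
    finally have "z powi i * fourier z h y w = (\<Sum>k\<in>J. h (arr y (k - i) w) * z powi k)"
      using \<open>z \<noteq> 0\<close> by (simp add: sum_distrib_left power_int_diff)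
    then show "(\<Sum>k\<in>J. f (arr x i y) * h (arr y (k - i) w) * z powi k) = f (arr x i y) * z powi i * fourier z h y w"
      by (simp only: mult.assoc sum_distrib_left)
  qed
  also have "\<dots> = (\<Sum>y\<in>S. \<Sum>i\<in>I. f (arr x i y) * z powi i * fourier z h y w)"
    by (subst sum.swap) (simp add: sum.cartesian_product)
  also have "\<dots> = (\<Sum>y\<in>S. fourier z f x y * fourier z h y w)"
  proof (rule sum.cong[OF refl])
    fix y
    have "fourier z f x y = (\<Sum>i\<in>I. f (arr x i y) * z powi i)"
      unfolding fourier_def by (rule laurent_eq_sum) (use fin midsf in auto)
    then show "(\<Sum>i\<in>I. f (arr x i y) * z powi i * fourier z h y w) = fourier z f x y * fourier z h y w"
      by (simp add: sum_distrib_right)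
  qed
  also have "\<dots> = mprod (fourier z f) (fourier z h) x w"
  proof (rule mprod_eq_sum[symmetric])
    fix y assume "fourier z f x y \<noteq> 0"
    then show "y \<in> S" unfolding fourier_def using laurent_nonzero midsf by blast
  qed (use fin fmatrix_fourier[OF f] in auto)
  finally show "fourier z (amult \<A> f h) x w = mprod (fourier z f) (fourier z h) x w" .
qed

text \<open>On the circle \<open>fourier z\<close> respects products and adjoints, so the operator
  norm pulls back. These seminorms bound the universal one from below.\<close>

lemma cstar_seminorm_fourier:
  assumes z: "cmod z = 1" shows "cstar_seminorm \<A> (\<lambda>f. opnorm (fourier z f))"
proof -
  have z0: "z \<noteq> 0" using z by auto
  show ?thesis
    unfolding cstar_seminorm_def
  proof (intro conjI ballI allI)
    fix f t assume f: "f \<in> vcarrier \<A>"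
    show "0 \<le> opnorm (fourier z f)" by (rule opnorm_nonneg[OF fmatrix_fourier[OF f]])
    have "fourier z (\<lambda>g. t * f g) = (\<lambda>x y. t * fourier z f x y)" by (simp add: fun_eq_iff fourier_scale)
    then show "opnorm (fourier z (vscale \<A> t f)) = cmod t * opnorm (fourier z f)"
      using opnorm_scale[OF fmatrix_fourier[OF f]] by simp
    show "opnorm (fourier z (amult \<A> (astar \<A> f) f)) = (opnorm (fourier z f))\<^sup>2"
      by (simp add: fourier_amult z0 fourier_star f z opnorm_star fmatrix_fourier)
    fix h assume h: "h \<in> vcarrier \<A>"
    have "fourier z (\<lambda>g. f g + h g) = (\<lambda>x y. fourier z f x y + fourier z h x y)" by (simp add: fun_eq_iff fourier_add f h)
    then show "opnorm (fourier z (vplus \<A> f h)) \<le> opnorm (fourier z f) + opnorm (fourier z h)"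
      using opnorm_add[OF fmatrix_fourier[OF f] fmatrix_fourier[OF h]] by simp
    show "opnorm (fourier z (amult \<A> f h)) \<le> opnorm (fourier z f) * opnorm (fourier z h)"
      by (simp add: fourier_amult z0 f h opnorm_mprod fmatrix_fourier)
  qed
qed

section \<open>The universal seminorm of a corner\<close>

definition delta :: "'y \<times> (int \<times> int) \<times> 'y \<Rightarrow> 'y \<times> (int \<times> int) \<times> 'y \<Rightarrow> complex" where
  "delta g = (\<lambda>g'. if g' = g then 1 else 0)"

lemma delta_apply: "delta g g' = (if g' = g then 1 else 0)"
  by (simp add: delta_def)

lemma delta_carrier [simp, intro]: "g \<in> arrows G \<Longrightarrow> delta g \<in> vcarrier \<A>"
  by (rule carrierI[of "{g}"]) (auto simp: delta_def split: if_splits)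

lemma amult_delta_left:
  assumes "x \<in> Y" "y \<in> Y" "f \<in> vcarrier \<A>"
  shows "amult \<A> (delta (arr x i y)) f (arr x' k w) = (if x' = x then f (arr y (k - i) w) else 0)"
  by (subst amult_arr[of _ _ "{(i, y)}"]) (use assms in \<open>auto simp: delta_apply split: if_splits\<close>)

lemma amult_delta_right:
  assumes "y \<in> Y" "w \<in> Y" "f \<in> vcarrier \<A>"
  shows "amult \<A> f (delta (arr y j w)) (arr x k w') = (if w' = w then f (arr x (k - j) y) else 0)"
  by (subst amult_arr_right[of _ _ "{(j, y)}"]) (use assms in \<open>auto simp: delta_apply split: if_splits\<close>)

lemma amult_delta_delta:
  "\<lbrakk>x \<in> Y; y \<in> Y; w \<in> Y\<rbrakk> \<Longrightarrow> amult \<A> (delta (arr x i y)) (delta (arr y j w)) = delta (arr x (i + j) w)"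
  by (rule carrier_ext) (auto simp: amult_delta_left, auto simp: delta_apply)

lemma astar_delta: "\<lbrakk>x \<in> Y; y \<in> Y\<rbrakk> \<Longrightarrow> astar \<A> (delta (arr x j y)) = delta (arr y (- j) x)"
  by (rule carrier_ext) (auto simp: astar_arr, auto simp: delta_apply)

text \<open>A point mass is a partial isometry: its adjoint times itself is the projection
  \<open>u\<close> at a unit. The C*-identity gives \<open>(\<rho> u)\<^sup>2 = \<rho> u\<close>, so
  \<open>\<rho> u\<close> is 0 or 1.\<close>

lemma cstar_seminorm_delta_le:
  assumes \<rho>: "cstar_seminorm \<A> \<rho>" and g: "g \<in> arrows G" shows "\<rho> (delta g) \<le> 1"
proof -
  interpret star_algebra_seminorm \<A> \<rho> by unfold_locales (rule \<rho>)
  obtain x j y where g: "g = arr x j y" "x \<in> Y" "y \<in> Y" using g by (elim arrows_cases)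
  define u where "u = delta (arr y 0 y)"
  have uc: "u \<in> vcarrier \<A>" using g by (simp add: u_def)
  have gu: "amult \<A> (astar \<A> (delta g)) (delta g) = u"
    using g by (simp add: u_def astar_delta amult_delta_delta)
  have "amult \<A> (astar \<A> u) u = u" using g by (simp add: u_def astar_delta amult_delta_delta)
  then have "(\<rho> u)\<^sup>2 = \<rho> u" using norm_star_amult[OF uc] by simp
  then have "\<rho> u \<le> 1" by (auto simp: power2_eq_square)
  then have "(\<rho> (delta g))\<^sup>2 \<le> 1\<^sup>2" using norm_star_amult[of "delta g"] gu g by simp
  then show ?thesis by (rule power2_le_imp_le) simp
qed

text \<open>Removes one point of the support at a time. The condition \<open>h g = 0\<close> keeps
  the supports disjoint, so that sums of absolute values add up exactly.\<close>

lemma carrier_induct [consumes 1, case_names zero add]: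
  assumes f: "f \<in> vcarrier \<A>" and zero: "P (\<lambda>g. 0)"
    and add: "\<And>g t h. \<lbrakk>g \<in> arrows G; t \<noteq> 0; h \<in> vcarrier \<A>; h g = 0; P h\<rbrakk>
      \<Longrightarrow> P (\<lambda>g'. t * delta g g' + h g')"
  shows "P f"
  using carrier_finite[OF f] f
proof (induction "{g. f g \<noteq> 0}" arbitrary: f rule: finite_induct)
  case empty
  then have "f = (\<lambda>g. 0)" by auto
  then show ?case using zero by simp
next
  case (insert g S)
  then have "f g \<noteq> 0" by blast
  then have g: "g \<in> arrows G" by (rule carrier_support[OF insert.prems])
  define h where "h = (\<lambda>g'. if g' = g then 0 else f g')"
  have h: "h \<in> vcarrier \<A>"
    by (rule carrierI[OF carrier_finite[OF insert.prems]])
      (use carrier_support[OF insert.prems] in \<open>auto simp: h_def split: if_splits\<close>)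
  have "S = {g. h g \<noteq> 0}" using insert.hyps(2,4) by (auto simp: h_def)
  then have "P h" using insert.hyps(3) h by blast
  from add[OF g \<open>f g \<noteq> 0\<close> h _ this] have "P (\<lambda>g'. f g * delta g g' + h g')" by (simp add: h_def)
  also have "(\<lambda>g'. f g * delta g g' + h g') = f" by (auto simp: h_def delta_apply)
  finally show ?case .
qed

text \<open>The triangle inequality over point masses. The bound does not depend on the seminorm,
  which is what makes the universal seminorm finite.\<close>

lemma cstar_seminorm_le_sum:
  assumes \<rho>: "cstar_seminorm \<A> \<rho>" and f: "f \<in> vcarrier \<A>"
  shows "\<rho> f \<le> (\<Sum>g | f g \<noteq> 0. cmod (f g))"
proof -
  interpret star_algebra_seminorm \<A> \<rho> by unfold_locales (rule \<rho>)
  show ?thesis using f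
  proof (induction f rule: carrier_induct)
    case zero
    then show ?case using norm_vzero by simp
  next
    case (add g t h)
    have "\<rho> (\<lambda>g'. t * delta g g' + h g') \<le> \<rho> (vscale \<A> t (delta g)) + \<rho> h"
      using norm_triangle[of "vscale \<A> t (delta g)" h] add by simp
    also have "\<rho> (vscale \<A> t (delta g)) = cmod t * \<rho> (delta g)"
      using add by (intro norm_vscale) simp
    also have "\<dots> \<le> cmod t * 1"
      by (intro mult_left_mono cstar_seminorm_delta_le \<rho> add) simp
    finally have "\<rho> (\<lambda>g'. t * delta g g' + h g') \<le> cmod t + (\<Sum>g | h g \<noteq> 0. cmod (h g))"
      using add.IH by simp
    also have "\<dots> = (\<Sum>g' \<in> insert g {g. h g \<noteq> 0}. cmod (t * delta g g' + h g'))"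
      using add carrier_finite[OF add(3)] by (subst sum.insert) (auto simp: delta_apply intro!: sum.cong)
    also have "insert g {g. h g \<noteq> 0} = {g'. t * delta g g' + h g' \<noteq> 0}"
      using add by (auto simp: delta_apply)
    finally show ?case .
  qed
qed

lemma cstar_seminorms_bounded:
  "f \<in> vcarrier \<A> \<Longrightarrow> \<exists>M. \<forall>\<rho>. cstar_seminorm \<A> \<rho> \<longrightarrow> \<rho> f \<le> M"
  using cstar_seminorm_le_sum by blast

lemmas universal_cstar = conv.cstar_seminorm_universal[OF cstar_seminorms_bounded]

lemma norm_fourier_le_universal:
  assumes "f \<in> vcarrier \<A>" "cmod z = 1"
  shows "cmod (fourier z f x y) \<le> universal_seminorm \<A> f"
  using norm_entry_le_opnorm[OF fmatrix_fourier[OF assms(1)], of z x y]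
    universal_cstar(1)[OF _ cstar_seminorm_fourier[OF assms(2)] assms(1)] by simp

text \<open>The functions on the isotropy group at \<open>x\<close>, a copy of the integers; under
  the Fourier transform they are the Laurent polynomials.\<close>

definition corner :: "'y \<Rightarrow> ('y \<times> (int \<times> int) \<times> 'y \<Rightarrow> complex) set" where
  "corner x = {f \<in> vcarrier \<A>. \<forall>g. f g \<noteq> 0 \<longrightarrow> (\<exists>j. g = arr x j x)}"

lemma corner_carrier: "f \<in> corner x \<Longrightarrow> f \<in> vcarrier \<A>"
  by (simp add: corner_def)

lemma corner_cases:
  assumes "f \<in> corner x" "f g \<noteq> 0" obtains j where "g = arr x j x"
  using assms unfolding corner_def by blast

lemma corner_arr: "f \<in> corner x \<Longrightarrow> f (arr y j w) \<noteq> 0 \<Longrightarrow> y = x \<and> w = x"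
  by (metis corner_cases arr_eq_iff)

lemma cornerI:
  assumes f: "f \<in> vcarrier \<A>" and "\<And>y j w. f (arr y j w) \<noteq> 0 \<Longrightarrow> y = x \<and> w = x" shows "f \<in> corner x"
  unfolding corner_def
proof (intro CollectI conjI f allI impI)
  fix g assume "f g \<noteq> 0"
  moreover from carrier_support[OF f this] obtain y j w where "g = arr y j w" by (rule arrows_cases)
  ultimately show "\<exists>j. g = arr x j x" using assms(2) by blast
qed

text \<open>As \<open>h\<close> lies in the corner, column \<open>x\<close> of its matrix can be
  nonzero only on the diagonal, and the matrix product at \<open>(x, x)\<close> is left with one
  term.\<close>

lemma fourier_corner_amult:
  assumes f: "f \<in> vcarrier \<A>" and h: "h \<in> corner x" and "z \<noteq> 0"
  shows "fourier z (amult \<A> f h) x x = fourier z f x x * fourier z h x x"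
proof -
  have "fourier z (amult \<A> f h) x x = (\<Sum>y\<in>{x}. fourier z f x y * fourier z h y x)"
    unfolding fourier_amult[OF f corner_carrier[OF h] \<open>z \<noteq> 0\<close>]
  proof (rule mprod_eq_sum)
    fix y assume "fourier z h y x \<noteq> 0"
    then obtain j where "h (arr y j x) \<noteq> 0" unfolding fourier_def using laurent_nonzero by blast
    then show "y \<in> {x}" using corner_arr[OF h] by blast
  qed (use fmatrix_fourier[OF f] in auto)
  then show ?thesis by simp
qed

lemma fourier_corner_star_amult:
  assumes f: "f \<in> corner x" and z: "cmod z = 1"
  shows "fourier z (amult \<A> (astar \<A> f) f) x x = cnj (fourier z f x x) * fourier z f x x"
proof -
  have "z \<noteq> 0" using z by auto
  then show ?thesis
    using fourier_corner_amult[OF astar_carrier[OF corner_carrier[OF f]] f]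
    by (simp add: fourier_star[OF corner_carrier[OF f] z] madj_def)
qed

lemma corner_star_amult: "f \<in> corner x \<Longrightarrow> amult \<A> (astar \<A> f) f \<in> corner x"
proof (rule cornerI)
  assume f: "f \<in> corner x"
  note fc = corner_carrier[OF f]
  show "amult \<A> (astar \<A> f) f \<in> vcarrier \<A>" using fc by blast
  fix y k w assume ne: "amult \<A> (astar \<A> f) f (arr y k w) \<noteq> 0"
  obtain i u where *: "astar \<A> f (arr y i u) * f (arr u (k - i) w) \<noteq> 0"
  proof -
    have "(\<Sum>(i, u)\<in>mids (astar \<A> f). astar \<A> f (arr y i u) * f (arr u (k - i) w)) \<noteq> 0"
      using ne fc by (simp add: amult_arr_left[OF _ fc, of "astar \<A> f" "mids (astar \<A> f)"])
    then show ?thesis using that by (metis (mono_tags, lifting) case_prod_beta sum.neutral)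
  qed
  then show "y = x \<and> w = x" using corner_arr[OF f] fc by (auto simp: astar_arr)
qed

text \<open>A nonzero coefficient of the product involves coefficients of \<open>f\<close> at
  \<open>- i\<close> and \<open>k - i\<close>, both of size at most \<open>D\<close>. So one
  application of \<open>f \<mapsto> f* f\<close> at most doubles the degree.\<close>

lemma corner_star_amult_coeff:
  assumes f: "f \<in> corner x" and D: "\<And>j. f (arr x j x) \<noteq> 0 \<Longrightarrow> \<bar>j\<bar> \<le> D"
    and ne: "amult \<A> (astar \<A> f) f (arr x k x) \<noteq> 0"
  shows "\<bar>k\<bar> \<le> 2 * D"
proof -
  note fc = corner_carrier[OF f]
  obtain i u where *: "astar \<A> f (arr x i u) * f (arr u (k - i) x) \<noteq> 0"
  proof -
    have "(\<Sum>(i, u)\<in>mids (astar \<A> f). astar \<A> f (arr x i u) * f (arr u (k - i) x)) \<noteq> 0"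
      using ne fc by (simp add: amult_arr_left[OF _ fc, of "astar \<A> f" "mids (astar \<A> f)"])
    then show ?thesis using that by (metis (mono_tags, lifting) case_prod_beta sum.neutral)
  qed
  then have "f (arr u (- i) x) \<noteq> 0" "f (arr u (k - i) x) \<noteq> 0" using fc by (auto simp: astar_arr)
  moreover from this have "u = x" using corner_arr[OF f] by blast
  ultimately have "\<bar>- i\<bar> \<le> D" "\<bar>k - i\<bar> \<le> D" using D by blast+
  then show ?thesis by linarith
qed

text \<open>
  The trivial bound by the sum of the coefficients is off by a factor that is linear in the
  degree. Applied to the iterates of \<open>f \<mapsto> f\<^sup>* f\<close>, which square both seminorm and Fourier transform,
  the factor disappears in the limit.
\<close>

lemma cstar_seminorm_corner_le:
  assumes \<rho>: "cstar_seminorm \<A> \<rho>" and f: "f \<in> corner x"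
    and M: "\<And>z. cmod z = 1 \<Longrightarrow> cmod (fourier z f x x) \<le> M"
  shows "\<rho> f \<le> M"
proof -
  interpret star_algebra_seminorm \<A> \<rho> by unfold_locales (rule \<rho>)
  have "0 \<le> M" using order_trans[OF norm_ge_zero M[of 1]] by simp
  \<comment> \<open>There are \<open>2 * D + 1\<close> exponents between \<open>-D\<close> and
    \<open>D\<close>, and each coefficient is at most \<open>B\<close> by
    \<open>laurent_coeff_bound\<close>.\<close>
  have bound: "\<rho> h \<le> (2 * real_of_int D + 1) * B"
    if h: "h \<in> corner x" and B: "\<And>z. cmod z = 1 \<Longrightarrow> cmod (fourier z h x x) \<le> B"
      and D: "\<And>j. h (arr x j x) \<noteq> 0 \<Longrightarrow> \<bar>j\<bar> \<le> D" "0 \<le> D" for h B and D :: int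
  proof -
    note hc = corner_carrier[OF h]
    have inj: "inj_on (\<lambda>j. arr x j x) {-D..D}" by (auto simp: inj_on_def)
    have "\<rho> h \<le> (\<Sum>g | h g \<noteq> 0. cmod (h g))" by (rule cstar_seminorm_le_sum[OF \<rho> hc])
    also have "\<dots> \<le> (\<Sum>g\<in>(\<lambda>j. arr x j x) ` {-D..D}. cmod (h g))"
    proof (rule sum_mono2)
      show "{g. h g \<noteq> 0} \<subseteq> (\<lambda>j. arr x j x) ` {-D..D}"
      proof
        fix g assume g: "g \<in> {g. h g \<noteq> 0}"
        then obtain j where "g = arr x j x" using corner_cases[OF h] by blast
        moreover from this g have "j \<in> {-D..D}" using D(1)[of j] by auto
        ultimately show "g \<in> (\<lambda>j. arr x j x) ` {-D..D}" by blast
      qed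
    qed simp_all
    also have "\<dots> = (\<Sum>j\<in>{-D..D}. cmod (h (arr x j x)))" by (simp add: sum.reindex[OF inj])
    also have "\<dots> \<le> (\<Sum>j\<in>{-D..D}. B)"
    proof (rule sum_mono)
      fix j show "cmod (h (arr x j x)) \<le> B"
        by (rule laurent_coeff_bound[OF finite_coeffs[OF hc]]) (use B in \<open>simp add: fourier_def\<close>)
    qed
    also have "\<dots> = (2 * real_of_int D + 1) * B" using D(2) by simp
    finally show ?thesis .
  qed
  define s where "s = (\<lambda>n. ((\<lambda>h. amult \<A> (astar \<A> h) h) ^^ n) f)"
  have s_Suc: "s (Suc n) = amult \<A> (astar \<A> (s n)) (s n)" for n by (simp add: s_def)
  have "finite {j. f (arr x j x) \<noteq> 0}" using finite_coeffs corner_carrier[OF f] by blast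
  then obtain D where D: "\<And>j. f (arr x j x) \<noteq> 0 \<Longrightarrow> \<bar>j\<bar> \<le> D" "0 \<le> D"
  proof -
    assume fin: "finite {j. f (arr x j x) \<noteq> 0}"
    \<comment> \<open>Inserting 0 makes the maximum defined and nonnegative also for
      \<open>f = 0\<close>.\<close>
    let ?D = "Max (insert 0 (abs ` {j. f (arr x j x) \<noteq> 0}))"
    have "\<bar>j\<bar> \<le> ?D" if "f (arr x j x) \<noteq> 0" for j using fin that by (intro Max_ge) auto
    moreover have "0 \<le> ?D" using fin by (intro Max_ge) auto
    ultimately show ?thesis using that by blast
  qed
  have s: "s n \<in> corner x \<and> \<rho> (s n) = \<rho> f ^ (2 ^ n) \<and>
      (\<forall>z. cmod z = 1 \<longrightarrow> cmod (fourier z (s n) x x) \<le> M ^ (2 ^ n)) \<and>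
      (\<forall>j. s n (arr x j x) \<noteq> 0 \<longrightarrow> \<bar>j\<bar> \<le> 2 ^ n * D)" for n
  proof (induction n)
    case 0
    then show ?case using f M D by (simp add: s_def)
  next
    case (Suc n)
    then have c: "s n \<in> corner x" by blast
    have "\<rho> (s (Suc n)) = \<rho> f ^ (2 ^ Suc n)"
      using Suc norm_star_amult[OF corner_carrier[OF c]] by (simp add: s_Suc power_mult[symmetric] mult.commute)
    moreover have "cmod (fourier z (s (Suc n)) x x) \<le> M ^ (2 ^ Suc n)" if z: "cmod z = 1" for z
    proof -
      have "cmod (fourier z (s (Suc n)) x x) = (cmod (fourier z (s n) x x))\<^sup>2"
        by (simp add: s_Suc fourier_corner_star_amult[OF c z] norm_mult power2_eq_square)
      also have "\<dots> \<le> (M ^ (2 ^ n))\<^sup>2" using Suc z by (intro power_mono) auto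
      finally show ?thesis by (simp add: power_mult[symmetric] mult.commute)
    qed
    moreover have "\<bar>j\<bar> \<le> 2 ^ Suc n * D" if "s (Suc n) (arr x j x) \<noteq> 0" for j
      using corner_star_amult_coeff[OF c, of "2 ^ n * D" j] Suc that by (simp add: s_Suc)
    ultimately show ?case using corner_star_amult[OF c] by (simp add: s_Suc)
  qed
  show ?thesis
  proof (rule root_growth_le)
    show "0 \<le> \<rho> f" using corner_carrier[OF f] by simp
    show "0 \<le> M" by fact
    fix n
    have "\<rho> (s n) \<le> (2 * real_of_int (2 ^ n * D) + 1) * M ^ (2 ^ n)"
      by (rule bound) (use s[of n] D(2) in auto)
    then show "\<rho> f ^ 2 ^ n \<le> (2 * (2 ^ n * real_of_int D) + 1) * M ^ 2 ^ n" using s[of n] by simp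
  qed
qed

lemma universal_seminorm_corner_le:
  assumes f: "f \<in> corner x" and M: "\<And>z. cmod z = 1 \<Longrightarrow> cmod (fourier z f x x) \<le> M"
  shows "universal_seminorm \<A> f \<le> M"
  by (rule cstar_seminorm_corner_le[OF universal_cstar(2) f M])

end

section \<open>The completed corner at a base point and its isomorphism with C(T)\<close>

locale pointed_triple_groupoid = triple_groupoid Y lev G
  for Y :: "'y set" and lev G +
  fixes y0 :: 'y
  assumes y0_in: "y0 \<in> Y"
begin

abbreviation "\<rho> \<equiv> universal_seminorm \<A>"

sublocale U: star_algebra_seminorm \<A> \<rho>
  by unfold_locales (rule universal_cstar(2))

definition E :: "complex \<Rightarrow> ('y \<times> (int \<times> int) \<times> 'y \<Rightarrow> complex) \<Rightarrow> complex" where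
  "E z f = fourier z f y0 y0"

definition unit :: "'y \<times> (int \<times> int) \<times> 'y \<Rightarrow> complex" where
  "unit = delta (arr y0 0 y0)"

text \<open>
  The continuous extension of \<open>E z\<close> to the completion; the limit does not depend on the
  representing sequence.
\<close>

definition \<Psi> :: "(nat \<Rightarrow> 'y \<times> (int \<times> int) \<times> 'y \<Rightarrow> complex) set \<Rightarrow> complex \<Rightarrow> complex" where
  "\<Psi> P z = (if cmod z = 1 then lim (\<lambda>n. E z ((SOME u. u \<in> P) n)) else 0)"

lemma E_ops:
  assumes "f \<in> vcarrier \<A>"
  shows "h \<in> vcarrier \<A> \<Longrightarrow> E z (vplus \<A> f h) = E z f + E z h"
    and "E z (vscale \<A> t f) = t * E z f"
    and "h \<in> vcarrier \<A> \<Longrightarrow> E z (vminus \<A> f h) = E z f - E z h"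
    and "cmod z = 1 \<Longrightarrow> E z (astar \<A> f) = cnj (E z f)"
    and "cmod z = 1 \<Longrightarrow> cmod (E z f) \<le> \<rho> f"
    and "cmod z = 1 \<Longrightarrow> h \<in> corner y0 \<Longrightarrow> E z (amult \<A> f h) = E z f * E z h"
proof -
  show E1: "E z (vplus \<A> f h) = E z f + E z h" if "h \<in> vcarrier \<A>" for h
    using assms that by (simp add: E_def fourier_add)
  show E2: "E z (vscale \<A> t f) = t * E z f" for t f by (simp add: E_def fourier_scale)
  show "E z (vminus \<A> f h) = E z f - E z h" if "h \<in> vcarrier \<A>"
    unfolding vminus_def E1[OF conv.vscale_closed[OF that]] E2 by simp
  show "E z (astar \<A> f) = cnj (E z f)" if "cmod z = 1"
    using assms that by (simp add: E_def fourier_star madj_def)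
  show "cmod (E z f) \<le> \<rho> f" if "cmod z = 1"
    using assms that by (simp add: E_def norm_fourier_le_universal)
  show "E z (amult \<A> f h) = E z f * E z h" if "cmod z = 1" "h \<in> corner y0"
    using assms that unfolding E_def by (intro fourier_corner_amult) auto
qed

text \<open>\<open>E z\<close> is linear and bounded by the universal seminorm, so it maps Cauchy
  sequences to convergent ones and equivalent sequences to the same limit. Any representative can
  thus replace the one chosen by \<open>SOME\<close>.\<close>

lemma \<Psi>_LIMSEQ:
  assumes u: "u \<in> U.CS" and z: "cmod z = 1"
  shows "(\<lambda>n. E z (u n)) \<longlonglongrightarrow> \<Psi> (U.cls u) z"
proof -
  have conv: "convergent (\<lambda>n. E z (v n))" if v: "v \<in> U.CS" for v
  proof (rule Cauchy_convergent, rule metric_CauchyI)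
    fix e :: real assume "e > 0"
    then obtain N where N: "\<And>m n. m \<ge> N \<Longrightarrow> n \<ge> N \<Longrightarrow> \<rho> (vminus \<A> (v m) (v n)) < e"
      using U.CS_E[OF v] by blast
    have "dist (E z (v m)) (E z (v n)) < e" if "m \<ge> N" "n \<ge> N" for m n
    proof -
      have "E z (v m) - E z (v n) = E z (vminus \<A> (v m) (v n))"
        by (rule E_ops(3)[symmetric]) (use v in auto)
      then show ?thesis
        using E_ops(5)[OF conv.vminus_closed[OF U.CS_carrier U.CS_carrier] z, OF v v, of m n] N[OF that]
        by (simp add: dist_norm)
    qed
    then show "\<exists>M. \<forall>m\<ge>M. \<forall>n\<ge>M. dist (E z (v m)) (E z (v n)) < e" by blast
  qed
  define v where "v = (SOME v. v \<in> U.cls u)"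
  have "v \<in> U.cls u" using U.self_mem_cls[OF u] unfolding v_def by (rule someI[of "\<lambda>v. v \<in> U.cls u"])
  then have v: "v \<in> U.CS" "(\<lambda>n. \<rho> (vminus \<A> (u n) (v n))) \<longlonglongrightarrow> 0" using U.mem_cls_iff[OF u] by auto
  have "(\<lambda>n. E z (v n)) \<longlonglongrightarrow> \<Psi> (U.cls u) z"
    using conv[OF v(1)] z by (simp add: \<Psi>_def v_def convergent_LIMSEQ_iff)
  moreover have "(\<lambda>n. E z (u n) - E z (v n)) \<longlonglongrightarrow> 0"
  proof (rule Lim_null_comparison[OF _ v(2)], rule always_eventually, rule allI)
    fix n
    have "E z (u n) - E z (v n) = E z (vminus \<A> (u n) (v n))"
      by (rule E_ops(3)[symmetric]) (use u v in auto)
    then show "norm (E z (u n) - E z (v n)) \<le> \<rho> (vminus \<A> (u n) (v n))"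
      using E_ops(5)[OF conv.vminus_closed[OF U.CS_carrier U.CS_carrier] z, OF u v(1), of n n] by simp
  qed
  ultimately show ?thesis using tendsto_add by fastforce
qed

lemma \<Psi>_off: "cmod z \<noteq> 1 \<Longrightarrow> \<Psi> P z = 0"
  by (simp add: \<Psi>_def)

lemma \<Psi>_eqI:
  assumes "u \<in> U.CS" "\<And>z. cmod z = 1 \<Longrightarrow> (\<lambda>n. E z (u n)) \<longlonglongrightarrow> f z" "\<And>z. cmod z \<noteq> 1 \<Longrightarrow> f z = 0"
  shows "\<Psi> (U.cls u) = f"
proof
  fix z show "\<Psi> (U.cls u) z = f z"
    using LIMSEQ_unique[OF \<Psi>_LIMSEQ[OF assms(1)] assms(2)] assms(3) \<Psi>_off by (cases "cmod z = 1") auto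
qed

lemma \<Psi>_const: "f \<in> vcarrier \<A> \<Longrightarrow> cmod z = 1 \<Longrightarrow> \<Psi> (U.cls (\<lambda>n. f)) z = E z f"
  using LIMSEQ_unique[OF \<Psi>_LIMSEQ[OF U.const_CS] tendsto_const] by blast

lemma \<Psi>_vplus:
  "u \<in> U.CS \<Longrightarrow> v \<in> U.CS \<Longrightarrow> \<Psi> (vplus U.\<C> (U.cls u) (U.cls v)) = (\<lambda>z. \<Psi> (U.cls u) z + \<Psi> (U.cls v) z)"
  unfolding U.vplus_completion
proof (rule \<Psi>_eqI)
  fix z :: complex assume uv: "u \<in> U.CS" "v \<in> U.CS" and z: "cmod z = 1"
  have "E z (vplus \<A> (u n) (v n)) = E z (u n) + E z (v n)" for n
    by (rule E_ops) (use uv in auto)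
  then show "(\<lambda>n. E z (vplus \<A> (u n) (v n))) \<longlonglongrightarrow> \<Psi> (U.cls u) z + \<Psi> (U.cls v) z"
    using tendsto_add[OF \<Psi>_LIMSEQ[OF uv(1) z] \<Psi>_LIMSEQ[OF uv(2) z]] by presburger
qed (auto simp: \<Psi>_off simp del: conv_simps)

lemma \<Psi>_vscale:
  "u \<in> U.CS \<Longrightarrow> \<Psi> (vscale U.\<C> t (U.cls u)) = (\<lambda>z. t * \<Psi> (U.cls u) z)"
  unfolding U.vscale_completion
proof (rule \<Psi>_eqI)
  fix z :: complex assume uv: "u \<in> U.CS" and z: "cmod z = 1"
  have "E z (vscale \<A> t (u n)) = t * E z (u n)" for n
    by (rule E_ops) (use uv in auto)
  then show "(\<lambda>n. E z (vscale \<A> t (u n))) \<longlonglongrightarrow> t * \<Psi> (U.cls u) z"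
    using tendsto_mult_left[OF \<Psi>_LIMSEQ[OF uv(1) z]] by presburger
qed (auto simp: \<Psi>_off simp del: conv_simps)

lemma \<Psi>_vminus:
  "u \<in> U.CS \<Longrightarrow> v \<in> U.CS \<Longrightarrow> \<Psi> (vminus U.\<C> (U.cls u) (U.cls v)) = (\<lambda>z. \<Psi> (U.cls u) z - \<Psi> (U.cls v) z)"
proof -
  assume uv: "u \<in> U.CS" "v \<in> U.CS"
  have "vscale U.\<C> (-1) (U.cls v) = U.cls (\<lambda>n. vscale \<A> (-1) (v n))" by (rule U.vscale_completion[OF uv(2)])
  then show ?thesis
    unfolding vminus_def using \<Psi>_vplus[OF uv(1) U.CS_vscale[OF uv(2), of "-1"]] \<Psi>_vscale[OF uv(2), of "-1"]
    by (simp del: conv_simps)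
qed

lemma \<Psi>_astar:
  "u \<in> U.CS \<Longrightarrow> \<Psi> (astar U.\<C> (U.cls u)) = (\<lambda>z. cnj (\<Psi> (U.cls u) z))"
  unfolding U.astar_completion
proof (rule \<Psi>_eqI)
  fix z :: complex assume uv: "u \<in> U.CS" and z: "cmod z = 1"
  have "E z (astar \<A> (u n)) = cnj (E z (u n))" for n
    by (rule E_ops) (use uv z in auto)
  then show "(\<lambda>n. E z (astar \<A> (u n))) \<longlonglongrightarrow> cnj (\<Psi> (U.cls u) z)"
    using tendsto_cnj[OF \<Psi>_LIMSEQ[OF uv(1) z]] by presburger
qed (auto simp: \<Psi>_off simp del: conv_simps)

lemma \<Psi>_amult:
  assumes uv: "u \<in> U.CS" "v \<in> U.CS" and "\<And>n. v n \<in> corner y0"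
  shows "\<Psi> (amult U.\<C> (U.cls u) (U.cls v)) = (\<lambda>z. \<Psi> (U.cls u) z * \<Psi> (U.cls v) z)"
  unfolding U.amult_completion[OF uv]
proof (rule \<Psi>_eqI)
  fix z :: complex assume z: "cmod z = 1"
  have "E z (amult \<A> (u n) (v n)) = E z (u n) * E z (v n)" for n
    by (rule E_ops) (use uv z assms in auto)
  then show "(\<lambda>n. E z (amult \<A> (u n) (v n))) \<longlonglongrightarrow> \<Psi> (U.cls u) z * \<Psi> (U.cls v) z"
    using tendsto_mult[OF \<Psi>_LIMSEQ[OF uv(1) z] \<Psi>_LIMSEQ[OF uv(2) z]] by presburger
qed (use uv in \<open>auto simp: \<Psi>_off simp del: conv_simps\<close>)

lemma norm_\<Psi>_le:
  assumes "u \<in> U.CS" "cmod z = 1" shows "cmod (\<Psi> (U.cls u) z) \<le> anorm U.\<C> (U.cls u)"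
proof (rule LIMSEQ_le)
  show "(\<lambda>n. cmod (E z (u n))) \<longlonglongrightarrow> cmod (\<Psi> (U.cls u) z)" by (intro tendsto_norm \<Psi>_LIMSEQ assms)
  show "(\<lambda>n. \<rho> (u n)) \<longlonglongrightarrow> anorm U.\<C> (U.cls u)" by (rule U.anorm_completion[OF assms(1)])
  show "\<exists>N. \<forall>n\<ge>N. cmod (E z (u n)) \<le> \<rho> (u n)" using E_ops(5) assms by auto
qed

text \<open>The bound is independent of \<open>z\<close>; therefore the Laurent polynomials
  \<open>E z (u n)\<close> converge uniformly on the circle and their limit is continuous.\<close>

lemma norm_E_minus_\<Psi>_le:
  assumes u: "u \<in> U.CS" and z: "cmod z = 1"
  shows "cmod (E z (u n) - \<Psi> (U.cls u) z) \<le> anorm U.\<C> (vminus U.\<C> (U.cls u) (U.cls (\<lambda>_. u n)))"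
proof -
  have un: "u n \<in> vcarrier \<A>" using u by simp
  have "\<Psi> (U.cls u) z - E z (u n) = \<Psi> (vminus U.\<C> (U.cls u) (U.cls (\<lambda>_. u n))) z"
    by (simp only: \<Psi>_vminus[OF u U.const_CS[OF un]] \<Psi>_const[OF un z])
  also have "cmod \<dots> \<le> anorm U.\<C> (vminus U.\<C> (U.cls u) (U.cls (\<lambda>_. u n)))"
    unfolding U.vminus_completion[OF u U.const_CS[OF un]]
    by (rule norm_\<Psi>_le[OF U.CS_vminus[OF u U.const_CS[OF un]] z])
  finally show ?thesis by (simp add: norm_minus_commute)
qed

lemma \<Psi>_circle:
  assumes u: "u \<in> U.CS" shows "\<Psi> (U.cls u) \<in> vcarrier \<T>"
  unfolding circle_carrier_iff
proof (intro conjI)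
  have "uniform_limit (sphere 0 1) (\<lambda>n z. E z (u n)) (\<Psi> (U.cls u)) sequentially"
    unfolding uniform_limit_iff
  proof (intro allI impI)
    fix e :: real assume "e > 0"
    with U.cls_dense[OF u] have "eventually (\<lambda>n. anorm U.\<C> (vminus U.\<C> (U.cls u) (U.cls (\<lambda>_. u n))) < e) sequentially"
      by (rule order_tendstoD)
    then show "eventually (\<lambda>n. \<forall>z\<in>sphere 0 1. dist (E z (u n)) (\<Psi> (U.cls u) z) < e) sequentially"
      by eventually_elim (auto simp: dist_norm intro!: le_less_trans[OF norm_E_minus_\<Psi>_le[OF u]])
  qed
  moreover have "continuous_on (sphere 0 1) (\<lambda>z. E z (u n))" for n
    unfolding E_def fourier_def by (rule continuous_on_laurent)
  ultimately show "continuous_on (sphere 0 1) (\<Psi> (U.cls u))"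
    by (intro uniform_limit_theorem[where F = sequentially]) auto
qed (auto simp: \<Psi>_off)

text \<open>For the hard inequality, \<open>universal_seminorm_corner_le\<close> is applied to each
  term \<open>u n\<close>, with the norm of the limit function plus the distance from
  \<open>u n\<close> to its class as bound. This distance tends to 0.\<close>

lemma anorm_corner:
  assumes u: "u \<in> U.CS" and c: "\<And>n. u n \<in> corner y0"
  shows "anorm \<T> (\<Psi> (U.cls u)) = anorm U.\<C> (U.cls u)"
proof (rule antisym)
  show "anorm \<T> (\<Psi> (U.cls u)) \<le> anorm U.\<C> (U.cls u)"
    by (rule circle_norm_least) (rule norm_\<Psi>_le[OF u])
  let ?d = "\<lambda>n. anorm U.\<C> (vminus U.\<C> (U.cls u) (U.cls (\<lambda>_. u n)))"
  have "\<rho> (u n) \<le> anorm \<T> (\<Psi> (U.cls u)) + ?d n" for n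
  proof (rule universal_seminorm_corner_le[OF c])
    fix z :: complex assume z: "cmod z = 1"
    have "cmod (E z (u n)) \<le> cmod (\<Psi> (U.cls u) z) + cmod (E z (u n) - \<Psi> (U.cls u) z)"
      using norm_triangle_ineq[of "\<Psi> (U.cls u) z" "E z (u n) - \<Psi> (U.cls u) z"] by simp
    then show "cmod (fourier z (u n) y0 y0) \<le> anorm \<T> (\<Psi> (U.cls u)) + ?d n"
      using circle_norm_upper[OF \<Psi>_circle[OF u], of z] norm_E_minus_\<Psi>_le[OF u z, of n] by (simp add: E_def)
  qed
  moreover have "(\<lambda>n. anorm \<T> (\<Psi> (U.cls u)) + ?d n) \<longlonglongrightarrow> anorm \<T> (\<Psi> (U.cls u)) + 0"
    by (intro tendsto_intros U.cls_dense u)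
  ultimately show "anorm U.\<C> (U.cls u) \<le> anorm \<T> (\<Psi> (U.cls u))"
    using LIMSEQ_le[OF U.anorm_completion[OF u]] by fastforce
qed

lemma unit_carrier [simp]: "unit \<in> vcarrier \<A>"
  using y0_in by (simp add: unit_def)

lemma unit_star: "astar \<A> unit = unit"
  using y0_in by (simp add: unit_def astar_delta)

lemma unit_unit: "amult \<A> unit unit = unit"
  using y0_in by (simp add: unit_def amult_delta_delta)

lemma corner_unit: "f \<in> corner y0 \<Longrightarrow> amult \<A> unit f = f" "f \<in> corner y0 \<Longrightarrow> amult \<A> f unit = f"
proof -
  assume f: "f \<in> corner y0"
  note fc = corner_carrier[OF f]
  show "amult \<A> unit f = f"
  proof (rule carrier_ext)
    fix x j y show "amult \<A> unit f (arr x j y) = f (arr x j y)"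
      unfolding unit_def amult_delta_left[OF y0_in y0_in fc] using corner_arr[OF f, of x j y] by (metis diff_0_right)
  qed (use fc in auto)
  show "amult \<A> f unit = f"
  proof (rule carrier_ext)
    fix x j y show "amult \<A> f unit (arr x j y) = f (arr x j y)"
      unfolding unit_def amult_delta_right[OF y0_in y0_in fc] using corner_arr[OF f, of x j y] by (metis diff_0_right)
  qed (use fc in auto)
qed

lemma unit_corner: "f \<in> vcarrier \<A> \<Longrightarrow> amult \<A> unit (amult \<A> f unit) \<in> corner y0"
proof (rule cornerI)
  assume f: "f \<in> vcarrier \<A>"
  then show "amult \<A> unit (amult \<A> f unit) \<in> vcarrier \<A>" by auto
  fix x j y assume "amult \<A> unit (amult \<A> f unit) (arr x j y) \<noteq> 0"
  then show "x = y0 \<and> y = y0"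
    using f by (simp add: unit_def amult_delta_left[OF y0_in y0_in] amult_delta_right[OF y0_in y0_in] y0_in split: if_splits)
qed

definition proj :: "(nat \<Rightarrow> 'y \<times> (int \<times> int) \<times> 'y \<Rightarrow> complex) set" where
  "proj = U.cls (\<lambda>n. unit)"

abbreviation "left_ideal \<equiv> {P \<in> vcarrier U.\<C>. amult U.\<C> P proj = P}"
abbreviation "corner_completion \<equiv> {P \<in> vcarrier U.\<C>. amult U.\<C> proj P = P \<and> amult U.\<C> P proj = P}"

lemma unit_CS [simp]: "(\<lambda>n. unit) \<in> U.CS"
  by (rule U.const_CS) simp

lemma corner_cls:
  assumes u: "u \<in> U.CS" and c: "\<And>n. u n \<in> corner y0"
  shows "U.cls u \<in> vcarrier U.\<C> \<and> amult U.\<C> proj (U.cls u) = U.cls u \<and> amult U.\<C> (U.cls u) proj = U.cls u"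
  using u corner_unit[OF c] by (simp add: proj_def U.amult_completion del: conv_simps)

text \<open>Multiplying a representing sequence by \<open>unit\<close> on both sides leaves a class
  of the corner unchanged and moves every term into the algebraic corner.\<close>

lemma corner_completion_cases:
  assumes "P \<in> corner_completion"
  obtains u where "u \<in> U.CS" "\<And>n. u n \<in> corner y0" "P = U.cls u"
proof -
  obtain u where u: "u \<in> U.CS" "P = U.cls u" using assms U.completion_cases by blast
  define v where "v = (\<lambda>n. amult \<A> unit (amult \<A> (u n) unit))"
  have "P = amult U.\<C> proj (amult U.\<C> P proj)" using assms by simp
  also have "\<dots> = U.cls v"
    unfolding u(2) proj_def v_def using u(1) by (simp add: U.amult_completion U.CS_amult)
  finally have "P = U.cls v" .
  moreover have "v \<in> U.CS" using u(1) by (simp add: v_def U.CS_amult)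
  moreover have "v n \<in> corner y0" for n unfolding v_def by (rule unit_corner) (use u in simp)
  ultimately show ?thesis using that by blast
qed

text \<open>The inverse Fourier transform at the base point; \<open>snd (fst (snd g))\<close> reads
  off the integer \<open>j\<close> of \<open>arr y0 j y0\<close>.\<close>

definition of_coeffs :: "(int \<Rightarrow> complex) \<Rightarrow> 'y \<times> (int \<times> int) \<times> 'y \<Rightarrow> complex" where
  "of_coeffs c = (\<lambda>g. if g \<in> range (\<lambda>j. arr y0 j y0) then c (snd (fst (snd g))) else 0)"

lemma of_coeffs_arr: "of_coeffs c (arr x j y) = (if x = y0 \<and> y = y0 then c j else 0)"
  by (auto simp: of_coeffs_def) (simp add: arr_def)

lemma of_coeffs_corner: "finite {j. c j \<noteq> 0} \<Longrightarrow> of_coeffs c \<in> corner y0"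
proof (rule cornerI)
  assume fin: "finite {j. c j \<noteq> 0}"
  show "of_coeffs c \<in> vcarrier \<A>"
  proof (rule carrierI)
    show "finite ((\<lambda>j. arr y0 j y0) ` {j. c j \<noteq> 0})" using fin by simp
    fix g assume g: "of_coeffs c g \<noteq> 0"
    then obtain j where j: "g = arr y0 j y0" by (auto simp: of_coeffs_def split: if_splits)
    with g show "g \<in> (\<lambda>j. arr y0 j y0) ` {j. c j \<noteq> 0} \<and> g \<in> arrows G" using y0_in by (simp add: of_coeffs_arr)
  qed
qed (simp add: of_coeffs_arr split: if_splits)

lemma E_of_coeffs: "E z (of_coeffs c) = laurent c z"
  by (simp add: E_def fourier_def of_coeffs_arr)

text \<open>Laurent approximations of \<open>f\<close> are uniformly Cauchy on the circle. On the
  corner the supremum norm dominates the universal seminorm, so their coefficients define a Cauchy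
  sequence there.\<close>

lemma \<Psi>_surj:
  assumes f: "f \<in> vcarrier \<T>"
  obtains u where "u \<in> U.CS" "\<And>n. u n \<in> corner y0" "\<Psi> (U.cls u) = f"
proof -
  have "\<exists>c. finite {j. c j \<noteq> 0} \<and> (\<forall>z. cmod z = 1 \<longrightarrow> cmod (f z - laurent c z) < 1 / Suc n)" for n
    by (rule laurent_dense) (use f in \<open>auto simp: circle_carrier_iff\<close>)
  then obtain c where c: "\<And>n. finite {j. c n j \<noteq> 0}" "\<And>n z. cmod z = 1 \<Longrightarrow> cmod (f z - laurent (c n) z) < 1 / Suc n"
    by metis
  define u where "u = (\<lambda>n. of_coeffs (c n))"
  have uc: "u n \<in> corner y0" for n using of_coeffs_corner c(1) by (simp add: u_def)
  have uA: "u n \<in> vcarrier \<A>" for n by (rule corner_carrier[OF uc])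
  have Eu: "cmod (E z (u n) - f z) < 1 / Suc n" if "cmod z = 1" for z n
    using c(2)[OF that, of n] by (simp add: u_def E_of_coeffs norm_minus_commute)
  have u: "u \<in> U.CS"
  proof (rule U.CS_I[OF uA])
    fix e :: real assume "e > 0"
    then obtain N where N: "1 / Suc N < e / 2" using nat_approx_posE[of "e / 2"] by auto
    show "\<exists>N. \<forall>m\<ge>N. \<forall>n\<ge>N. \<rho> (vminus \<A> (u m) (u n)) < e"
    proof (intro exI allI impI)
      fix m n assume mn: "m \<ge> N" "n \<ge> N"
      have "\<rho> (vminus \<A> (u m) (u n)) \<le> 1 / Suc m + 1 / Suc n"
      proof (rule universal_seminorm_corner_le)
        show "vminus \<A> (u m) (u n) \<in> corner y0"
        proof (rule cornerI)
          fix y j w assume "vminus \<A> (u m) (u n) (arr y j w) \<noteq> 0"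
          then show "y = y0 \<and> w = y0" by (simp add: vminus_def u_def of_coeffs_arr split: if_splits)
        qed (use uA in auto)
        fix z :: complex assume z: "cmod z = 1"
        have "fourier z (vminus \<A> (u m) (u n)) y0 y0 = (E z (u m) - f z) - (E z (u n) - f z)"
          using E_ops(3)[OF uA uA, of z m n] by (simp add: E_def)
        then show "cmod (fourier z (vminus \<A> (u m) (u n)) y0 y0) \<le> 1 / Suc m + 1 / Suc n"
          using norm_triangle_ineq4[of "E z (u m) - f z" "E z (u n) - f z"] Eu[OF z, of m] Eu[OF z, of n] by simp
      qed
      also have "\<dots> \<le> 1 / Suc N + 1 / Suc N" using mn by (intro add_mono) (simp_all add: frac_le)
      also have "\<dots> < e" using N by simp
      finally show "\<rho> (vminus \<A> (u m) (u n)) < e" .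
    qed
  qed
  have "\<Psi> (U.cls u) = f"
  proof (rule \<Psi>_eqI[OF u])
    fix z :: complex assume z: "cmod z = 1"
    have "(\<lambda>n. E z (u n) - f z) \<longlonglongrightarrow> 0"
      by (rule Lim_null_comparison[OF _ LIMSEQ_Suc[OF lim_const_over_n[of 1]]])
        (use Eu[OF z] in \<open>auto intro!: always_eventually less_imp_le\<close>)
    then show "(\<lambda>n. E z (u n)) \<longlonglongrightarrow> f z" by (simp add: LIM_zero_iff)
  qed (use f in \<open>auto simp: circle_carrier_iff\<close>)
  then show ?thesis using that u uc by blast
qed

text \<open>Before the limit, the entry of \<open>u* u\<close> at the base point is the sum of the
  squared absolute values in column \<open>y0\<close> of the Fourier matrix. Nonnegative reals form
  a closed set.\<close>

lemma \<Psi>_positive: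
  assumes u: "u \<in> U.CS"
  shows "\<Psi> (amult U.\<C> (astar U.\<C> (U.cls u)) (U.cls u)) \<in> positive_elements \<T>"
proof (rule circle_positiveI)
  let ?w = "\<lambda>n. amult \<A> (astar \<A> (u n)) (u n)"
  have eq: "amult U.\<C> (astar U.\<C> (U.cls u)) (U.cls u) = U.cls ?w"
    using u by (simp add: U.CS_astar)
  have w: "?w \<in> U.CS" by (intro U.CS_amult U.CS_astar u)
  show "\<Psi> (amult U.\<C> (astar U.\<C> (U.cls u)) (U.cls u)) \<in> vcarrier \<T>"
    unfolding eq by (rule \<Psi>_circle[OF w])
  fix z :: complex assume z: "cmod z = 1"
  then have z0: "z \<noteq> 0" by auto
  have "E z (?w n) \<in> \<real>\<^sub>\<ge>\<^sub>0" for n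
  proof -
    have un: "u n \<in> vcarrier \<A>" using u by simp
    let ?m = "fourier z (u n)"
    have "E z (?w n) = (\<Sum>y | madj ?m y0 y \<noteq> 0. madj ?m y0 y * ?m y y0)"
      unfolding E_def fourier_amult[OF astar_carrier[OF un] un z0] fourier_star[OF un z] mprod_def ..
    also have "\<dots> = (\<Sum>y | madj ?m y0 y \<noteq> 0. of_real ((cmod (?m y y0))\<^sup>2))"
      by (rule sum.cong[OF refl]) (simp only: madj_def complex_norm_square mult.commute)
    also have "\<dots> = of_real (\<Sum>y | madj ?m y0 y \<noteq> 0. (cmod (?m y y0))\<^sup>2)" by simp
    finally show ?thesis by (simp only: nonneg_Reals_of_real_iff) (simp add: sum_nonneg)
  qed
  then have "\<Psi> (U.cls ?w) z \<in> \<real>\<^sub>\<ge>\<^sub>0"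
    by (intro Lim_in_closed_set[OF closed_nonneg_Reals_complex _ _ \<Psi>_LIMSEQ[OF w z]]) auto
  then show "\<exists>r\<ge>0. \<Psi> (amult U.\<C> (astar U.\<C> (U.cls u)) (U.cls u)) z = of_real r"
    unfolding eq by (elim nonneg_Reals_cases) blast
qed

text \<open>Transitivity makes the corner full: the point mass at \<open>arr x j y\<close> is the
  one at \<open>arr x j y0\<close> times the adjoint of the one at \<open>arr y 0 y0\<close>, and
  both of these lie in the left ideal.\<close>

lemma const_in_hull:
  assumes f: "f \<in> vcarrier \<A>"
  shows "U.cls (\<lambda>n. f) \<in> vsubspace U.\<C> hull
    {amult U.\<C> x (astar U.\<C> y) |x y. x \<in> left_ideal \<and> y \<in> left_ideal}"
    (is "_ \<in> _ hull ?S")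
  unfolding hull_def
proof (intro InterI, elim CollectE conjE)
  fix T assume T: "vsubspace U.\<C> T" and S: "?S \<subseteq> T"
  show "U.cls (\<lambda>n. f) \<in> T" using f
  proof (induction f rule: carrier_induct)
    case zero
    have "vzero U.\<C> = U.cls (\<lambda>n. \<lambda>g. 0)" by (simp add: U.vzero_completion)
    then show ?case using T by (simp add: vsubspace_def)
  next
    case (add g t h)
    obtain x j y where g: "g = arr x j y" "x \<in> Y" "y \<in> Y" using add.hyps(1) by (rule arrows_cases)
    let ?a = "delta (arr x j y0)" and ?b = "delta (arr y 0 y0)"
    have ab: "?a \<in> vcarrier \<A>" "?b \<in> vcarrier \<A>" using g y0_in by auto
    have "amult \<A> ?a unit = ?a" "amult \<A> ?b unit = ?b"
      using g y0_in by (simp_all add: unit_def amult_delta_delta)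
    then have "U.cls (\<lambda>n. ?a) \<in> left_ideal"
        "U.cls (\<lambda>n. ?b) \<in> left_ideal"
      using ab by (simp_all add: proj_def U.const_CS)
    then have "amult U.\<C> (U.cls (\<lambda>n. ?a)) (astar U.\<C> (U.cls (\<lambda>n. ?b))) \<in> T" using S by blast
    also have "amult U.\<C> (U.cls (\<lambda>n. ?a)) (astar U.\<C> (U.cls (\<lambda>n. ?b))) = U.cls (\<lambda>n. delta g)"
      using ab g y0_in by (simp add: U.const_CS astar_delta amult_delta_delta)
    finally have "vplus U.\<C> (vscale U.\<C> t (U.cls (\<lambda>n. delta g))) (U.cls (\<lambda>n. h)) \<in> T"
      using T add.IH by (simp add: vsubspace_def)
    also have "vplus U.\<C> (vscale U.\<C> t (U.cls (\<lambda>n. delta g))) (U.cls (\<lambda>n. h)) = U.cls (\<lambda>n g'. t * delta g g' + h g')"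
      using add.hyps by (simp add: U.const_CS)
    finally show ?case .
  qed
qed

theorem morita_equivalent_groupoid_cstar: "morita_equivalent (groupoid_cstar G) \<T>"
proof -
  have eq: "groupoid_cstar G = U.\<C>" by (simp add: groupoid_cstar_def Let_def)
  have pC: "proj \<in> vcarrier U.\<C>" by (simp add: proj_def)
  interpret C: cstar_algebra U.\<C> by (rule U.cstar_algebra_completion)
  show ?thesis unfolding eq
  proof (rule morita_equivalent_corner[where p = proj and \<psi> = \<Psi>])
    show "cstar_algebra U.\<C>" by (rule U.cstar_algebra_completion)
    show "cstar_algebra \<T>" by (rule cstar_algebra_circle)
    show "proj \<in> vcarrier U.\<C>" by fact
    show "astar U.\<C> proj = proj" by (simp add: proj_def unit_star)
    show "amult U.\<C> proj proj = proj" by (simp add: proj_def unit_unit)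
    fix P assume P: "P \<in> corner_completion"
    then obtain u where u: "u \<in> U.CS" "\<And>n. u n \<in> corner y0" "P = U.cls u" using corner_completion_cases by blast
    show "\<Psi> (vscale U.\<C> t P) = vscale \<T> t (\<Psi> P)" for t using u(1) by (simp add: u(3) \<Psi>_vscale del: U.vscale_completion)
    show "\<Psi> (astar U.\<C> P) = astar \<T> (\<Psi> P)" using u(1) by (simp add: u(3) \<Psi>_astar del: U.astar_completion)
    show "anorm \<T> (\<Psi> P) = anorm U.\<C> P" using u by (simp add: anorm_corner)
    fix Q assume Q: "Q \<in> corner_completion"
    then obtain v where v: "v \<in> U.CS" "\<And>n. v n \<in> corner y0" "Q = U.cls v" using corner_completion_cases by blast
    show "\<Psi> (vplus U.\<C> P Q) = vplus \<T> (\<Psi> P) (\<Psi> Q)"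
      using u(1) v(1) by (simp add: u(3) v(3) \<Psi>_vplus del: U.vplus_completion)
    show "\<Psi> (amult U.\<C> P Q) = amult \<T> (\<Psi> P) (\<Psi> Q)"
      using u v by (simp add: \<Psi>_amult del: U.amult_completion)
  next
    show "bij_betw \<Psi> corner_completion (vcarrier \<T>)"
    proof (rule bij_betw_imageI)
      show "inj_on \<Psi> corner_completion"
      proof (rule inj_onI)
        fix P Q assume P: "P \<in> corner_completion" and Q: "Q \<in> corner_completion" and PQ: "\<Psi> P = \<Psi> Q"
        obtain u where u: "u \<in> U.CS" "\<And>n. u n \<in> corner y0" "P = U.cls u" using P corner_completion_cases by blast
        obtain v where v: "v \<in> U.CS" "\<And>n. v n \<in> corner y0" "Q = U.cls v" using Q corner_completion_cases by blast
        \<comment> \<open>Injectivity comes from isometry, which is available only on the corner;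
          hence the check that the difference stays there.\<close>
        have "vminus U.\<C> P Q \<in> corner_completion"
          using P Q pC by (simp add: C.amult_vminus_left C.amult_vminus_right)
        then obtain w where w: "w \<in> U.CS" "\<And>n. w n \<in> corner y0" "vminus U.\<C> P Q = U.cls w"
          using corner_completion_cases by blast
        have "\<Psi> (vminus U.\<C> P Q) = (\<lambda>z. 0)"
          using PQ unfolding u(3) v(3) \<Psi>_vminus[OF u(1) v(1)] by simp
        moreover have "anorm \<T> (\<lambda>z. 0) = 0"
          by (simp add: anorm_circle)
        ultimately have "anorm U.\<C> (vminus U.\<C> P Q) = 0" using anorm_corner[OF w(1,2)] w(3) by simp
        then have "vminus U.\<C> P Q = vzero U.\<C>" using P Q by (intro C.anorm_eq_0) auto
        then show "P = Q" using P Q C.vminus_eq_0 by blast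
      qed
      show "\<Psi> ` corner_completion = vcarrier \<T>"
      proof (intro equalityI subsetI)
        fix f assume "f \<in> \<Psi> ` corner_completion"
        then obtain P where P: "P \<in> vcarrier U.\<C>" "f = \<Psi> P" by blast
        then obtain u where "u \<in> U.CS" "P = U.cls u" using U.completion_cases by blast
        then show "f \<in> vcarrier \<T>" using P(2) \<Psi>_circle by blast
      next
        fix f assume "f \<in> vcarrier \<T>"
        then obtain u where u: "u \<in> U.CS" "\<And>n. u n \<in> corner y0" "\<Psi> (U.cls u) = f" using \<Psi>_surj by blast
        then show "f \<in> \<Psi> ` corner_completion" using corner_cls[OF u(1,2)] by blast
      qed
    qed
    fix P assume "P \<in> left_ideal"
    then obtain u where "u \<in> U.CS" "P = U.cls u" using U.completion_cases by blast
    then show "\<Psi> (amult U.\<C> (astar U.\<C> P) P) \<in> positive_elements \<T>" using \<Psi>_positive by blast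
  next
    show "dense_span U.\<C> {amult U.\<C> x (astar U.\<C> y) |x y.
        x \<in> left_ideal \<and> y \<in> left_ideal}"
    proof (rule dense_spanI[OF U.cstar_algebra_completion])
      fix P and \<epsilon> :: real assume "P \<in> vcarrier U.\<C>" "0 < \<epsilon>"
      then obtain u where u: "u \<in> U.CS" "P = U.cls u" using U.completion_cases by blast
      have "eventually (\<lambda>n. anorm U.\<C> (vminus U.\<C> (U.cls u) (U.cls (\<lambda>k. u n))) < \<epsilon>) sequentially"
        using U.cls_dense[OF u(1)] \<open>0 < \<epsilon>\<close> by (rule order_tendstoD)
      then obtain n where n: "anorm U.\<C> (vminus U.\<C> P (U.cls (\<lambda>k. u n))) < \<epsilon>"
        unfolding u(2) eventually_sequentially by blast
      have un: "u n \<in> vcarrier \<A>" using u(1) by simp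
      show "\<exists>b\<in>vcarrier U.\<C> \<inter> (vsubspace U.\<C> hull {amult U.\<C> x (astar U.\<C> y) |x y.
          x \<in> left_ideal \<and> y \<in> left_ideal}).
          anorm U.\<C> (vminus U.\<C> P b) < \<epsilon>"
        using const_in_hull[OF un] n U.cls_carrier[OF U.const_CS[OF un]] by blast
    qed
  qed
qed

end

section \<open>Graded 2-graphs with a tail\<close>

context two_graph
begin

lemma factor_unique:
  assumes "m \<in> mor \<Lambda>" "n \<in> mor \<Lambda>" "src \<Lambda> m = rng \<Lambda> n" "m' \<in> mor \<Lambda>" "n' \<in> mor \<Lambda>" "src \<Lambda> m' = rng \<Lambda> n'"
    and "cmp \<Lambda> m n = cmp \<Lambda> m' n'" "deg \<Lambda> m = deg \<Lambda> m'" "deg \<Lambda> n = deg \<Lambda> n'"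
  shows "m = m' \<and> n = n'"
proof -
  have "\<exists>!(a, b). a \<in> mor \<Lambda> \<and> b \<in> mor \<Lambda> \<and> src \<Lambda> a = rng \<Lambda> b \<and> cmp \<Lambda> m n = cmp \<Lambda> a b
      \<and> deg \<Lambda> a = deg \<Lambda> m \<and> deg \<Lambda> b = deg \<Lambda> n"
    by (rule factorization) (use assms in \<open>simp_all add: cmp_mor deg_cmp\<close>)
  then obtain q where "\<And>p. (case p of (a, b) \<Rightarrow> a \<in> mor \<Lambda> \<and> b \<in> mor \<Lambda> \<and> src \<Lambda> a = rng \<Lambda> b \<and> cmp \<Lambda> m n = cmp \<Lambda> a b
      \<and> deg \<Lambda> a = deg \<Lambda> m \<and> deg \<Lambda> b = deg \<Lambda> n) \<Longrightarrow> p = q" by (metis (no_types, lifting))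
  from this[of "(m, n)"] this[of "(m', n')"] show ?thesis using assms by simp
qed

lemma factor_exists:
  assumes "l \<in> mor \<Lambda>" "deg \<Lambda> l = p + q"
  obtains m n where "m \<in> mor \<Lambda>" "n \<in> mor \<Lambda>" "src \<Lambda> m = rng \<Lambda> n" "l = cmp \<Lambda> m n" "deg \<Lambda> m = p" "deg \<Lambda> n = q"
  using factorization[OF assms] by (auto elim!: ex1E)

text \<open>Composition with the identities at either end gives two factorisations of
  \<open>l\<close> into parts of degree 0; uniqueness identifies them.\<close>

lemma identity_if_deg_0: "l \<in> mor \<Lambda> \<Longrightarrow> deg \<Lambda> l = 0 \<Longrightarrow> src \<Lambda> l = l \<and> rng \<Lambda> l = l"
  using factor_unique[of "rng \<Lambda> l" l l "src \<Lambda> l"]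
  by (simp add: rng_mor src_mor src_rng rng_src cmp_rng cmp_src deg_rng deg_src)

text \<open>The factorisation property splits off an edge at the range end, blue if possible. The
  total degree of the rest is smaller, which allows induction on length.\<close>

lemma last_edge_cases:
  assumes "l \<in> mor \<Lambda>"
  obtains (identity) "deg \<Lambda> l = 0" "rng \<Lambda> l = src \<Lambda> l"
    | (edge) f k where "f \<in> blue_edges \<Lambda> \<union> red_edges \<Lambda>" "f \<in> mor \<Lambda>" "k \<in> mor \<Lambda>" "src \<Lambda> f = rng \<Lambda> k"
      "l = cmp \<Lambda> f k" "deg \<Lambda> l = deg \<Lambda> f + deg \<Lambda> k"
      "fst (deg \<Lambda> k) + snd (deg \<Lambda> k) < fst (deg \<Lambda> l) + snd (deg \<Lambda> l)"
proof -
  obtain a b where ab: "deg \<Lambda> l = (a, b)" by (cases "deg \<Lambda> l")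
  have edge': thesis if "deg \<Lambda> l = d + q" "d = (1, 0) \<or> d = (0, 1)" for d q
  proof -
    from factor_exists[OF assms that(1)] obtain f k where fk: "f \<in> mor \<Lambda>" "k \<in> mor \<Lambda>" "src \<Lambda> f = rng \<Lambda> k"
      "l = cmp \<Lambda> f k" "deg \<Lambda> f = d" "deg \<Lambda> k = q" by blast
    have "fst d + snd d = 1" using that(2) by auto
    then show thesis using edge[of f k] fk that by (auto simp: blue_edges_def red_edges_def)
  qed
  consider "a = 0" "b = 0" | a' where "a = Suc a'" | b' where "b = Suc b'" by (cases a; cases b) auto
  then show ?thesis
  proof cases
    case 1
    then show ?thesis using identity ab identity_if_deg_0[OF assms] by (simp add: zero_prod_def)
  next
    case 2
    then show ?thesis using edge'[of "(1, 0)" "(a', b)"] ab by simp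
  next
    case 3
    then show ?thesis using edge'[of "(0, 1)" "(a, b')"] ab by simp
  qed
qed

end

text \<open>Infinite paths run from source to range here, so levels increase along them and the
  edges that matter in the tail are those with source \<open>v n\<close>.\<close>

locale tail_graded_two_graph = two_graph \<Lambda> for \<Lambda> :: "('a, 'm) two_graph_scheme" +
  fixes V :: "int \<Rightarrow> 'a set" and N :: int and v :: "int \<Rightarrow> 'a"
  assumes vertices_eq: "vertices \<Lambda> = (\<Union>n. V n)"
    and disjoint: "disjoint_family V"
    and blue_level: "f \<in> blue_edges \<Lambda> \<Longrightarrow> \<exists>n. src \<Lambda> f \<in> V n \<and> rng \<Lambda> f \<in> V (n + 1)"
    and red_level: "f \<in> red_edges \<Lambda> \<Longrightarrow> \<exists>n. src \<Lambda> f \<in> V n \<and> rng \<Lambda> f \<in> V n"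
    and tail_vertex: "N \<le> n \<Longrightarrow> V n = {v n}"
    and tail_blue: "N \<le> n \<Longrightarrow> \<exists>!f. f \<in> blue_edges \<Lambda> \<and> src \<Lambda> f = v n"
    and tail_red: "N \<le> n \<Longrightarrow> \<exists>!f. f \<in> red_edges \<Lambda> \<and> src \<Lambda> f = v n"
begin

lemma V_unique: "w \<in> V m \<Longrightarrow> w \<in> V n \<Longrightarrow> m = n"
  using disjoint by (auto simp: disjoint_family_on_def)

lemma edge_level:
  assumes "f \<in> blue_edges \<Lambda> \<union> red_edges \<Lambda>" "src \<Lambda> f \<in> V n" shows "rng \<Lambda> f \<in> V (n + int (fst (deg \<Lambda> f)))"
  using assms(1)
proof
  assume f: "f \<in> blue_edges \<Lambda>"
  then obtain m where "src \<Lambda> f \<in> V m" "rng \<Lambda> f \<in> V (m + 1)" using blue_level by blast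
  then show ?thesis using V_unique[OF assms(2)] f by (simp add: blue_edges_def)
next
  assume f: "f \<in> red_edges \<Lambda>"
  then obtain m where "src \<Lambda> f \<in> V m" "rng \<Lambda> f \<in> V m" using red_level by blast
  then show ?thesis using V_unique[OF assms(2)] f by (simp add: red_edges_def)
qed

text \<open>Blue edges raise the level by one and red edges keep it, so the first coordinate of the
  degree counts the levels climbed.\<close>

lemma rng_level:
  "l \<in> mor \<Lambda> \<Longrightarrow> src \<Lambda> l \<in> V n \<Longrightarrow> rng \<Lambda> l \<in> V (n + int (fst (deg \<Lambda> l)))"
proof (induction "fst (deg \<Lambda> l) + snd (deg \<Lambda> l)" arbitrary: l rule: less_induct)
  case less
  from less.prems(1) show ?case
  proof (cases rule: last_edge_cases)
    case identity
    then show ?thesis using less.prems by simp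
  next
    case (edge f k)
    have "src \<Lambda> k \<in> V n" using less.prems(2) src_cmp[OF edge(2-4)] edge(5) by simp
    then have "src \<Lambda> f \<in> V (n + int (fst (deg \<Lambda> k)))"
      unfolding edge(4) by (rule less.hyps[OF edge(7,3)])
    from edge_level[OF edge(1) this] show ?thesis
      using rng_cmp[OF edge(2-4)] edge(5,6) by (simp add: algebra_simps)
  qed
qed

lemma tail_rng: "\<lbrakk>N \<le> n; l \<in> mor \<Lambda>; src \<Lambda> l = v n\<rbrakk> \<Longrightarrow> rng \<Lambda> l = v (n + int (fst (deg \<Lambda> l)))"
  using rng_level[of l n] tail_vertex[of n] tail_vertex[of "n + int (fst (deg \<Lambda> l))"] by simp

lemma tail_mor: "N \<le> n \<Longrightarrow> v n \<in> mor \<Lambda> \<and> deg \<Lambda> (v n) = 0"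
  using vertices_eq tail_vertex[of n] by (force simp: vertices_def)

lemma tail_edge_unique:
  assumes "N \<le> n" "f \<in> blue_edges \<Lambda> \<union> red_edges \<Lambda>" "f' \<in> mor \<Lambda>" "src \<Lambda> f = v n" "src \<Lambda> f' = v n" "deg \<Lambda> f = deg \<Lambda> f'"
  shows "f = f'"
  using assms(2)
proof
  assume "f \<in> blue_edges \<Lambda>"
  then have "f' \<in> blue_edges \<Lambda>" using assms(3,6) by (simp add: blue_edges_def)
  then show ?thesis using tail_blue[OF assms(1)] \<open>f \<in> blue_edges \<Lambda>\<close> assms(4,5) by blast
next
  assume "f \<in> red_edges \<Lambda>"
  then have "f' \<in> red_edges \<Lambda>" using assms(3,6) by (simp add: red_edges_def)
  then show ?thesis using tail_red[OF assms(1)] \<open>f \<in> red_edges \<Lambda>\<close> assms(4,5) by blast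
qed

text \<open>Factor both paths with the same degrees. The initial parts agree by induction, so the
  two last edges have the same colour and leave the same tail vertex.\<close>

lemma tail_path_unique:
  "\<lbrakk>N \<le> n; l \<in> mor \<Lambda>; src \<Lambda> l = v n; l' \<in> mor \<Lambda>; src \<Lambda> l' = v n; deg \<Lambda> l = deg \<Lambda> l'\<rbrakk> \<Longrightarrow> l = l'"
proof (induction "fst (deg \<Lambda> l) + snd (deg \<Lambda> l)" arbitrary: l l' rule: less_induct)
  case less
  from less.prems(2) show ?case
  proof (cases rule: last_edge_cases)
    case identity
    then show ?thesis using less.prems identity_if_deg_0 by metis
  next
    case (edge f k)
    have d: "deg \<Lambda> l' = deg \<Lambda> f + deg \<Lambda> k" using edge(6) less.prems(6) by simp
    obtain f' k' where l': "f' \<in> mor \<Lambda>" "k' \<in> mor \<Lambda>" "src \<Lambda> f' = rng \<Lambda> k'" "l' = cmp \<Lambda> f' k'"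
        "deg \<Lambda> f' = deg \<Lambda> f" "deg \<Lambda> k' = deg \<Lambda> k"
      by (rule factor_exists[OF less.prems(4) d])
    have src: "src \<Lambda> k = v n" "src \<Lambda> k' = v n"
      using less.prems(3,5) src_cmp[OF edge(2-4)] src_cmp[OF l'(1-3)] edge(5) l'(4) by simp_all
    have k: "k = k'"
      by (rule less.hyps[OF edge(7) less.prems(1) edge(3) src(1) l'(2) src(2) l'(6)[symmetric]])
    have "src \<Lambda> f = v (n + int (fst (deg \<Lambda> k)))"
      using tail_rng[OF less.prems(1) edge(3) src(1)] edge(4) by simp
    moreover from this have "src \<Lambda> f' = v (n + int (fst (deg \<Lambda> k)))" using k edge(4) l'(3) by simp
    ultimately have "f = f'"
      by (rule tail_edge_unique[rotated 3]) (use less.prems(1) edge(1) l'(1,5) in simp_all)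
    then show ?thesis using k edge(5) l'(4) by simp
  qed
qed

lemma tail_path_exists:
  assumes "N \<le> n" shows "\<exists>l. l \<in> mor \<Lambda> \<and> src \<Lambda> l = v n \<and> deg \<Lambda> l = (a, b)"
proof (induction b)
  case 0
  show ?case
  proof (induction a)
    case 0
    then show ?case using tail_mor[OF assms] identity_if_deg_0[of "v n"] by (auto simp: zero_prod_def)
  next
    case (Suc a)
    then obtain l where l: "l \<in> mor \<Lambda>" "src \<Lambda> l = v n" "deg \<Lambda> l = (a, 0)" by blast
    obtain f where "f \<in> blue_edges \<Lambda>" "src \<Lambda> f = rng \<Lambda> l"
      using tail_blue[of "n + int a"] tail_rng[OF assms l(1,2)] l(3) assms by auto
    then show ?case
      using l by (intro exI[of _ "cmp \<Lambda> f l"]) (simp add: blue_edges_def cmp_mor src_cmp deg_cmp)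
  qed
next
  case (Suc b)
  then obtain l where l: "l \<in> mor \<Lambda>" "src \<Lambda> l = v n" "deg \<Lambda> l = (a, b)" by blast
  obtain f where "f \<in> red_edges \<Lambda>" "src \<Lambda> f = rng \<Lambda> l"
    using tail_red[of "n + int a"] tail_rng[OF assms l(1,2)] l(3) assms by auto
  then show ?case
    using l by (intro exI[of _ "cmp \<Lambda> f l"]) (simp add: red_edges_def cmp_mor src_cmp deg_cmp)
qed

definition tail_path :: "int \<Rightarrow> nat \<times> nat \<Rightarrow> 'a" where
  "tail_path n p = (SOME l. l \<in> mor \<Lambda> \<and> src \<Lambda> l = v n \<and> deg \<Lambda> l = p)"

lemma tail_path:
  assumes "N \<le> n"
  shows "tail_path n p \<in> mor \<Lambda>" "src \<Lambda> (tail_path n p) = v n" "deg \<Lambda> (tail_path n p) = p"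
    "rng \<Lambda> (tail_path n p) = v (n + int (fst p))"
proof -
  have "tail_path n p \<in> mor \<Lambda> \<and> src \<Lambda> (tail_path n p) = v n \<and> deg \<Lambda> (tail_path n p) = p"
    unfolding tail_path_def by (rule someI_ex) (metis tail_path_exists[OF assms] surj_pair)
  then show "tail_path n p \<in> mor \<Lambda>" "src \<Lambda> (tail_path n p) = v n" "deg \<Lambda> (tail_path n p) = p"
    "rng \<Lambda> (tail_path n p) = v (n + int (fst p))" using tail_rng[OF assms] by auto
qed

lemma tail_path_eqI: "\<lbrakk>N \<le> n; l \<in> mor \<Lambda>; src \<Lambda> l = v n\<rbrakk> \<Longrightarrow> l = tail_path n (deg \<Lambda> l)"
  by (rule tail_path_unique[of n]) (auto simp: tail_path)

section \<open>Infinite paths and the path groupoid\<close>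

abbreviation "Y \<equiv> infinite_paths \<Lambda>"

lemma Omega2_simps [simp]:
  "(m, n) \<in> mor Omega2 \<longleftrightarrow> m \<le> n" "rng Omega2 (m, n) = (n, n)" "src Omega2 (m, n) = (m, m)"
  "cmp Omega2 (m, n) (k, l) = (k, n)" "deg Omega2 (m, n) = n - m"
  by (simp_all add: Omega2_def)

lemma path_mor:
  assumes "x \<in> Y" "m \<le> n"
  shows "x (m, n) \<in> mor \<Lambda>" "rng \<Lambda> (x (m, n)) = x (n, n)" "src \<Lambda> (x (m, n)) = x (m, m)" "deg \<Lambda> (x (m, n)) = n - m"
proof -
  have "two_graph_morphism Omega2 \<Lambda> x" using assms(1) by (simp add: infinite_paths_def)
  then have "\<forall>l\<in>mor Omega2. x l \<in> mor \<Lambda> \<and> rng \<Lambda> (x l) = x (rng Omega2 l) \<and>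
      src \<Lambda> (x l) = x (src Omega2 l) \<and> deg \<Lambda> (x l) = deg Omega2 l"
    unfolding two_graph_morphism_def by blast
  from bspec[OF this, of "(m, n)"] assms(2)
  show "x (m, n) \<in> mor \<Lambda>" "rng \<Lambda> (x (m, n)) = x (n, n)" "src \<Lambda> (x (m, n)) = x (m, m)" "deg \<Lambda> (x (m, n)) = n - m"
    by simp_all
qed

lemma path_cmp:
  assumes "x \<in> Y" "k \<le> m" "m \<le> n" shows "x (k, n) = cmp \<Lambda> (x (m, n)) (x (k, m))"
proof -
  have "two_graph_morphism Omega2 \<Lambda> x" using assms(1) by (simp add: infinite_paths_def)
  then have "\<forall>l\<in>mor Omega2. \<forall>m\<in>mor Omega2. src Omega2 l = rng Omega2 m \<longrightarrow> x (cmp Omega2 l m) = cmp \<Lambda> (x l) (x m)"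
    unfolding two_graph_morphism_def by blast
  from bspec[OF bspec[OF this, of "(m, n)"], of "(k, m)"] assms(2,3) show ?thesis by simp
qed

lemma path_ext:
  assumes "x \<in> Y" "y \<in> Y" "\<And>m n. m \<le> n \<Longrightarrow> x (m, n) = y (m, n)" shows "x = y"
proof
  fix l :: "(nat \<times> nat) \<times> (nat \<times> nat)"
  obtain m n where l: "l = (m, n)" by (cases l)
  have "x \<in> extensional (mor Omega2)" "y \<in> extensional (mor Omega2)" using assms by (simp_all add: infinite_paths_def)
  then show "x l = y l"
    using assms(3)[of m n] extensional_arb[of x "mor Omega2" l] extensional_arb[of y "mor Omega2" l]
    by (cases "m \<le> n") (simp_all add: l)
qed

section \<open>Levels of infinite paths and discreteness of the groupoid\<close>

definition level :: "'a ipath \<Rightarrow> int" where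
  "level x = (THE n. x (0, 0) \<in> V n)"

lemma level: "x \<in> Y \<Longrightarrow> x (m, m) \<in> V (level x + int (fst m))"
proof -
  assume x: "x \<in> Y"
  have "x (0, 0) \<in> vertices \<Lambda>" using path_mor[OF x, of 0 0] by (simp add: vertices_def)
  then obtain n where "x (0, 0) \<in> V n" using vertices_eq by blast
  then have "level x = n" unfolding level_def using V_unique by blast
  moreover have "(0 :: nat \<times> nat) \<le> m" by (simp add: less_eq_prod_def)
  ultimately show ?thesis
    using rng_level[of "x (0, m)" n] path_mor[OF x, of 0 m] \<open>x (0, 0) \<in> V n\<close> by simp
qed

lemma path_tail:
  assumes x: "x \<in> Y" and "N \<le> level x + int (fst m)" "m \<le> n"
  shows "x (m, n) = tail_path (level x + int (fst m)) (n - m)"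
proof -
  have "src \<Lambda> (x (m, n)) = v (level x + int (fst m))"
    using path_mor[OF x \<open>m \<le> n\<close>] level[OF x, of m] tail_vertex[OF assms(2)] by simp
  then show ?thesis using tail_path_eqI[OF assms(2)] path_mor[OF x \<open>m \<le> n\<close>] by metis
qed

lemma path_determined:
  assumes x: "x \<in> Y" and y: "y \<in> Y" and eq: "x (0, p) = y (0, p)" and p: "N \<le> level x + int (fst p)"
  shows "x = y"
proof (rule path_ext[OF x y])
  fix m n :: "nat \<times> nat" assume mn: "m \<le> n"
  have zero: "0 \<le> k" for k :: "nat \<times> nat" by (simp add: less_eq_prod_def)
  have "x (0, 0) = y (0, 0)"
    using path_mor(3)[OF x zero, of p] path_mor(3)[OF y zero, of p] eq by simp
  then have lev: "level x = level y" by (simp add: level_def)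
  \<comment> \<open>\<open>q\<close> lies above both \<open>p\<close> and \<open>n\<close>. The
    segments up to \<open>q\<close> agree because beyond \<open>p\<close> both paths follow the
    tail; unique factorisation then cuts them at \<open>n\<close> and at \<open>m\<close>.\<close>
  define q where "q = n + p"
  have q: "n \<le> q" "p \<le> q" by (auto simp: q_def less_eq_prod_def)
  have "x (p, q) = y (p, q)"
    using path_tail[OF x p q(2)] path_tail[OF y _ q(2)] p lev by simp
  then have q_eq: "x (0, q) = y (0, q)"
    using path_cmp[OF x zero q(2)] path_cmp[OF y zero q(2)] eq by simp
  have "x (n, q) = y (n, q) \<and> x (0, n) = y (0, n)"
    by (rule factor_unique) (use path_mor[OF x q(1)] path_mor[OF y q(1)] path_mor[OF x zero, of n] path_mor[OF y zero, of n]
      path_cmp[OF x zero q(1)] path_cmp[OF y zero q(1)] q_eq in simp_all)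
  then have n_eq: "x (0, n) = y (0, n)" by blast
  have "x (m, n) = y (m, n) \<and> x (0, m) = y (0, m)"
    by (rule factor_unique) (use path_mor[OF x mn] path_mor[OF y mn] path_mor[OF x zero, of m] path_mor[OF y zero, of m]
      path_cmp[OF x zero mn] path_cmp[OF y zero mn] n_eq in simp_all)
  then show "x (m, n) = y (m, n)" by blast
qed

text \<open>From level \<open>N\<close> on, a segment is determined by its starting level and its
  degree. The red coordinates of \<open>p\<close> and \<open>q\<close> are unconstrained, which is
  why every integer \<open>j\<close> occurs.\<close>

lemma shift_eq_iff:
  assumes x: "x \<in> Y" and y: "y \<in> Y" and p: "N \<le> level x + int (fst p)"
    and eq: "level x + int (fst p) = level y + int (fst q)"
  shows "shift p x = shift q y"
proof
  fix l :: "(nat \<times> nat) \<times> (nat \<times> nat)"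
  obtain m n where l: "l = (m, n)" by (cases l)
  have "x (m + p, n + p) = y (m + q, n + q)" if "m \<le> n"
  proof -
    have le: "m + p \<le> n + p" "m + q \<le> n + q" using that by (simp_all add: less_eq_prod_def)
    have N: "N \<le> level x + int (fst (m + p))" "N \<le> level y + int (fst (m + q))" using p eq by auto
    have "level x + int (fst (m + p)) = level y + int (fst (m + q))" using eq by simp
    moreover have "n + p - (m + p) = n + q - (m + q)" by (simp add: minus_prod_def prod_eq_iff)
    ultimately show ?thesis unfolding path_tail[OF x N(1) le(1)] path_tail[OF y N(2) le(2)] by (simp only:)
  qed
  then show "shift p x l = shift q y l" by (simp add: shift_def l)
qed

text \<open>Equal shifts start at the same vertex, and a vertex has only one level.\<close>

lemma shift_eq_level:
  assumes x: "x \<in> Y" and y: "y \<in> Y" and eq: "shift p x = shift q y"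
  shows "level x + int (fst p) = level y + int (fst q)"
proof -
  have "shift p x (0, 0) = shift q y (0, 0)" by (simp add: eq)
  then have "x (p, p) = y (q, q)" by (simp add: shift_def)
  then show ?thesis using level[OF x, of p] level[OF y, of q] V_unique by simp
qed

lemma arrows_path_groupoid_UN: "arrows (path_groupoid \<Lambda>) = (\<Union>p q. path_bisets Y p q Y)"
  by (simp add: path_groupoid_def)

lemma arrows_path_groupoid:
  "arrows (path_groupoid \<Lambda>) = {(x, (level y - level x, j :: int), y) |x j y. x \<in> Y \<and> y \<in> Y}"
proof (intro equalityI subsetI)
  fix g assume "g \<in> arrows (path_groupoid \<Lambda>)"
  then obtain p q x y where g: "g = (x, int_diff p q, y)" "x \<in> Y" "y \<in> Y" "shift p x = shift q y"
    by (auto simp: path_groupoid_def path_bisets_def)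
  then show "g \<in> {(x, (level y - level x, j :: int), y) |x j y. x \<in> Y \<and> y \<in> Y}"
    using shift_eq_level[OF g(2-4)] by (auto simp: int_diff_def)
next
  fix g assume "g \<in> {(x, (level y - level x, j :: int), y) |x j y. x \<in> Y \<and> y \<in> Y}"
  then obtain x y and j :: int where g: "g = (x, (level y - level x, j), y)" "x \<in> Y" "y \<in> Y" by blast
  \<comment> \<open>Blue shifts bring both paths to the common level \<open>M\<close> in the tail.
    The positive and negative parts of \<open>j\<close> serve as red shifts, which do not affect the
    level.\<close>
  define M where "M = max N (max (level x) (level y))"
  define p where "p = (nat (M - level x), nat j)"
  define q where "q = (nat (M - level y), nat (- j))"
  have "shift p x = shift q y" by (rule shift_eq_iff) (use g in \<open>auto simp: p_def q_def M_def\<close>)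
  moreover have "int_diff p q = (level y - level x, j)" by (auto simp: int_diff_def p_def q_def M_def)
  ultimately have "g \<in> path_bisets Y p q Y" using g unfolding path_bisets_def by force
  then show "g \<in> arrows (path_groupoid \<Lambda>)" unfolding arrows_path_groupoid_UN by blast
qed

lemma topspace_path_topology: "topspace (path_topology \<Lambda>) = Y"
proof -
  have "x \<in> cylinder \<Lambda> (x (0, 0)) \<and> x (0, 0) \<in> mor \<Lambda>" if "x \<in> Y" for x
    using that path_mor[OF that, of 0 0] by (simp add: cylinder_def)
  then show ?thesis unfolding path_topology_def topology_generated_by_topspace by (auto simp: cylinder_def)
qed

text \<open>The segment of \<open>x\<close> that reaches level \<open>N\<close> determines
  \<open>x\<close>, so its cylinder contains no other path.\<close>

lemma openin_singleton_path: "x \<in> Y \<Longrightarrow> openin (path_topology \<Lambda>) {x}"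
proof -
  assume x: "x \<in> Y"
  define p where "p = (nat (N - level x), 0 :: nat)"
  have p: "N \<le> level x + int (fst p)" by (simp add: p_def)
  have zero: "0 \<le> p" by (simp add: less_eq_prod_def)
  have "cylinder \<Lambda> (x (0, p)) = {x}"
    using x path_mor[OF x zero] by (auto simp: cylinder_def intro!: path_determined[OF x _ _ p, symmetric])
  then show ?thesis
    unfolding path_topology_def using path_mor(1)[OF x zero] by (metis imageI topology_generated_by_Basis)
qed

lemma gtop_path_groupoid: "gtop (path_groupoid \<Lambda>) = discrete_topology (arrows (path_groupoid \<Lambda>))"
proof -
  let ?B = "{path_bisets U p q W |U p q W. openin (path_topology \<Lambda>) U \<and> openin (path_topology \<Lambda>) W}"
  have gtop: "gtop (path_groupoid \<Lambda>) = topology_generated_by ?B" by (simp add: path_groupoid_def)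
  have "\<Union>?B = arrows (path_groupoid \<Lambda>)"
  proof (intro equalityI subsetI)
    fix g assume "g \<in> \<Union>?B"
    then obtain S where "g \<in> S" "S \<in> ?B" by (rule UnionE)
    from this(2) obtain U p q W where "S = path_bisets U p q W"
      and g: "openin (path_topology \<Lambda>) U" "openin (path_topology \<Lambda>) W" by (elim CollectE exE conjE)
    then have "g \<in> path_bisets U p q W" using \<open>g \<in> S\<close> by simp
    moreover have "U \<subseteq> Y" "W \<subseteq> Y" using openin_subset[OF g(1)] openin_subset[OF g(2)] by (simp_all add: topspace_path_topology)
    then have "path_bisets U p q W \<subseteq> path_bisets Y p q Y" unfolding path_bisets_def by blast
    ultimately show "g \<in> arrows (path_groupoid \<Lambda>)" unfolding arrows_path_groupoid_UN by blast
  next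
    fix g assume "g \<in> arrows (path_groupoid \<Lambda>)"
    moreover have "openin (path_topology \<Lambda>) Y" using openin_topspace[of "path_topology \<Lambda>"] by (simp add: topspace_path_topology)
    ultimately show "g \<in> \<Union>?B" unfolding arrows_path_groupoid_UN by blast
  qed
  moreover have "openin (topology_generated_by ?B) {g}" if "g \<in> arrows (path_groupoid \<Lambda>)" for g
  proof -
    from that obtain p q x y where g: "g = (x, int_diff p q, y)" "x \<in> Y" "y \<in> Y" "shift p x = shift q y"
      by (auto simp: path_groupoid_def path_bisets_def)
    \<comment> \<open>Singletons of paths are open, so this is a basic open set containing a single
      arrow.\<close>
    then have "{g} = path_bisets {x} p q {y}" by (auto simp: path_bisets_def)
    then have "{g} \<in> ?B" using openin_singleton_path g by blast
    then show ?thesis by (rule topology_generated_by_Basis)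
  qed
  ultimately have "discrete_topology (arrows (path_groupoid \<Lambda>)) = topology_generated_by ?B"
    unfolding discrete_topology_unique topology_generated_by_topspace by blast
  then show ?thesis using gtop by simp
qed

text \<open>The infinite path that starts at \<open>v N\<close>. It shows that the path space is
  inhabited and serves as base point of the corner.\<close>

definition tail_ipath :: "'a ipath" where
  "tail_ipath = restrict (\<lambda>(m, n). tail_path (N + int (fst m)) (n - m)) (mor Omega2)"

lemma tail_infinite_path: "tail_ipath \<in> Y"
proof -
  have tail_apply: "tail_ipath (m, n) = tail_path (N + int (fst m)) (n - m)" if "m \<le> n" for m n
    using that by (simp add: tail_ipath_def)
  have diag: "tail_ipath (m, m) = v (N + int (fst m))" for m
  proof -
    have "v (N + int (fst m)) = tail_path (N + int (fst m)) (deg \<Lambda> (v (N + int (fst m))))"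
      by (rule tail_path_eqI) (use tail_mor[of "N + int (fst m)"] identity_if_deg_0 in auto)
    then show ?thesis using tail_mor[of "N + int (fst m)"] by (simp add: tail_apply)
  qed
  have "two_graph_morphism Omega2 \<Lambda> tail_ipath"
    unfolding two_graph_morphism_def
  proof (intro conjI ballI impI)
    fix l assume "l \<in> mor Omega2"
    then obtain m n where l: "l = (m, n)" "m \<le> n" by (cases l) auto
    have "N + int (fst m) + int (fst (n - m)) = N + int (fst n)" using l(2) by (simp add: less_eq_prod_def)
    then show "tail_ipath l \<in> mor \<Lambda>" "rng \<Lambda> (tail_ipath l) = tail_ipath (rng Omega2 l)" "src \<Lambda> (tail_ipath l) = tail_ipath (src Omega2 l)"
        "deg \<Lambda> (tail_ipath l) = deg Omega2 l"
      using l(2) by (simp_all add: l(1) diag tail_path tail_apply)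
    fix l' assume "l' \<in> mor Omega2" and src: "src Omega2 l = rng Omega2 l'"
    then obtain k where l': "l' = (k, m)" "k \<le> m" by (cases l') (auto simp: l(1))
    have km: "N + int (fst k) + int (fst (m - k)) = N + int (fst m)" using l'(2) by (simp add: less_eq_prod_def)
    have d: "n - m + (m - k) = n - k" using l(2) l'(2) by (cases k; cases m; cases n) (simp add: less_eq_prod_def)
    \<comment> \<open>Functoriality follows from uniqueness: the composite is a path from a tail
      vertex, hence the tail path of its degree.\<close>
    have "cmp \<Lambda> (tail_ipath (m, n)) (tail_ipath (k, m)) = tail_path (N + int (fst k)) (deg \<Lambda> (cmp \<Lambda> (tail_ipath (m, n)) (tail_ipath (k, m))))"
      by (rule tail_path_eqI) (use l(2) l'(2) km in \<open>simp_all add: tail_apply tail_path cmp_mor src_cmp\<close>)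
    also have "deg \<Lambda> (cmp \<Lambda> (tail_ipath (m, n)) (tail_ipath (k, m))) = n - k"
      using l(2) l'(2) km d by (simp add: tail_apply tail_path deg_cmp)
    finally show "tail_ipath (cmp Omega2 l l') = cmp \<Lambda> (tail_ipath l) (tail_ipath l')"
      using order_trans[OF l'(2) l(2)] by (simp add: l(1) l'(1) tail_apply)
  qed
  then show ?thesis by (simp add: infinite_paths_def tail_ipath_def)
qed

lemma morita_equivalent_two_graph_cstar: "morita_equivalent (two_graph_cstar \<Lambda>) circle_algebra"
proof -
  interpret P: pointed_triple_groupoid Y level "path_groupoid \<Lambda>" tail_ipath
    by unfold_locales
      (auto simp: arrows_path_groupoid gtop_path_groupoid tail_infinite_path, auto simp: path_groupoid_def)
  show ?thesis unfolding two_graph_cstar_def by (rule P.morita_equivalent_groupoid_cstar)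
qed

end

section \<open>Red cycles and the tail of the given graph\<close>

lemma red_cycle_loop:
  assumes "e \<in> red_edges \<Lambda>" "src \<Lambda> e = rng \<Lambda> e" "src \<Lambda> e \<in> vertices \<Lambda>"
  shows "red_cycle \<Lambda> {e}" "cycle_vertices \<Lambda> {e} = {src \<Lambda> e}"
proof -
  interpret pre_digraph "red_graph \<Lambda>" .
  have "verts (red_graph \<Lambda>) = vertices \<Lambda>" "arcs (red_graph \<Lambda>) = red_edges \<Lambda>"
      "tail (red_graph \<Lambda>) = src \<Lambda>" "head (red_graph \<Lambda>) = rng \<Lambda>"
    by (simp_all add: red_graph_def)
  then have "cycle [e]" using assms by (simp add: cycle_def awalk_def)
  then show "red_cycle \<Lambda> {e}" unfolding red_cycle_def by (intro exI[of _ "[e]"]) simp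
  show "cycle_vertices \<Lambda> {e} = {src \<Lambda> e}" by (simp add: cycle_vertices_def)
qed

lemma red_cycle_edges: "red_cycle \<Lambda> C \<Longrightarrow> C \<subseteq> red_edges \<Lambda>"
  unfolding red_cycle_def by (auto simp: pre_digraph.cycle_def pre_digraph.awalk_def red_graph_def)

theorem corollary7p4:
  fixes \<Lambda> :: "'a two_graph" and V :: "int \<Rightarrow> 'a set"
  assumes "two_graph \<Lambda>"
    and "row_finite \<Lambda>"
    and no_sources: "\<And>v. v \<in> vertices \<Lambda> \<Longrightarrow> \<not> is_source \<Lambda> v"
    and "vertices \<Lambda> = (\<Union>n. V n)"
    and "disjoint_family V"
    and "\<And>n. V n \<noteq> {}"
    and "\<And>n. finite (V n)"
    and blue: "\<And>f. f \<in> blue_edges \<Lambda> \<Longrightarrow> \<exists>n. src \<Lambda> f \<in> V n \<and> rng \<Lambda> f \<in> V (n + 1)"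
    and red_cycles: "\<And>n v. v \<in> V n \<Longrightarrow>
          (\<exists>!C. red_cycle \<Lambda> C \<and> v \<in> cycle_vertices \<Lambda> C) \<and>
          (\<forall>C. red_cycle \<Lambda> C \<and> v \<in> cycle_vertices \<Lambda> C \<longrightarrow> cycle_vertices \<Lambda> C \<subseteq> V n)"
    and red: "\<And>e. e \<in> red_edges \<Lambda> \<Longrightarrow> \<exists>n. src \<Lambda> e \<in> V n \<and> rng \<Lambda> e \<in> V n"
    and eventually_one: "\<exists>N. \<forall>n\<ge>N. card (V n) = 1 \<and>
          (\<exists>!f. f \<in> blue_edges \<Lambda> \<and> src \<Lambda> f \<in> V n \<and> rng \<Lambda> f \<in> V (n + 1))"
  shows "morita_equivalent (two_graph_cstar \<Lambda>) circle_algebra"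
proof -
  interpret two_graph \<Lambda> by fact
  from eventually_one obtain N where N0: "\<forall>n\<ge>N. card (V n) = 1 \<and>
      (\<exists>!f. f \<in> blue_edges \<Lambda> \<and> src \<Lambda> f \<in> V n \<and> rng \<Lambda> f \<in> V (n + 1))" ..
  have N: "card (V n) = 1" "\<exists>!f. f \<in> blue_edges \<Lambda> \<and> src \<Lambda> f \<in> V n \<and> rng \<Lambda> f \<in> V (n + 1)" if "N \<le> n" for n
    using mp[OF spec[OF N0, of n] that] by (rule conjunct1, rule conjunct2)
  define v where "v n = the_elem (V n)" for n
  have Vv: "V n = {v n}" if "N \<le> n" for n
    using card_1_singletonE[OF N(1)[OF that]] unfolding v_def by (metis the_elem_eq)
  have V_unique: "m = n" if "w \<in> V m" "w \<in> V n" for w m n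
    using \<open>disjoint_family V\<close> that by (auto simp: disjoint_family_on_def)
  \<comment> \<open>The hypothesis counts edges from \<open>V n\<close> to \<open>V (n + 1)\<close>.
    By the grading and disjointness every blue edge with source in \<open>V n\<close> is of this
    kind, so it counts all blue edges that leave \<open>v n\<close>.\<close>
  have blue_tail: "\<exists>!f. f \<in> blue_edges \<Lambda> \<and> src \<Lambda> f = v n" if n: "N \<le> n" for n
  proof -
    have "rng \<Lambda> f \<in> V (n + 1)" if f: "f \<in> blue_edges \<Lambda>" "src \<Lambda> f \<in> V n" for f
    proof -
      obtain m where m: "src \<Lambda> f \<in> V m" "rng \<Lambda> f \<in> V (m + 1)" using blue[OF f(1)] by blast
      then show ?thesis using V_unique[OF f(2) m(1)] by simp
    qed
    moreover have "src \<Lambda> f = v n \<longleftrightarrow> src \<Lambda> f \<in> V n" for f by (simp add: Vv[OF n])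
    ultimately have "f \<in> blue_edges \<Lambda> \<and> src \<Lambda> f = v n \<longleftrightarrow>
        f \<in> blue_edges \<Lambda> \<and> src \<Lambda> f \<in> V n \<and> rng \<Lambda> f \<in> V (n + 1)" for f
      by blast
    then show ?thesis using N(2)[OF n] by (simp only:)
  qed
  have red_tail: "\<exists>!e. e \<in> red_edges \<Lambda> \<and> src \<Lambda> e = v n" if n: "N \<le> n" for n
  proof -
    have vn: "v n \<in> V n" using Vv[OF n] by simp
    then have vv: "v n \<in> vertices \<Lambda>" using \<open>vertices \<Lambda> = (\<Union>n. V n)\<close> by blast
    obtain C where C: "red_cycle \<Lambda> C" "v n \<in> cycle_vertices \<Lambda> C"
      and unique: "\<And>C'. red_cycle \<Lambda> C' \<Longrightarrow> v n \<in> cycle_vertices \<Lambda> C' \<Longrightarrow> C' = C"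
      using conjunct1[OF red_cycles[OF vn]] by (elim ex1E) blast
    obtain e where e: "e \<in> C" "src \<Lambda> e = v n" using C(2) by (auto simp: cycle_vertices_def)
    \<comment> \<open>A red edge leaving \<open>v n\<close> stays in \<open>V n\<close>, whose only
      vertex is \<open>v n\<close>, so it is a loop. A loop is a red cycle through
      \<open>v n\<close> and therefore equals the unique one.\<close>
    have "{e'} = C" if e': "e' \<in> red_edges \<Lambda>" "src \<Lambda> e' = v n" for e'
    proof (rule unique)
      obtain m where m: "src \<Lambda> e' \<in> V m" "rng \<Lambda> e' \<in> V m" using red[OF e'(1)] by blast
      have "m = n" using V_unique[OF m(1)] vn e'(2) by simp
      then have "rng \<Lambda> e' = v n" using m(2) Vv[OF n] by simp
      with red_cycle_loop[of e' \<Lambda>] e' vv show "red_cycle \<Lambda> {e'}" "v n \<in> cycle_vertices \<Lambda> {e'}" by simp_all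
    qed
    then show ?thesis using e red_cycle_edges[OF C(1)] by blast
  qed
  interpret tail_graded_two_graph \<Lambda> V N v
    by unfold_locales (fact assms(4), fact assms(5), erule blue, erule red, erule Vv, erule blue_tail, erule red_tail)
  show ?thesis by (rule morita_equivalent_two_graph_cstar)
qed

end
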